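(* Let $I\subset T^*M$ be a Pfaffian system of rank $r$. Suppose that the annihilator $E^1(\mathcal I)=\mathrm{ann}(I)\subset TM$ decomposes as a direct sum $S_1\oplus S_2$ of subbundles of ranks $p$ and $q$ such that (i) every non-zero vector in $S_1$ and every non-zero vector in $S_2$ is singular for $\mathcal I$; and (ii) every 2-plane spanned by a pair of vectors $X\in S_1$ and $Y\in S_2$ (at the same point) is an integral 2-plane of $\mathcal I$. Choose local coframes $\theta^1,\dots,\theta^r,\hat\sigma^1,\dots,\hat\sigma^p,\check\sigma^1,\dots,\check\sigma^q$ with $I=\mathrm{span}\{\theta^i\}$, with $\hat\sigma^a$ vanishing on $S_2$ and $\check\sigma^\alpha$ vanishing on $S_1$, so that $$d\theta^i\equiv A^i_{ab}\,\hat\sigma^a\wedge\hat\sigma^b+B^i_{\alpha\beta}\,\check\sigma^\alpha\wedge\check\sigma^\beta\mod I ,$$ and at each point $x_0$ let $A=[A^i_{ab}(x_0)]\colon\mathbb R^r\to\Lambda^2(\mathbb R^p)$ and $B=[B^i_{\alpha\beta}(x_0)]\colon\mathbb R^r\to\Lambda^2(\mathbb R^q)$ be the linear maps $(t_i)\mapsto t_iA^i_{ab}$ and $(t_i)\mapsto t_iB^i_{\alpha\beta}$. If $A$ and $B$ are non-zero and of constant rank, and $$\dim\big(\ker(A)+\ker(B)\big)=\operatorname{rank} I$$ at each point, then $I$ (that is, the differential system $\mathcal I$ it generates) is decomposable.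
   Context: A Pfaffian system is a constant rank subbundle $I\subset T^*M$; $\mathcal I$ is the differential ideal generated by its sections. For a differential system $\mathcal I$, $E^1_x(\mathcal I)=\{X\in T_xM:\theta(X)=0\text{ for all 1-forms }\theta\in\mathcal I\}$. The polar equations of a non-zero $X\in E^1_x(\mathcal I)$ are the linear equations $\theta(X,Y)=0$, for all 2-forms $\theta\in\mathcal I$, in the unknown $Y\in E^1_x(\mathcal I)$; $X$ is regular if the rank of its polar equations is maximal (among non-zero vectors in $E^1_x(\mathcal I)$), and singular otherwise. A differential system $\mathcal I$ is decomposable (of type $[p,q]$, $p,q\ge2$) if about each point there is a coframe $\tilde\theta^1,\dots,\tilde\theta^r,\hat\sigma^1,\dots,\hat\sigma^p,\check\sigma^1,\dots,\check\sigma^q$ such that $\mathcal I$ is algebraically generated by the 1-forms and 2-forms $\{\tilde\theta^1,\dots,\tilde\theta^r,\hat\Omega^1,\dots,\hat\Omega^s,\check\Omega^1,\dots,\check\Omega^t\}$, where $s,t\ge1$, each $\hat\Omega^a$ is a combination (with function coefficients) of the $\hat\sigma^b\wedge\hat\sigma^c$, and each $\check\Omega^\alpha$ is a combination of the $\check\sigma^\beta\wedge\check\sigma^\gamma$. *)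

theory Defs
  imports "HOL-Analysis.Analysis" "HOL-Library.Function_Algebras"
begin

section \<open>Smooth maps between open subsets of normed spaces\<close>

fun Ck_on :: "nat \<Rightarrow> 'a::real_normed_vector set \<Rightarrow> ('a \<Rightarrow> 'b::real_normed_vector) \<Rightarrow> bool" where
  "Ck_on 0 S f \<longleftrightarrow> continuous_on S f"
| "Ck_on (Suc k) S f \<longleftrightarrow>
     (\<forall>x\<in>S. f differentiable (at x)) \<and> (\<forall>v. Ck_on k S (\<lambda>x. frechet_derivative f (at x) v))"

definition smooth_on :: "'a::real_normed_vector set \<Rightarrow> ('a \<Rightarrow> 'b::real_normed_vector) \<Rightarrow> bool" where
  "smooth_on S f \<longleftrightarrow> (\<forall>k. Ck_on k S f)"


section \<open>Manifolds\<close>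

text \<open>A chart is a pair of a domain and a coordinate map. The manifold is the topological space
  \<open>mtop M\<close> with the smooth atlas \<open>charts M\<close>; its dimension is \<open>DIM('e)\<close>.\<close>

type_synonym ('m, 'e) chart = "'m set \<times> ('m \<Rightarrow> 'e)"

record ('m, 'e) manifold =
  mtop :: "'m topology"
  charts :: "('m, 'e) chart set"

abbreviation pts :: "('m, 'e) manifold \<Rightarrow> 'm set" where
  "pts M \<equiv> topspace (mtop M)"

abbreviation open_in :: "('m, 'e) manifold \<Rightarrow> 'm set \<Rightarrow> bool" where
  "open_in M U \<equiv> openin (mtop M) U"

definition chart_inv :: "('m, 'e) chart \<Rightarrow> 'e \<Rightarrow> 'm" where
  "chart_inv c = inv_into (fst c) (snd c)"

definition smooth_manifold :: "('m, 'e::euclidean_space) manifold \<Rightarrow> bool" where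
  "smooth_manifold M \<longleftrightarrow>
     Hausdorff_space (mtop M) \<and> second_countable (mtop M) \<and>
     pts M = (\<Union>c\<in>charts M. fst c) \<and>
     (\<forall>c\<in>charts M. open_in M (fst c) \<and> open (snd c ` fst c) \<and>
        homeomorphic_map (subtopology (mtop M) (fst c)) (top_of_set (snd c ` fst c)) (snd c)) \<and>
     (\<forall>c\<in>charts M. \<forall>c'\<in>charts M.
        smooth_on (snd c ` (fst c \<inter> fst c')) (snd c' \<circ> chart_inv c))"

text \<open>Tangent vectors at \<open>x\<close> are written in the coordinates of one chart around \<open>x\<close>, selected once
  and for all; in this way the tangent space at \<open>x\<close> is the vector space \<open>'e\<close>, and the cotangent
  space is its dual \<open>'e \<Rightarrow>\<^sub>L real\<close>. The differential of the coordinate change passes from the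
  selected chart to any other chart around \<open>x\<close>. As the selected chart varies with \<open>x\<close> in an
  arbitrary way, smoothness of fields and forms is always expressed in the charts of the atlas.\<close>

definition chart_at :: "('m, 'e) manifold \<Rightarrow> 'm \<Rightarrow> ('m, 'e) chart" where
  "chart_at M x = (SOME c. c \<in> charts M \<and> x \<in> fst c)"

definition coord_change ::
  "('m, 'e::euclidean_space) chart \<Rightarrow> ('m, 'e) chart \<Rightarrow> 'm \<Rightarrow> 'e \<Rightarrow> 'e" where
  "coord_change c c' x = frechet_derivative (snd c' \<circ> chart_inv c) (at (snd c x))"

definition smooth_fun :: "('m, 'e::euclidean_space) manifold \<Rightarrow> 'm set \<Rightarrow> ('m \<Rightarrow> real) \<Rightarrow> bool" where
  "smooth_fun M U f \<longleftrightarrow> (\<forall>c\<in>charts M. smooth_on (snd c ` (fst c \<inter> U)) (f \<circ> chart_inv c))"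

definition smooth_vector_field ::
  "('m, 'e::euclidean_space) manifold \<Rightarrow> 'm set \<Rightarrow> ('m \<Rightarrow> 'e) \<Rightarrow> bool" where
  "smooth_vector_field M U X \<longleftrightarrow>
     (\<forall>c\<in>charts M. smooth_on (snd c ` (fst c \<inter> U))
        ((\<lambda>x. coord_change (chart_at M x) c x (X x)) \<circ> chart_inv c))"

text \<open>Rank \<open>k\<close> subbundles of the tangent bundle.\<close>

definition tangent_subbundle ::
  "('m, 'e::euclidean_space) manifold \<Rightarrow> nat \<Rightarrow> ('m \<Rightarrow> 'e set) \<Rightarrow> bool" where
  "tangent_subbundle M k S \<longleftrightarrow>
     (\<forall>x\<in>pts M. subspace (S x) \<and> dim (S x) = k \<and>
        (\<exists>U X. open_in M U \<and> x \<in> U \<and> (\<forall>i<k. smooth_vector_field M U (X i)) \<and>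
               (\<forall>y\<in>U. span ((\<lambda>i. X i y) ` {..<k}) = S y)))"


section \<open>Differential forms\<close>

text \<open>An alternating form of mixed degree on \<open>'e\<close> is a function on finite lists of vectors, whose
  restriction to the lists of length \<open>k\<close> is the component of degree \<open>k\<close>. (Components of degree
  above \<open>DIM('e)\<close> vanish automatically.)\<close>

definition alternating_form :: "('e::real_vector list \<Rightarrow> real) \<Rightarrow> bool" where
  "alternating_form \<alpha> \<longleftrightarrow>
     (\<forall>vs. \<forall>i<length vs. linear (\<lambda>v. \<alpha> (vs[i := v]))) \<and>
     (\<forall>vs. \<forall>j<length vs. \<forall>i<j. vs ! i = vs ! j \<longrightarrow> \<alpha> vs = 0)"

text \<open>The wedge product is the sum over shuffles, so that
  \<open>(\<alpha> \<and> \<beta>)(v, w) = \<alpha>(v) \<beta>(w) - \<alpha>(w) \<beta>(v)\<close> for 1-forms: the indices in \<open>S\<close> are fed to the left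
  factor, and the sign is that of the shuffle which moves them to the front.\<close>

definition shuffle_sign :: "nat set \<Rightarrow> nat \<Rightarrow> real" where
  "shuffle_sign S n = (- 1) ^ card {(i, j). i \<in> S \<and> j \<in> {..<n} - S \<and> j < i}"

definition wedge_pt :: "('e list \<Rightarrow> real) \<Rightarrow> ('e list \<Rightarrow> real) \<Rightarrow> 'e list \<Rightarrow> real" where
  "wedge_pt \<alpha> \<beta> vs =
     (\<Sum>S\<in>Pow {..<length vs}. shuffle_sign S (length vs) * \<alpha> (nths vs S) * \<beta> (nths vs (- S)))"

text \<open>Exterior derivative on an open subset of \<open>'e\<close>; \<open>nths vs (- {i})\<close> omits the \<open>i\<close>-th vector.\<close>

definition ext_deriv_eucl ::
  "('e::real_normed_vector \<Rightarrow> 'e list \<Rightarrow> real) \<Rightarrow> 'e \<Rightarrow> 'e list \<Rightarrow> real" where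
  "ext_deriv_eucl \<omega> y vs =
     (\<Sum>i<length vs. (- 1) ^ i * frechet_derivative (\<lambda>z. \<omega> z (nths vs (- {i}))) (at y) (vs ! i))"

type_synonym ('m, 'e) form = "'m \<Rightarrow> 'e list \<Rightarrow> real"

definition chart_rep ::
  "('m, 'e::euclidean_space) manifold \<Rightarrow> ('m, 'e) chart \<Rightarrow> ('m, 'e) form \<Rightarrow> 'e \<Rightarrow> 'e list \<Rightarrow> real" where
  "chart_rep M c \<omega> y vs =
     (let x = chart_inv c y in \<omega> x (map (coord_change c (chart_at M x) x) vs))"

text \<open>The smooth forms on an open set \<open>U\<close>, extended by 0 outside \<open>U\<close> so that forms on \<open>U\<close> which
  agree on \<open>U\<close> are equal.\<close>

definition forms :: "('m, 'e::euclidean_space) manifold \<Rightarrow> 'm set \<Rightarrow> ('m, 'e) form set" where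
  "forms M U =
     {\<omega>. (\<forall>x. x \<notin> U \<longrightarrow> \<omega> x = 0) \<and> (\<forall>x\<in>U. alternating_form (\<omega> x)) \<and>
         (\<forall>c\<in>charts M. \<forall>vs. smooth_on (snd c ` (fst c \<inter> U)) (\<lambda>y. chart_rep M c \<omega> y vs))}"

definition homogeneous :: "nat \<Rightarrow> ('m, 'e) form \<Rightarrow> bool" where
  "homogeneous k \<omega> \<longleftrightarrow> (\<forall>x vs. length vs \<noteq> k \<longrightarrow> \<omega> x vs = 0)"

definition wedge :: "('m, 'e) form \<Rightarrow> ('m, 'e) form \<Rightarrow> ('m, 'e) form" (infixr "\<and>\<^sub>f" 70) where
  "(\<alpha> \<and>\<^sub>f \<beta>) = (\<lambda>x. wedge_pt (\<alpha> x) (\<beta> x))"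

definition scale_form :: "('m \<Rightarrow> real) \<Rightarrow> ('m, 'e) form \<Rightarrow> ('m, 'e) form" (infixr "*\<^sub>f" 75) where
  "(f *\<^sub>f \<omega>) = (\<lambda>x vs. f x * \<omega> x vs)"

definition ext_deriv ::
  "('m, 'e::euclidean_space) manifold \<Rightarrow> 'm set \<Rightarrow> ('m, 'e) form \<Rightarrow> ('m, 'e) form" where
  "ext_deriv M U \<omega> =
     (\<lambda>x vs. if x \<in> U
             then let c = chart_at M x in ext_deriv_eucl (chart_rep M c \<omega>) (snd c x) vs
             else 0)"

text \<open>The 1-form on \<open>U\<close> given by a field of covectors.\<close>

definition form1 :: "'m set \<Rightarrow> ('m \<Rightarrow> 'e::euclidean_space \<Rightarrow>\<^sub>L real) \<Rightarrow> ('m, 'e) form" where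
  "form1 U \<eta> = (\<lambda>x vs. if x \<in> U \<and> length vs = 1 then \<eta> x (hd vs) else 0)"

text \<open>Coframes on \<open>U\<close>, indexed by \<open>K\<close>.\<close>

definition coframe_on ::
  "('m, 'e::euclidean_space) manifold \<Rightarrow> 'm set \<Rightarrow> 'k set \<Rightarrow> ('k \<Rightarrow> 'm \<Rightarrow> 'e \<Rightarrow>\<^sub>L real) \<Rightarrow> bool" where
  "coframe_on M U K \<eta> \<longleftrightarrow>
     (\<forall>k\<in>K. form1 U (\<eta> k) \<in> forms M U) \<and>
     (\<forall>x\<in>U. inj_on (\<lambda>k. \<eta> k x) K \<and> independent ((\<lambda>k. \<eta> k x) ` K) \<and>
            span ((\<lambda>k. \<eta> k x) ` K) = UNIV)"


section \<open>Differential systems\<close>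

text \<open>A two-sided ideal of the algebra of forms on \<open>U\<close>.\<close>

definition form_ideal ::
  "('m, 'e::euclidean_space) manifold \<Rightarrow> 'm set \<Rightarrow> ('m, 'e) form set \<Rightarrow> bool" where
  "form_ideal M U J \<longleftrightarrow>
     J \<subseteq> forms M U \<and> 0 \<in> J \<and> (\<forall>\<omega>\<in>J. \<forall>\<psi>\<in>J. \<omega> + \<psi> \<in> J) \<and>
     (\<forall>\<alpha>\<in>forms M U. \<forall>\<omega>\<in>J. \<alpha> \<and>\<^sub>f \<omega> \<in> J \<and> \<omega> \<and>\<^sub>f \<alpha> \<in> J)"

definition differential_ideal ::
  "('m, 'e::euclidean_space) manifold \<Rightarrow> 'm set \<Rightarrow> ('m, 'e) form set \<Rightarrow> bool" where
  "differential_ideal M U J \<longleftrightarrow> form_ideal M U J \<and> (\<forall>\<omega>\<in>J. ext_deriv M U \<omega> \<in> J)"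

text \<open>Differential systems are treated as (pre)sheaves: a system assigns to each open set \<open>U\<close> an
  ideal of forms on \<open>U\<close>.\<close>

type_synonym ('m, 'e) diff_system = "'m set \<Rightarrow> ('m, 'e) form set"

definition pfaffian_system ::
  "('m, 'e::euclidean_space) manifold \<Rightarrow> nat \<Rightarrow> ('m \<Rightarrow> ('e \<Rightarrow>\<^sub>L real) set) \<Rightarrow> bool" where
  "pfaffian_system M r I \<longleftrightarrow>
     (\<forall>x\<in>pts M. subspace (I x) \<and> dim (I x) = r \<and>
        (\<exists>U \<theta>. open_in M U \<and> x \<in> U \<and> (\<forall>i<r. form1 U (\<theta> i) \<in> forms M U) \<and>
               (\<forall>y\<in>U. span ((\<lambda>i. \<theta> i y) ` {..<r}) = I y)))"

definition pfaffian_sections ::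
  "('m, 'e::euclidean_space) manifold \<Rightarrow> ('m \<Rightarrow> ('e \<Rightarrow>\<^sub>L real) set) \<Rightarrow> 'm set \<Rightarrow> ('m, 'e) form set" where
  "pfaffian_sections M I U = {form1 U \<eta> | \<eta>. (\<forall>x\<in>U. \<eta> x \<in> I x)} \<inter> forms M U"

definition pfaffian_ideal ::
  "('m, 'e::euclidean_space) manifold \<Rightarrow> ('m \<Rightarrow> ('e \<Rightarrow>\<^sub>L real) set) \<Rightarrow> ('m, 'e) diff_system" where
  "pfaffian_ideal M I U = differential_ideal M U hull pfaffian_sections M I U"

definition cong_mod ::
  "('m, 'e::euclidean_space) manifold \<Rightarrow> ('m \<Rightarrow> ('e \<Rightarrow>\<^sub>L real) set) \<Rightarrow> 'm set \<Rightarrow>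
     ('m, 'e) form \<Rightarrow> ('m, 'e) form \<Rightarrow> bool" where
  "cong_mod M I U \<omega> \<psi> \<longleftrightarrow> \<omega> - \<psi> \<in> form_ideal M U hull pfaffian_sections M I U"

definition E1 ::
  "('m, 'e::euclidean_space) manifold \<Rightarrow> ('m, 'e) diff_system \<Rightarrow> 'm \<Rightarrow> 'e set" where
  "E1 M \<I> x =
     {X. \<forall>U \<theta>. open_in M U \<and> x \<in> U \<and> \<theta> \<in> \<I> U \<and> homogeneous 1 \<theta> \<longrightarrow> \<theta> x [X] = 0}"

text \<open>Solutions \<open>Y\<close> of the polar equations of \<open>X\<close>. The rank of the equations, as a homogeneous
  linear system on \<open>E1\<close>, is the codimension of their solution space.\<close>

definition polar_space ::
  "('m, 'e::euclidean_space) manifold \<Rightarrow> ('m, 'e) diff_system \<Rightarrow> 'm \<Rightarrow> 'e \<Rightarrow> 'e set" where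
  "polar_space M \<I> x X =
     {Y \<in> E1 M \<I> x.
        \<forall>U \<theta>. open_in M U \<and> x \<in> U \<and> \<theta> \<in> \<I> U \<and> homogeneous 2 \<theta> \<longrightarrow> \<theta> x [X, Y] = 0}"

definition polar_rank ::
  "('m, 'e::euclidean_space) manifold \<Rightarrow> ('m, 'e) diff_system \<Rightarrow> 'm \<Rightarrow> 'e \<Rightarrow> nat" where
  "polar_rank M \<I> x X = dim (E1 M \<I> x) - dim (polar_space M \<I> x X)"

definition regular_vector ::
  "('m, 'e::euclidean_space) manifold \<Rightarrow> ('m, 'e) diff_system \<Rightarrow> 'm \<Rightarrow> 'e \<Rightarrow> bool" where
  "regular_vector M \<I> x X \<longleftrightarrow>
     X \<in> E1 M \<I> x \<and> X \<noteq> 0 \<and>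
     (\<forall>Z\<in>E1 M \<I> x. Z \<noteq> 0 \<longrightarrow> polar_rank M \<I> x Z \<le> polar_rank M \<I> x X)"

definition singular_vector ::
  "('m, 'e::euclidean_space) manifold \<Rightarrow> ('m, 'e) diff_system \<Rightarrow> 'm \<Rightarrow> 'e \<Rightarrow> bool" where
  "singular_vector M \<I> x X \<longleftrightarrow> X \<in> E1 M \<I> x \<and> X \<noteq> 0 \<and> \<not> regular_vector M \<I> x X"

text \<open>Integral 2-planes: all forms of the system vanish on the plane.\<close>

definition integral_2plane ::
  "('m, 'e::euclidean_space) manifold \<Rightarrow> ('m, 'e) diff_system \<Rightarrow> 'm \<Rightarrow> 'e set \<Rightarrow> bool" where
  "integral_2plane M \<I> x P \<longleftrightarrow>
     subspace P \<and> dim P = 2 \<and>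
     (\<forall>U \<omega> vs. open_in M U \<and> x \<in> U \<and> \<omega> \<in> \<I> U \<and> set vs \<subseteq> P \<longrightarrow> \<omega> x vs = 0)"

text \<open>Linear combinations, with function coefficients, of the products \<open>\<sigma>\<^sub>b \<and> \<sigma>\<^sub>c\<close>.\<close>

definition two_form_comb ::
  "('m, 'e::euclidean_space) manifold \<Rightarrow> 'm set \<Rightarrow> nat \<Rightarrow> (nat \<Rightarrow> 'm \<Rightarrow> 'e \<Rightarrow>\<^sub>L real) \<Rightarrow>
     ('m, 'e) form \<Rightarrow> bool" where
  "two_form_comb M U p \<sigma> \<Omega> \<longleftrightarrow>
     (\<exists>F. (\<forall>b<p. \<forall>c<p. smooth_fun M U (F b c)) \<and>
          \<Omega> = (\<Sum>b<p. \<Sum>c<p. F b c *\<^sub>f (form1 U (\<sigma> b) \<and>\<^sub>f form1 U (\<sigma> c))))"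

text \<open>The coframe is indexed by the disjoint union \<open>{..<r} <+> {..<p} <+> {..<q}\<close>.\<close>

definition decomposable_of_type ::
  "('m, 'e::euclidean_space) manifold \<Rightarrow> ('m, 'e) diff_system \<Rightarrow> nat \<Rightarrow> nat \<Rightarrow> bool" where
  "decomposable_of_type M \<I> p q \<longleftrightarrow>
     p \<ge> 2 \<and> q \<ge> 2 \<and>
     (\<forall>x\<in>pts M. \<exists>U r s t \<theta> \<sigma> \<tau> \<Omega> \<Psi>.
        open_in M U \<and> x \<in> U \<and> s \<ge> (1::nat) \<and> t \<ge> (1::nat) \<and>
        coframe_on M U ({..<r::nat} <+> ({..<p} <+> {..<q})) (case_sum \<theta> (case_sum \<sigma> \<tau>)) \<and>
        (\<forall>a<s. two_form_comb M U p \<sigma> (\<Omega> a)) \<and>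
        (\<forall>a<t. two_form_comb M U q \<tau> (\<Psi> a)) \<and>
        \<I> U = form_ideal M U hull
                ((\<lambda>i. form1 U (\<theta> i)) ` {..<r} \<union> \<Omega> ` {..<s} \<union> \<Psi> ` {..<t}))"

definition decomposable ::
  "('m, 'e::euclidean_space) manifold \<Rightarrow> ('m, 'e) diff_system \<Rightarrow> bool" where
  "decomposable M \<I> \<longleftrightarrow> (\<exists>p q. decomposable_of_type M \<I> p q)"


section \<open>Coframes adapted to a splitting\<close>

definition adapted_coframe ::
  "('m, 'e::euclidean_space) manifold \<Rightarrow> ('m \<Rightarrow> ('e \<Rightarrow>\<^sub>L real) set) \<Rightarrow> ('m \<Rightarrow> 'e set) \<Rightarrow>
     ('m \<Rightarrow> 'e set) \<Rightarrow> 'm set \<Rightarrow> ('r::finite \<Rightarrow> 'm \<Rightarrow> 'e \<Rightarrow>\<^sub>L real) \<Rightarrow>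
     ('p::finite \<Rightarrow> 'm \<Rightarrow> 'e \<Rightarrow>\<^sub>L real) \<Rightarrow> ('q::finite \<Rightarrow> 'm \<Rightarrow> 'e \<Rightarrow>\<^sub>L real) \<Rightarrow> bool" where
  "adapted_coframe M I S\<^sub>1 S\<^sub>2 U \<theta> \<sigma> \<tau> \<longleftrightarrow>
     coframe_on M U UNIV (case_sum \<theta> (case_sum \<sigma> \<tau>)) \<and>
     (\<forall>x\<in>U. I x = span (range (\<lambda>i. \<theta> i x)) \<and>
            (\<forall>a. \<forall>v\<in>S\<^sub>2 x. \<sigma> a x v = 0) \<and> (\<forall>\<alpha>. \<forall>v\<in>S\<^sub>1 x. \<tau> \<alpha> x v = 0))"

text \<open>The functions \<open>A i a b\<close> and \<open>B i \<alpha> \<beta>\<close> are the coefficients of the structure equations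
  \<open>d\<theta>\<^sup>i \<equiv> A\<^sup>i\<^sub>a\<^sub>b \<sigma>\<^sup>a \<and> \<sigma>\<^sup>b + B\<^sup>i\<^sub>\<alpha>\<^sub>\<beta> \<tau>\<^sup>\<alpha> \<and> \<tau>\<^sup>\<beta>\<close> modulo \<open>I\<close>, summed over all pairs of indices and
  skew-symmetric in them; thereby they are uniquely determined on \<open>U\<close>. They exist as
  soon as the 2-planes spanned by vectors of \<open>S\<^sub>1\<close> and \<open>S\<^sub>2\<close> are integral.\<close>

definition structure_coeffs ::
  "('m, 'e::euclidean_space) manifold \<Rightarrow> ('m \<Rightarrow> ('e \<Rightarrow>\<^sub>L real) set) \<Rightarrow> 'm set \<Rightarrow>
     ('r::finite \<Rightarrow> 'm \<Rightarrow> 'e \<Rightarrow>\<^sub>L real) \<Rightarrow>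
     ('p::finite \<Rightarrow> 'm \<Rightarrow> 'e \<Rightarrow>\<^sub>L real) \<Rightarrow> ('q::finite \<Rightarrow> 'm \<Rightarrow> 'e \<Rightarrow>\<^sub>L real) \<Rightarrow>
     ('r \<Rightarrow> 'p \<Rightarrow> 'p \<Rightarrow> 'm \<Rightarrow> real) \<Rightarrow> ('r \<Rightarrow> 'q \<Rightarrow> 'q \<Rightarrow> 'm \<Rightarrow> real) \<Rightarrow> bool" where
  "structure_coeffs M I U \<theta> \<sigma> \<tau> A B \<longleftrightarrow>
     (\<forall>i a b. smooth_fun M U (A i a b) \<and> (\<forall>x\<in>U. A i a b x = - A i b a x)) \<and>
     (\<forall>i \<alpha> \<beta>. smooth_fun M U (B i \<alpha> \<beta>) \<and> (\<forall>x\<in>U. B i \<alpha> \<beta> x = - B i \<beta> \<alpha> x)) \<and>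
     (\<forall>i. cong_mod M I U (ext_deriv M U (form1 U (\<theta> i)))
        ((\<Sum>a\<in>UNIV. \<Sum>b\<in>UNIV. A i a b *\<^sub>f (form1 U (\<sigma> a) \<and>\<^sub>f form1 U (\<sigma> b))) +
         (\<Sum>\<alpha>\<in>UNIV. \<Sum>\<beta>\<in>UNIV. B i \<alpha> \<beta> *\<^sub>f (form1 U (\<tau> \<alpha>) \<and>\<^sub>f form1 U (\<tau> \<beta>)))))"

text \<open>The linear map \<open>(t\<^sub>i) \<mapsto> t\<^sub>i A\<^sup>i\<^sub>a\<^sub>b(x)\<close>; elements of \<open>\<Lambda>\<^sup>2(\<real>\<^sup>p)\<close> are skew-symmetric matrices.\<close>

definition coeff_map ::
  "('r::finite \<Rightarrow> 'k::finite \<Rightarrow> 'k \<Rightarrow> 'm \<Rightarrow> real) \<Rightarrow> 'm \<Rightarrow> real ^ 'r \<Rightarrow> real ^ 'k ^ 'k" where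
  "coeff_map A x t = (\<chi> a b. \<Sum>i\<in>UNIV. t $ i * A i a b x)"

definition kernel :: "('a \<Rightarrow> 'b::zero) \<Rightarrow> 'a set" where
  "kernel f = {t. f t = 0}"

end

theory Submission
  imports Defs
begin

text \<open>The hypotheses say that \<open>d\<theta>\<^sup>i \<equiv> \<Phi>\<^sup>i + \<Psi>\<^sup>i\<close> modulo \<open>I\<close>, with \<open>\<Phi>\<^sup>i = A\<^sup>i\<^sub>a\<^sub>b \<sigma>\<^sup>a \<and> \<sigma>\<^sup>b\<close> and
  \<open>\<Psi>\<^sup>i = B\<^sup>i\<^sub>\<alpha>\<^sub>\<beta> \<tau>\<^sup>\<alpha> \<and> \<tau>\<^sup>\<beta>\<close>: the mixed terms are the values of \<open>d\<theta>\<^sup>i\<close> on planes spanned by a vector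
  of \<open>S\<^sub>1\<close> and a vector of \<open>S\<^sub>2\<close>. As \<open>ker A + ker B\<close> is everything, the \<open>i\<close>-th unit vector is
  congruent modulo \<open>ker A\<close> to some \<open>u\<^sub>i\<close> in \<open>ker B\<close>, and contracting the structure equations with
  \<open>u\<^sub>i\<close> shows that \<open>\<Phi>\<^sup>i\<close>, hence also \<open>\<Psi>\<^sup>i\<close>, lies in the ideal. So the \<open>\<theta>\<^sup>i\<close>, \<open>\<Phi>\<^sup>i\<close> and
  \<open>\<Psi>\<^sup>i\<close> generate it. The constant rank of \<open>A\<close> and \<open>B\<close> makes the rank of \<open>(A, B)\<close> constant, so that \<open>u\<^sub>i\<close> can be chosen to depend
  smoothly on the point.\<close>


section \<open>Calculus of smooth maps\<close>

text \<open>Since d squared vanishes, the differential ideal is generated algebraically by the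
  \<theta> and their derivatives, and the theorem becomes an exchange of generators. As
  \<open>ext_deriv\<close> works at each point in an arbitrarily selected chart, its smoothness and
  d squared = 0 rest on chart independence, hence on symmetric second derivatives and naturality
  under pullback. The hypotheses on A and B concern every family of coefficients that satisfies the
  structure equations, so one such family has to be exhibited before they can be used. With k and l
  the ranks of A and B, ker A \<inter> ker B has dimension (r - k) + (r - l) - r; this is the
  constancy that the smooth choice needs. A choice of vectors in ker B made point by point would be
  worthless, because an ideal of forms absorbs smooth coefficients only. The choice is therefore
  made by one linear system whose matrix is invertible near the base point, solved by Cramer's
  rule.\<close>

lemma Ck_on_subset: "Ck_on k S f \<Longrightarrow> T \<subseteq> S \<Longrightarrow> Ck_on k T f"
  by (induction k arbitrary: f) (auto intro: continuous_on_subset)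

text \<open>Openness of \<open>S\<close> makes agreement on \<open>S\<close> pass to the derivatives
  at points of \<open>S\<close>, which is what the induction hypothesis is applied to.\<close>

lemma Ck_on_cong:
  assumes "open S" "\<And>x. x \<in> S \<Longrightarrow> f x = g x" "Ck_on k S f"
  shows "Ck_on k S g"
  using assms(2,3)
proof (induction k arbitrary: f g)
  case 0
  then show ?case by (simp cong: continuous_on_cong)
next
  case (Suc k)
  have "(g has_derivative frechet_derivative f (at x)) (at x)" if "x \<in> S" for x
    using Suc.prems that assms(1)
    by (auto intro!: has_derivative_transform_within_open[of f _ x UNIV S g] simp: frechet_derivative_works)
  then have "g differentiable at x \<and> frechet_derivative f (at x) = frechet_derivative g (at x)" if "x \<in> S" for x
    using that frechet_derivative_at differentiableI by blast
  then show ?case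
    using Suc.prems Suc.IH by (metis (no_types, lifting) Ck_on.simps(2))
qed

lemma Ck_on_SucD: "Ck_on (Suc k) S f \<Longrightarrow> Ck_on k S f"
proof (induction k arbitrary: f)
  case 0
  then show ?case
    by (auto intro: differentiable_imp_continuous_on simp: differentiable_on_def differentiable_at_withinI)
qed simp

lemma Ck_on_const: "Ck_on k S (\<lambda>x. c)"
  by (induction k arbitrary: c) auto

text \<open>\<open>Ck_on\<close> refers to the chosen \<open>frechet_derivative\<close>; by
  uniqueness of derivatives an explicit formula may stand in for it.\<close>

lemma Ck_on_SucI:
  assumes "open S" "\<And>x. x \<in> S \<Longrightarrow> (f has_derivative f' x) (at x)"
    and "\<And>v. Ck_on k S (\<lambda>x. f' x v)"
  shows "Ck_on (Suc k) S f"
proof -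
  have "frechet_derivative f (at x) = f' x" if "x \<in> S" for x
    using assms(2)[OF that] frechet_derivative_at by metis
  then have "Ck_on k S (\<lambda>x. frechet_derivative f (at x) v)" for v
    by (intro Ck_on_cong[OF assms(1) _ assms(3)]) simp
  then show ?thesis
    using assms(2) by (auto simp: differentiable_def)
qed

lemma Ck_on_SucE:
  assumes "Ck_on (Suc k) S f"
  obtains "\<And>x. x \<in> S \<Longrightarrow> (f has_derivative frechet_derivative f (at x)) (at x)"
    and "\<And>v. Ck_on k S (\<lambda>x. frechet_derivative f (at x) v)" and "Ck_on k S f"
  using assms Ck_on_SucD[OF assms] by (auto simp: frechet_derivative_works)

lemma Ck_on_add:
  assumes "open S" "Ck_on k S f" "Ck_on k S g"
  shows "Ck_on k S (\<lambda>x. f x + g x)"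
  using assms(2,3)
proof (induction k arbitrary: f g)
  case (Suc k)
  show ?case
    using Suc.prems(1,2)
    by (elim Ck_on_SucE, intro Ck_on_SucI[OF assms(1), where f' =
          "\<lambda>x v. frechet_derivative f (at x) v + frechet_derivative g (at x) v"])
       (auto intro: has_derivative_add Suc.IH)
qed (simp add: continuous_on_add)

lemma Ck_on_bounded_linear:
  assumes "bounded_linear L" "open S" "Ck_on k S f"
  shows "Ck_on k S (\<lambda>x. L (f x))"
  using assms(3)
proof (induction k arbitrary: f)
  case 0
  then show ?case using assms(1) by (simp add: bounded_linear.continuous_on)
next
  case (Suc k)
  show ?case
    using Suc.prems
    by (elim Ck_on_SucE, intro Ck_on_SucI[OF assms(2), where f' =
          "\<lambda>x v. L (frechet_derivative f (at x) v)"])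
       (auto intro: bounded_linear.has_derivative[OF assms(1)] Suc.IH)
qed

lemma Ck_on_mult:
  fixes f g :: "'a::real_normed_vector \<Rightarrow> real"
  assumes "open S" "Ck_on k S f" "Ck_on k S g"
  shows "Ck_on k S (\<lambda>x. f x * g x)"
  using assms(2,3)
proof (induction k arbitrary: f g)
  case (Suc k)
  show ?case
    using Suc.prems(1,2)
    by (elim Ck_on_SucE, intro Ck_on_SucI[OF assms(1), where f' =
          "\<lambda>x v. f x * frechet_derivative g (at x) v + frechet_derivative f (at x) v * g x"])
       (simp_all add: has_derivative_mult Ck_on_add[OF assms(1)] Suc.IH)
qed (simp add: continuous_on_mult)

text \<open>The derivative of 1/f is a product of 1/f, 1/f and the derivative of f, up to sign, so
  the induction hypothesis is needed for the same f only. The sign is written as the factor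
  \<open>-1\<close> so that the rule for products covers the whole expression.\<close>

lemma Ck_on_inverse:
  fixes f :: "'a::real_normed_vector \<Rightarrow> real"
  assumes "open S" "\<And>x. x \<in> S \<Longrightarrow> f x \<noteq> 0" "Ck_on k S f"
  shows "Ck_on k S (\<lambda>x. inverse (f x))"
  using assms(3)
proof (induction k)
  case 0
  then show ?case using assms(2) by (simp add: continuous_on_inverse)
next
  case (Suc k)
  show ?case
    using Suc.prems
  proof (elim Ck_on_SucE, intro Ck_on_SucI[OF assms(1)])
    fix x assume *: "\<And>x. x \<in> S \<Longrightarrow> (f has_derivative frechet_derivative f (at x)) (at x)" "x \<in> S"
    show "((\<lambda>x. inverse (f x)) has_derivative
        (\<lambda>v. (-1) * (inverse (f x) * (frechet_derivative f (at x) v * inverse (f x))))) (at x)"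
      using * assms(2) by (auto intro!: derivative_eq_intros)
  next
    fix v assume *: "\<And>v. Ck_on k S (\<lambda>x. frechet_derivative f (at x) v)" "Ck_on k S f"
    show "Ck_on k S (\<lambda>x. (-1) * (inverse (f x) * (frechet_derivative f (at x) v * inverse (f x))))"
      by (intro Ck_on_mult assms(1) Ck_on_const * Suc.IH)
  qed
qed

lemma Ck_on_sum:
  assumes "open S" "\<And>i. i \<in> A \<Longrightarrow> Ck_on k S (f i)"
  shows "Ck_on k S (\<lambda>x. \<Sum>i\<in>A. f i x)"
  using assms(2)
  by (induction A rule: infinite_finite_induct) (auto intro!: Ck_on_add assms(1) Ck_on_const)

lemma linear_eq_sum_Basis:
  fixes f :: "'a::euclidean_space \<Rightarrow> 'b::real_normed_vector"
  assumes "linear L"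
  shows "L v = (\<Sum>b\<in>Basis. (v \<bullet> b) *\<^sub>R (L b :: 'b))"
  by (subst (1) euclidean_representation[symmetric]) (simp add: linear_sum[OF assms] linear_cmul[OF assms])

lemma smooth_on_subset: "smooth_on S f \<Longrightarrow> T \<subseteq> S \<Longrightarrow> smooth_on T f"
  unfolding smooth_on_def using Ck_on_subset by blast

lemma smooth_on_cong:
  "open S \<Longrightarrow> (\<And>x. x \<in> S \<Longrightarrow> f x = g x) \<Longrightarrow> smooth_on S f \<Longrightarrow> smooth_on S g"
  unfolding smooth_on_def using Ck_on_cong by blast

lemma smooth_on_const: "smooth_on S (\<lambda>x. c)"
  unfolding smooth_on_def using Ck_on_const by blast

lemma smooth_on_add: "open S \<Longrightarrow> smooth_on S f \<Longrightarrow> smooth_on S g \<Longrightarrow> smooth_on S (\<lambda>x. f x + g x)"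
  unfolding smooth_on_def using Ck_on_add by blast

lemma smooth_on_bounded_linear:
  "bounded_linear L \<Longrightarrow> open S \<Longrightarrow> smooth_on S f \<Longrightarrow> smooth_on S (\<lambda>x. L (f x))"
  unfolding smooth_on_def using Ck_on_bounded_linear by blast

lemma smooth_on_inner: "open S \<Longrightarrow> smooth_on S f \<Longrightarrow> smooth_on S (\<lambda>x. f x \<bullet> b)"
  by (rule smooth_on_bounded_linear[OF bounded_linear_inner_left])

lemma smooth_on_mult:
  fixes f g :: "'a::real_normed_vector \<Rightarrow> real"
  shows "open S \<Longrightarrow> smooth_on S f \<Longrightarrow> smooth_on S g \<Longrightarrow> smooth_on S (\<lambda>x. f x * g x)"
  unfolding smooth_on_def using Ck_on_mult by blast

lemma smooth_on_divide:
  fixes f g :: "'a::real_normed_vector \<Rightarrow> real"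
  shows "open S \<Longrightarrow> smooth_on S f \<Longrightarrow> smooth_on S g \<Longrightarrow> (\<And>x. x \<in> S \<Longrightarrow> g x \<noteq> 0) \<Longrightarrow>
    smooth_on S (\<lambda>x. f x / g x)"
  by (simp add: smooth_on_def divide_inverse Ck_on_mult Ck_on_inverse)

lemma smooth_on_sum:
  "open S \<Longrightarrow> (\<And>i. i \<in> A \<Longrightarrow> smooth_on S (f i)) \<Longrightarrow> smooth_on S (\<lambda>x. \<Sum>i\<in>A. f i x)"
  by (simp add: smooth_on_def Ck_on_sum)

lemma smooth_on_prod:
  fixes f :: "'i \<Rightarrow> 'a::real_normed_vector \<Rightarrow> real"
  assumes "open S" "\<And>i. i \<in> A \<Longrightarrow> smooth_on S (f i)"
  shows "smooth_on S (\<lambda>x. \<Prod>i\<in>A. f i x)"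
  using assms(2)
  by (induction A rule: infinite_finite_induct) (auto intro!: smooth_on_mult assms(1) smooth_on_const)

lemma smooth_on_differentiable: "smooth_on S f \<Longrightarrow> x \<in> S \<Longrightarrow> f differentiable (at x)"
  unfolding smooth_on_def by (metis Ck_on.simps(2))

lemma smooth_on_has_derivative:
  "smooth_on S f \<Longrightarrow> x \<in> S \<Longrightarrow> (f has_derivative frechet_derivative f (at x)) (at x)"
  using smooth_on_differentiable frechet_derivative_works by blast

lemma smooth_on_continuous_on: "smooth_on S f \<Longrightarrow> continuous_on S f"
  unfolding smooth_on_def by (metis Ck_on.simps(1))

lemma smooth_on_frechet_derivative:
  "smooth_on S f \<Longrightarrow> smooth_on S (\<lambda>x. frechet_derivative f (at x) v)"
  unfolding smooth_on_def by (metis Ck_on.simps(2))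

lemma Ck_on_local:
  assumes "\<And>x. x \<in> S \<Longrightarrow> \<exists>T. open T \<and> x \<in> T \<and> Ck_on k T f"
  shows "Ck_on k S f"
  using assms
proof (induction k arbitrary: f)
  case 0
  have "continuous (at x) f" if "x \<in> S" for x
    using 0[OF that] by (auto simp: continuous_on_eq_continuous_at)
  then show ?case
    by (simp add: continuous_at_imp_continuous_on)
next
  case (Suc k)
  then show ?case by simp meson
qed

lemma smooth_on_local:
  assumes "\<And>x. x \<in> S \<Longrightarrow> \<exists>T. open T \<and> x \<in> T \<and> smooth_on T f"
  shows "smooth_on S f"
  using assms unfolding smooth_on_def by (meson Ck_on_local)

lemma smooth_on_euclidean:
  fixes f :: "'a::real_normed_vector \<Rightarrow> 'b::euclidean_space"
  assumes "open S" "\<And>b. b \<in> Basis \<Longrightarrow> smooth_on S (\<lambda>x. f x \<bullet> b)"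
  shows "smooth_on S f"
proof -
  have "smooth_on S (\<lambda>x. \<Sum>b\<in>Basis. (f x \<bullet> b) *\<^sub>R b)"
    using assms by (intro smooth_on_sum smooth_on_bounded_linear[OF bounded_linear_scaleR_left])
  then show ?thesis by (simp add: euclidean_representation)
qed

lemma smooth_on_det:
  fixes A :: "'a::real_normed_vector \<Rightarrow> real^'n^'n"
  assumes "open S" "\<And>i j. smooth_on S (\<lambda>x. A x $ i $ j)"
  shows "smooth_on S (\<lambda>x. det (A x))"
  unfolding det_def
  by (intro smooth_on_sum smooth_on_mult smooth_on_const smooth_on_prod assms)

section \<open>Symmetry of second derivatives\<close>

lemma mvt_second_difference:
  fixes f :: "'a::euclidean_space \<Rightarrow> real"
  assumes "open S" "smooth_on S f" "h > 0"
    and mem: "\<And>s t. 0 \<le> s \<Longrightarrow> s \<le> h \<Longrightarrow> 0 \<le> t \<Longrightarrow> t \<le> h \<Longrightarrow> y + s *\<^sub>R v + t *\<^sub>R w \<in> S"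
  shows "\<exists>s t. 0 \<le> s \<and> s \<le> h \<and> 0 \<le> t \<and> t \<le> h \<and>
     f (y + h *\<^sub>R v + h *\<^sub>R w) - f (y + h *\<^sub>R v) - (f (y + h *\<^sub>R w) - f y) =
       h * h * frechet_derivative (\<lambda>x. frechet_derivative f (at x) v) (at (y + s *\<^sub>R v + t *\<^sub>R w)) w"
proof -
  \<comment> \<open>The mean value theorem is applied twice: to this difference as a function of
    \<open>s\<close>, then to the first derivative as a function of \<open>t\<close>. The term
    \<open>0 *\<^sub>R w\<close> gives both summands the shape that \<open>der\<close>
    differentiates, with t = h and t = 0.\<close>
  define g where "g s = f (y + s *\<^sub>R v + h *\<^sub>R w) - f (y + s *\<^sub>R v + 0 *\<^sub>R w)" for s
  have lin: "linear (frechet_derivative f (at x))" if "x \<in> S" for x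
    using assms(2) that linear_frechet_derivative smooth_on_differentiable by blast
  have der: "((\<lambda>s. f (y + s *\<^sub>R v + t *\<^sub>R w)) has_derivative
      (\<lambda>u. u * frechet_derivative f (at (y + s *\<^sub>R v + t *\<^sub>R w)) v)) (at s)"
    if "0 \<le> s" "s \<le> h" "0 \<le> t" "t \<le> h" for s t
  proof -
    have "((\<lambda>s. f (y + s *\<^sub>R v + t *\<^sub>R w)) has_derivative
      (\<lambda>u. frechet_derivative f (at (y + s *\<^sub>R v + t *\<^sub>R w)) (u *\<^sub>R v))) (at s)"
      by (rule has_derivative_compose[of "\<lambda>s. y + s *\<^sub>R v + t *\<^sub>R w" "\<lambda>u. u *\<^sub>R v"])
         (auto intro!: derivative_eq_intros smooth_on_has_derivative[OF assms(2)] mem that)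
    then show ?thesis
      using linear_cmul[OF lin[OF mem[OF that]]] by simp
  qed
  have dg: "(g has_derivative
      (\<lambda>u. u * (frechet_derivative f (at (y + s *\<^sub>R v + h *\<^sub>R w)) v - frechet_derivative f (at (y + s *\<^sub>R v + 0 *\<^sub>R w)) v))) (at s)"
    if "0 \<le> s" "s \<le> h" for s
    unfolding g_def
    by (rule has_derivative_eq_rhs[OF has_derivative_diff[OF der der]])
       (use that assms(3) in \<open>auto simp: algebra_simps\<close>)
  obtain s where s: "s \<in> {0<..<h}" "g h - g 0 = (h - 0) *
      (frechet_derivative f (at (y + s *\<^sub>R v + h *\<^sub>R w)) v - frechet_derivative f (at (y + s *\<^sub>R v + 0 *\<^sub>R w)) v)"
    using mvt_simple[OF assms(3), of g, OF has_derivative_at_withinI[OF dg]] by force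
  define k where "k t = frechet_derivative f (at (y + s *\<^sub>R v + t *\<^sub>R w)) v" for t
  define D where "D x = frechet_derivative (\<lambda>x. frechet_derivative f (at x) v) (at x)" for x
  have sm: "smooth_on S (\<lambda>x. frechet_derivative f (at x) v)"
    using assms(2) smooth_on_frechet_derivative by blast
  have linD: "linear (D x)" if "x \<in> S" for x
    unfolding D_def using sm that linear_frechet_derivative smooth_on_differentiable by blast
  have dk: "(k has_derivative (\<lambda>u. u * D (y + s *\<^sub>R v + t *\<^sub>R w) w)) (at t)"
    if "0 \<le> t" "t \<le> h" for t
  proof -
    have m: "y + s *\<^sub>R v + t *\<^sub>R w \<in> S" using mem that s by auto
    have "(k has_derivative (\<lambda>u. D (y + s *\<^sub>R v + t *\<^sub>R w) (u *\<^sub>R w))) (at t)"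
      unfolding k_def D_def
      by (rule has_derivative_compose[of "\<lambda>t. y + s *\<^sub>R v + t *\<^sub>R w" "\<lambda>u. u *\<^sub>R w"])
         (auto intro!: derivative_eq_intros smooth_on_has_derivative[OF sm] m)
    then show ?thesis
      using linear_cmul[OF linD[OF m]] by simp
  qed
  obtain t where t: "t \<in> {0<..<h}" "k h - k 0 = (h - 0) * D (y + s *\<^sub>R v + t *\<^sub>R w) w"
    using mvt_simple[OF assms(3), of k, OF has_derivative_at_withinI[OF dk]] by force
  have "g h - g 0 = h * (h * D (y + s *\<^sub>R v + t *\<^sub>R w) w)"
    using s(2) t(2) by (simp add: k_def)
  then show ?thesis
    using s(1) t(1) unfolding g_def D_def by (intro exI[of _ s] exI[of _ t]) (simp add: algebra_simps)
qed

text \<open>The second difference over the parallelogram spanned by h v and h w is symmetric in v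
  and w, and divided by h^2 it is a value of either mixed derivative at a point near y. With
  \<epsilon> half the gap between \<open>P y\<close> and \<open>Q y\<close>, continuity makes the
  two values too close to their limits to be equal.\<close>

lemma frechet_derivative_commute_real:
  fixes f :: "'a::euclidean_space \<Rightarrow> real"
  assumes "open S" "smooth_on S f" "y \<in> S"
  shows "frechet_derivative (\<lambda>x. frechet_derivative f (at x) v) (at y) w =
         frechet_derivative (\<lambda>x. frechet_derivative f (at x) w) (at y) v"
proof (rule ccontr)
  define P where "P x = frechet_derivative (\<lambda>x. frechet_derivative f (at x) v) (at x) w" for x
  define Q where "Q x = frechet_derivative (\<lambda>x. frechet_derivative f (at x) w) (at x) v" for x
  assume "\<not> ?thesis"
  then have "P y \<noteq> Q y" by (simp add: P_def Q_def)
  define \<epsilon> where "\<epsilon> = \<bar>P y - Q y\<bar> / 2"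
  have "\<epsilon> > 0" using \<open>P y \<noteq> Q y\<close> by (simp add: \<epsilon>_def)
  have "smooth_on S P" "smooth_on S Q"
    unfolding P_def Q_def by (intro smooth_on_frechet_derivative assms)+
  then have "continuous (at y) P" "continuous (at y) Q"
    using smooth_on_continuous_on assms(1,3) continuous_on_eq_continuous_at by blast+
  then obtain d1 d2 where d: "d1 > 0" "\<And>x. dist x y < d1 \<Longrightarrow> dist (P x) (P y) < \<epsilon>"
      "d2 > 0" "\<And>x. dist x y < d2 \<Longrightarrow> dist (Q x) (Q y) < \<epsilon>"
    using \<open>\<epsilon> > 0\<close> unfolding continuous_at_eps_delta by metis
  obtain d3 where d3: "d3 > 0" "ball y d3 \<subseteq> S"
    using assms(1,3) open_contains_ball by blast
  define d where "d = min d1 (min d2 d3)"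
  \<comment> \<open>With this size the whole parallelogram stays within distance \<open>d\<close> of
    \<open>y\<close>; the summand 1 keeps the denominator positive even if both vectors are
    zero.\<close>
  define h where "h = d / (norm v + norm w + 1)"
  have "d > 0" using d d3 by (simp add: d_def)
  have pos: "norm v + norm w + 1 > 0" by (simp add: add_nonneg_pos)
  have "h > 0" using \<open>d > 0\<close> pos by (simp add: h_def)
  have hd: "h * (norm v + norm w) < d"
    using pos \<open>d > 0\<close> by (simp add: h_def field_simps)
  have close: "dist (y + s *\<^sub>R a + t *\<^sub>R b) y < d"
    if "0 \<le> s" "s \<le> h" "0 \<le> t" "t \<le> h" "norm a + norm b = norm v + norm w" for s t a b
  proof -
    have "dist (y + s *\<^sub>R a + t *\<^sub>R b) y \<le> s * norm a + t * norm b"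
      using that by (auto simp: dist_norm add.assoc intro: norm_triangle_le)
    also have "\<dots> \<le> h * norm a + h * norm b"
      using that by (intro add_mono mult_right_mono) auto
    also have "h * norm a + h * norm b = h * (norm v + norm w)"
      by (simp flip: that(5) add: distrib_left)
    finally show ?thesis using hd by linarith
  qed
  have mem: "y + s *\<^sub>R a + t *\<^sub>R b \<in> S"
    if "0 \<le> s" "s \<le> h" "0 \<le> t" "t \<le> h" "norm a + norm b = norm v + norm w" for s t a b
    using close[OF that] d3(2) by (auto simp: d_def dist_commute)
  obtain s t where st: "0 \<le> s" "s \<le> h" "0 \<le> t" "t \<le> h" 
    "f (y + h *\<^sub>R v + h *\<^sub>R w) - f (y + h *\<^sub>R v) - (f (y + h *\<^sub>R w) - f y) =
       h * h * P (y + s *\<^sub>R v + t *\<^sub>R w)"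
    using mvt_second_difference[OF assms(1,2) \<open>h > 0\<close>, of y v w] mem[of _ _ v w] unfolding P_def by auto
  obtain s' t' where st': "0 \<le> s'" "s' \<le> h" "0 \<le> t'" "t' \<le> h" 
    "f (y + h *\<^sub>R w + h *\<^sub>R v) - f (y + h *\<^sub>R w) - (f (y + h *\<^sub>R v) - f y) =
       h * h * Q (y + s' *\<^sub>R w + t' *\<^sub>R v)"
    using mvt_second_difference[OF assms(1,2) \<open>h > 0\<close>, of y w v] mem[of _ _ w v] unfolding Q_def by auto
  have "h * h * P (y + s *\<^sub>R v + t *\<^sub>R w) = h * h * Q (y + s' *\<^sub>R w + t' *\<^sub>R v)"
    unfolding st(5)[symmetric] st'(5)[symmetric] by (simp add: algebra_simps)
  then have eq: "P (y + s *\<^sub>R v + t *\<^sub>R w) = Q (y + s' *\<^sub>R w + t' *\<^sub>R v)"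
    using \<open>h > 0\<close> by simp
  have "dist (P (y + s *\<^sub>R v + t *\<^sub>R w)) (P y) < \<epsilon>" 
    using d(2) close[of s t v w] st by (simp add: d_def)
  moreover have "dist (Q (y + s' *\<^sub>R w + t' *\<^sub>R v)) (Q y) < \<epsilon>" 
    using d(4) close[of s' t' w v] st' by (simp add: d_def)
  moreover have "dist (P y) (Q y) \<le> dist (P (y + s *\<^sub>R v + t *\<^sub>R w)) (P y) + dist (Q (y + s' *\<^sub>R w + t' *\<^sub>R v)) (Q y)"
    unfolding eq by (metis dist_commute dist_triangle2)
  moreover have "dist (P y) (Q y) = \<epsilon> + \<epsilon>"
    by (simp add: \<epsilon>_def dist_real_def)
  ultimately show False
    by linarith
qed

lemma frechet_derivative_inner:
  assumes "f differentiable (at x)"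
  shows "frechet_derivative (\<lambda>x. f x \<bullet> b) (at x) v = frechet_derivative f (at x) v \<bullet> b"
proof -
  have "((\<lambda>x. f x \<bullet> b) has_derivative (\<lambda>v. frechet_derivative f (at x) v \<bullet> b)) (at x)"
    using assms by (intro has_derivative_inner_left) (simp add: frechet_derivative_works)
  from frechet_derivative_at[OF this] show ?thesis by metis
qed

text \<open>Both functions have the same derivatives at \<open>x\<close>, so the choice in
  \<open>frechet_derivative\<close> returns the same value; this covers points where no derivative
  exists.\<close>

lemma frechet_derivative_cong:
  assumes "open S" "x \<in> S" "\<And>y. y \<in> S \<Longrightarrow> f y = g y"
  shows "frechet_derivative f (at x) = frechet_derivative g (at x)"
proof -
  have "(f has_derivative f') (at x) \<longleftrightarrow> (g has_derivative f') (at x)" for f'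
    using assms has_derivative_transform_within_open[of _ f' x UNIV S] by metis
  then show ?thesis
    unfolding frechet_derivative_def by simp
qed

lemma frechet_derivative_commute:
  fixes f :: "'a::euclidean_space \<Rightarrow> 'b::euclidean_space"
  assumes "open S" "smooth_on S f" "y \<in> S"
  shows "frechet_derivative (\<lambda>x. frechet_derivative f (at x) v) (at y) w =
         frechet_derivative (\<lambda>x. frechet_derivative f (at x) w) (at y) v"
proof (rule euclidean_eqI)
  fix b :: 'b
  have "frechet_derivative (\<lambda>x. frechet_derivative f (at x) v) (at y) w \<bullet> b =
    frechet_derivative (\<lambda>x. frechet_derivative (\<lambda>x. f x \<bullet> b) (at x) v) (at y) w" for v w
  proof -
    have "frechet_derivative (\<lambda>x. frechet_derivative f (at x) v) (at y) w \<bullet> b =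
      frechet_derivative (\<lambda>x. frechet_derivative f (at x) v \<bullet> b) (at y) w"
      by (rule frechet_derivative_inner[symmetric])
         (rule smooth_on_differentiable[OF smooth_on_frechet_derivative[OF assms(2)] assms(3)])
    also have "frechet_derivative (\<lambda>x. frechet_derivative f (at x) v \<bullet> b) (at y) =
       frechet_derivative (\<lambda>x. frechet_derivative (\<lambda>x. f x \<bullet> b) (at x) v) (at y)"
      by (rule frechet_derivative_cong[OF assms(1,3)])
         (simp add: frechet_derivative_inner smooth_on_differentiable[OF assms(2)])
    finally show ?thesis .
  qed
  then show "frechet_derivative (\<lambda>x. frechet_derivative f (at x) v) (at y) w \<bullet> b =
    frechet_derivative (\<lambda>x. frechet_derivative f (at x) w) (at y) v \<bullet> b"
    using frechet_derivative_commute_real[OF assms(1) smooth_on_inner[OF assms(1,2)] assms(3)] by simp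
qed

section \<open>Alternating forms and the wedge product\<close>

text \<open>The degree involution. It carries the sign (-1)^k that arises when a vector or d is
  moved past a form of degree k, without splitting a form of mixed degree into its
  components.\<close>

definition grade :: "('e list \<Rightarrow> real) \<Rightarrow> 'e list \<Rightarrow> real" where
  "grade \<alpha> vs = (- 1) ^ length vs * \<alpha> vs"

lemma wedge_pt_Nil: "wedge_pt \<alpha> \<beta> [] = \<alpha> [] * \<beta> []"
  by (simp add: wedge_pt_def shuffle_sign_def)

text \<open>If the index 0 goes to the right factor, every index of the left factor is moved past
  it: one new inversion for each element of \<open>T\<close>. If 0 goes to the left factor, as in
  \<open>shuffle_sign_insert_0\<close>, no index lies below it and no inversion is added.\<close>

lemma shuffle_sign_image_Suc:
  assumes "T \<subseteq> {..<n}"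
  shows "shuffle_sign (Suc ` T) (Suc n) = (- 1) ^ card T * shuffle_sign T n"
proof -
  have fin: "finite T" using assms finite_subset by blast
  let ?R = "{(i, j). i \<in> T \<and> j \<in> {..<n} - T \<and> j < i}"
  have "finite ?R" by (rule finite_subset[of _ "T \<times> {..<n}"]) (use fin in auto)
  have "{(i, j). i \<in> Suc ` T \<and> j \<in> {..<Suc n} - Suc ` T \<and> j < i} =
      (\<lambda>i. (Suc i, 0)) ` T \<union> map_prod Suc Suc ` ?R" (is "?L = _")
  proof (intro equalityI subsetI)
    fix z assume "z \<in> ?L"
    then obtain i j where z: "z = (Suc i, j)" "i \<in> T" "j < Suc n" "j \<notin> Suc ` T" "j < Suc i" by auto
    then show "z \<in> (\<lambda>i. (Suc i, 0)) ` T \<union> map_prod Suc Suc ` ?R"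
      by (cases j) (auto simp: image_iff map_prod_def split: prod.splits)
  qed auto
  also have "card \<dots> = card ((\<lambda>i. (Suc i, 0::nat)) ` T) + card (map_prod Suc Suc ` ?R)"
    by (rule card_Un_disjoint) (use fin \<open>finite ?R\<close> in auto)
  also have "\<dots> = card T + card ?R"
    by (subst (1 2) card_image) (auto simp: inj_on_def)
  finally show ?thesis
    by (simp add: shuffle_sign_def power_add)
qed

lemma shuffle_sign_insert_0:
  assumes "T \<subseteq> {..<n}"
  shows "shuffle_sign (insert 0 (Suc ` T)) (Suc n) = shuffle_sign T n"
proof -
  let ?R = "{(i, j). i \<in> T \<and> j \<in> {..<n} - T \<and> j < i}"
  have "{(i, j). i \<in> insert 0 (Suc ` T) \<and> j \<in> {..<Suc n} - insert 0 (Suc ` T) \<and> j < i} =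
      map_prod Suc Suc ` ?R" (is "?L = _")
  proof (intro equalityI subsetI)
    fix z assume "z \<in> ?L"
    then obtain i j where "z = (Suc i, j)" "i \<in> T" "j < Suc n" "j \<notin> Suc ` T" "j < Suc i" "j \<noteq> 0" by auto
    then show "z \<in> map_prod Suc Suc ` ?R"
      by (cases j) (auto simp: image_iff map_prod_def split: prod.splits)
  qed auto
  also have "card \<dots> = card ?R"
    by (rule card_image) (auto simp: inj_on_def)
  finally show ?thesis
    by (simp add: shuffle_sign_def)
qed

text \<open>Contraction with a vector is an antiderivation of the wedge product. The index sets are
  split by whether they contain 0. The resulting recursion on the argument list replaces the sum
  over shuffles in the proofs of alternation and of the Leibniz rule.\<close>

lemma wedge_pt_Cons:
  "wedge_pt \<alpha> \<beta> (v # vs) =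
     wedge_pt (\<lambda>ws. \<alpha> (v # ws)) \<beta> vs + wedge_pt (grade \<alpha>) (\<lambda>ws. \<beta> (v # ws)) vs"
proof -
  let ?n = "length vs"
  let ?f = "\<lambda>S. shuffle_sign S (Suc ?n) * \<alpha> (nths (v # vs) S) * \<beta> (nths (v # vs) (- S))"
  have Pow: "Pow {..<Suc ?n} = (`) Suc ` Pow {..<?n} \<union> insert 0 ` (`) Suc ` Pow {..<?n}"
    by (simp add: lessThan_Suc_eq_insert_0 Pow_insert image_Pow_surj[OF refl])
  have inj: "inj_on ((`) Suc) (Pow {..<?n})" "inj_on (insert 0) ((`) Suc ` Pow {..<?n})"
    by (auto simp: inj_on_def)
  have c1: "?f (insert 0 (Suc ` T)) = shuffle_sign T ?n * \<alpha> (v # nths vs T) * \<beta> (nths vs (- T))"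
    if "T \<subseteq> {..<?n}" for T
  proof -
    have "{j. Suc j \<in> insert 0 (Suc ` T)} = T" "{j. Suc j \<in> - insert 0 (Suc ` T)} = - T" by auto
    then have "nths (v # vs) (insert 0 (Suc ` T)) = v # nths vs T"
      "nths (v # vs) (- insert 0 (Suc ` T)) = nths vs (- T)"
      unfolding nths_Cons by simp_all
    then show ?thesis
      using that by (simp only: shuffle_sign_insert_0)
  qed
  have c2: "?f (Suc ` T) = shuffle_sign T ?n * grade \<alpha> (nths vs T) * \<beta> (v # nths vs (- T))"
    if "T \<subseteq> {..<?n}" for T
  proof -
    have "length (nths vs T) = card T"
      using that by (auto simp: length_nths intro!: arg_cong[of _ _ card])
    moreover have "{j. Suc j \<in> Suc ` T} = T" "{j. Suc j \<in> - Suc ` T} = - T" by auto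
    then have "nths (v # vs) (Suc ` T) = nths vs T" "nths (v # vs) (- Suc ` T) = v # nths vs (- T)"
      unfolding nths_Cons by auto
    ultimately show ?thesis
      using that by (simp only: shuffle_sign_image_Suc grade_def mult_ac)
  qed
  have "wedge_pt \<alpha> \<beta> (v # vs) = sum ?f (Pow {..<Suc ?n})"
    by (simp add: wedge_pt_def)
  also have "\<dots> = sum ?f ((`) Suc ` Pow {..<?n}) + sum ?f (insert 0 ` (`) Suc ` Pow {..<?n})"
    unfolding Pow by (rule sum.union_disjoint) auto
  also have "sum ?f (insert 0 ` (`) Suc ` Pow {..<?n}) =
      (\<Sum>T\<in>Pow {..<?n}. shuffle_sign T ?n * \<alpha> (v # nths vs T) * \<beta> (nths vs (- T)))"
    unfolding sum.reindex[OF inj(2)] sum.reindex[OF inj(1)] o_def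
    by (intro sum.cong refl c1) auto
  also have "sum ?f ((`) Suc ` Pow {..<?n}) =
      (\<Sum>T\<in>Pow {..<?n}. shuffle_sign T ?n * grade \<alpha> (nths vs T) * \<beta> (v # nths vs (- T)))"
    unfolding sum.reindex[OF inj(1)] o_def
    by (intro sum.cong refl c2) auto
  finally show ?thesis
    by (simp add: wedge_pt_def)
qed

lemma wedge_pt_add_left: "wedge_pt (\<lambda>ws. \<alpha> ws + \<alpha>' ws) \<beta> vs = wedge_pt \<alpha> \<beta> vs + wedge_pt \<alpha>' \<beta> vs"
  by (simp add: wedge_pt_def algebra_simps sum.distrib)

lemma wedge_pt_add_right: "wedge_pt \<alpha> (\<lambda>ws. \<beta> ws + \<beta>' ws) vs = wedge_pt \<alpha> \<beta> vs + wedge_pt \<alpha> \<beta>' vs"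
  by (simp add: wedge_pt_def algebra_simps sum.distrib)

lemma wedge_pt_scale_left: "wedge_pt (\<lambda>ws. c * \<alpha> ws) \<beta> vs = c * wedge_pt \<alpha> \<beta> vs"
  by (simp add: wedge_pt_def algebra_simps sum_distrib_left)

lemma wedge_pt_scale_right: "wedge_pt \<alpha> (\<lambda>ws. c * \<beta> ws) vs = c * wedge_pt \<alpha> \<beta> vs"
  by (simp add: wedge_pt_def algebra_simps sum_distrib_left)

lemma wedge_pt_uminus_left: "wedge_pt (\<lambda>ws. - \<alpha> ws) \<beta> vs = - wedge_pt \<alpha> \<beta> vs"
  using wedge_pt_scale_left[of "-1"] by simp

lemma wedge_pt_diff_left: "wedge_pt (\<lambda>ws. \<alpha> ws - \<alpha>' ws) \<beta> vs = wedge_pt \<alpha> \<beta> vs - wedge_pt \<alpha>' \<beta> vs"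
  by (simp add: wedge_pt_def algebra_simps sum_subtractf)

lemma wedge_pt_diff_right: "wedge_pt \<alpha> (\<lambda>ws. \<beta> ws - \<beta>' ws) vs = wedge_pt \<alpha> \<beta> vs - wedge_pt \<alpha> \<beta>' vs"
  by (simp add: wedge_pt_def algebra_simps sum_subtractf)

lemma wedge_pt_zero_left: "wedge_pt (\<lambda>ws. 0) \<beta> vs = 0"
  by (simp add: wedge_pt_def)

lemma wedge_pt_zero_right: "wedge_pt \<alpha> (\<lambda>ws. 0) vs = 0"
  by (simp add: wedge_pt_def)

lemma grade_Cons: "(\<lambda>ws. grade \<alpha> (v # ws)) = (\<lambda>ws. - grade (\<lambda>ws. \<alpha> (v # ws)) ws)"
  by (simp add: grade_def)

lemma grade_grade: "grade (grade \<alpha>) = \<alpha>"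
  by (simp add: grade_def fun_eq_iff power_mult_distrib flip: mult.assoc power_add)

lemma length_nths_Compl: "length (nths vs S) + length (nths vs (- S)) = length vs"
proof (induction vs arbitrary: S)
  case (Cons v vs)
  have "{j. Suc j \<in> - S} = - {j. Suc j \<in> S}" by auto
  then show ?case using Cons[of "{j. Suc j \<in> S}"] by (simp add: nths_Cons)
qed simp

lemma wedge_pt_grade: "grade (wedge_pt \<alpha> \<beta>) vs = wedge_pt (grade \<alpha>) (grade \<beta>) vs"
proof -
  have sgn: "(- 1) ^ length vs = (- 1) ^ length (nths vs S) * ((- 1) ^ length (nths vs (- S)) :: real)" for S
    using power_add[of "- 1 :: real" "length (nths vs S)" "length (nths vs (- S))"] by (simp add: length_nths_Compl)
  show ?thesis
    unfolding grade_def wedge_pt_def sum_distrib_left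
  proof (intro sum.cong refl)
    fix S
    show "(- 1) ^ length vs * (shuffle_sign S (length vs) * \<alpha> (nths vs S) * \<beta> (nths vs (- S))) =
      shuffle_sign S (length vs) * ((- 1) ^ length (nths vs S) * \<alpha> (nths vs S)) *
      ((- 1) ^ length (nths vs (- S)) * \<beta> (nths vs (- S)))"
      unfolding sgn[of S] by (simp only: mult_ac)
  qed
qed

section \<open>Alternation expressed through the first arguments\<close>

lemma alternating_form_linear_Cons:
  assumes "alternating_form \<alpha>"
  shows "linear (\<lambda>v. \<alpha> (v # vs))"
proof -
  have "linear (\<lambda>v. \<alpha> ((0 # vs)[0 := v]))"
    using assms unfolding alternating_form_def by blast
  then show ?thesis by simp
qed

lemma alternating_form_Cons_Cons:
  assumes "alternating_form \<alpha>"
  shows "\<alpha> (v # v # vs) = 0"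
proof -
  have "Suc 0 < length (v # v # vs)" "0 < Suc 0" "(v # v # vs) ! 0 = (v # v # vs) ! Suc 0" by simp_all
  then show ?thesis
    using assms unfolding alternating_form_def by blast
qed

lemma alternating_form_contract:
  assumes "alternating_form \<alpha>"
  shows "alternating_form (\<lambda>ws. \<alpha> (v # ws))"
  unfolding alternating_form_def
proof (intro conjI allI impI)
  fix vs :: "'a list" and i assume "i < length vs"
  then have "linear (\<lambda>x. \<alpha> ((v # vs)[Suc i := x]))"
    using assms unfolding alternating_form_def by (metis Suc_less_eq length_Cons)
  then show "linear (\<lambda>x. \<alpha> (v # vs[i := x]))" by simp
next
  fix vs :: "'a list" and i j assume "j < length vs" "i < j" "vs ! i = vs ! j"
  then have "Suc j < length (v # vs)" "Suc i < Suc j" "(v # vs) ! Suc i = (v # vs) ! Suc j" by auto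
  then show "\<alpha> (v # vs) = 0"
    using assms unfolding alternating_form_def by metis
qed

lemma alternating_form_swap:
  assumes "alternating_form \<alpha>"
  shows "\<alpha> (v # w # vs) = - \<alpha> (w # v # vs)"
proof -
  have l1: "linear (\<lambda>v. \<alpha> (v # ws))" for ws by (rule alternating_form_linear_Cons[OF assms])
  have l2: "linear (\<lambda>w. \<alpha> (v # w # ws))" for v ws
    by (rule alternating_form_linear_Cons[OF alternating_form_contract[OF assms]])
  have "0 = \<alpha> ((v + w) # (v + w) # vs)"
    by (simp add: alternating_form_Cons_Cons[OF assms])
  also have "\<dots> = \<alpha> (v # v # vs) + \<alpha> (v # w # vs) + (\<alpha> (w # v # vs) + \<alpha> (w # w # vs))"
    by (simp add: linear_add[OF l1] linear_add[OF l2])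
  finally show ?thesis
    by (simp add: alternating_form_Cons_Cons[OF assms])
qed

text \<open>The argument at place \<open>i\<close> reaches the front by \<open>i\<close>
  transpositions of neighbours.\<close>

lemma alternating_form_move_front:
  assumes "alternating_form \<alpha>" "i < length vs"
  shows "\<alpha> vs = (- 1) ^ i * \<alpha> (vs ! i # nths vs (- {i}))"
  using assms
proof (induction vs arbitrary: \<alpha> i)
  case (Cons v vs)
  have "nths vs {j. Suc j \<noteq> 0} = vs" by (simp add: nths_all)
  then have 0: "nths (v # vs) (- {0}) = vs"
    by (simp add: nths_Cons)
  show ?case
  proof (cases i)
    case 0
    then show ?thesis by (simp add: \<open>nths (v # vs) (- {0}) = vs\<close>)
  next
    case (Suc k)
    have "{j. Suc j \<noteq> Suc k} = - {k}" by auto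
    then have *: "nths (v # vs) (- {Suc k}) = v # nths vs (- {k})"
      by (simp add: nths_Cons)
    have "\<alpha> (v # vs) = (- 1) ^ k * \<alpha> (v # vs ! k # nths vs (- {k}))"
      using Cons.IH[OF alternating_form_contract[OF Cons.prems(1)], of k v] Cons.prems(2) Suc by simp
    then show ?thesis
      using alternating_form_swap[OF Cons.prems(1), of v "vs ! k"] by (simp add: Suc *)
  qed
qed simp

text \<open>Repetitions away from the first place are handled by the contraction. If the first
  vector recurs later, its second copy is moved to the second place inside the contraction, where
  \<open>alt\<close> applies.\<close>

lemma alternating_formI:
  assumes lin: "\<And>vs. linear (\<lambda>v. \<alpha> (v # vs))"
    and con: "\<And>v. alternating_form (\<lambda>ws. \<alpha> (v # ws))"
    and alt: "\<And>v vs. \<alpha> (v # v # vs) = 0"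
  shows "alternating_form \<alpha>"
  unfolding alternating_form_def
proof (intro conjI allI impI)
  fix vs :: "'a list" and i assume i: "i < length vs"
  then obtain v ws where vs: "vs = v # ws" by (cases vs) auto
  show "linear (\<lambda>x. \<alpha> (vs[i := x]))"
  proof (cases i)
    case (Suc k)
    then show ?thesis
      using con[of v] i unfolding vs alternating_form_def by auto
  qed (simp add: vs lin)
next
  fix vs :: "'a list" and i j assume ij: "j < length vs" "i < j" "vs ! i = vs ! j"
  then obtain v ws where vs: "vs = v # ws" by (cases vs) auto
  show "\<alpha> vs = 0"
  proof (cases i)
    case 0
    then have "j - 1 < length ws" "ws ! (j - 1) = v"
      using ij vs by auto
    then show ?thesis
      using alternating_form_move_front[OF con, of "j - 1" ws v] alt by (simp add: vs)
  next
    case (Suc k)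
    then obtain l where "j = Suc l" using ij by (cases j) auto
    then show ?thesis
      using con[of v] ij Suc unfolding vs alternating_form_def by auto
  qed
qed

text \<open>The closure of alternating forms under operations which commute with contraction only up to
  further operations is proved by induction on the degree, with the following bounded notion.\<close>

fun alternating_upto :: "nat \<Rightarrow> ('e::real_vector list \<Rightarrow> real) \<Rightarrow> bool" where
  "alternating_upto 0 \<alpha> \<longleftrightarrow> True"
| "alternating_upto (Suc n) \<alpha> \<longleftrightarrow>
     (\<forall>vs. linear (\<lambda>v. \<alpha> (v # vs))) \<and> (\<forall>v. alternating_upto n (\<lambda>ws. \<alpha> (v # ws))) \<and>
     (\<forall>v vs. \<alpha> (v # v # vs) = 0)"

text \<open>Truncation turns the bounded notion into a genuine alternating form. A list of length n
  does not distinguish a form from its truncation at n, so the unbounded notion can be recovered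
  degree by degree.\<close>

lemma alternating_upto_truncate:
  "alternating_upto n \<alpha> \<Longrightarrow> alternating_form (\<lambda>ws. if length ws \<le> n then \<alpha> ws else 0)"
proof (induction n arbitrary: \<alpha>)
  case 0
  show ?case
    by (rule alternating_formI) (auto simp: linear_zero alternating_form_def)
next
  case (Suc n)
  have 1: "linear (\<lambda>v. if length (v # vs) \<le> Suc n then \<alpha> (v # vs) else 0)" for vs
    using Suc.prems by (cases "length vs \<le> n") (simp_all add: linear_zero)
  have 2: "alternating_form (\<lambda>ws. if length (v # ws) \<le> Suc n then \<alpha> (v # ws) else 0)" for v
    using Suc.IH[of "\<lambda>ws. \<alpha> (v # ws)"] Suc.prems by simp
  show ?case
    by (rule alternating_formI[OF 1 2]) (use Suc.prems in simp)
qed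

lemma alternating_formI_upto:
  assumes "\<And>n. alternating_upto n \<alpha>"
  shows "alternating_form \<alpha>"
  unfolding alternating_form_def
proof (intro conjI allI impI)
  fix vs :: "'a list" and i assume "i < length vs"
  then have "linear (\<lambda>v. if length (vs[i := v]) \<le> length vs then \<alpha> (vs[i := v]) else 0)"
    using alternating_upto_truncate[OF assms, of "length vs"] unfolding alternating_form_def by blast
  then show "linear (\<lambda>v. \<alpha> (vs[i := v]))" by simp
next
  fix vs :: "'a list" and i j assume "j < length vs" "i < j" "vs ! i = vs ! j"
  then have "(if length vs \<le> length vs then \<alpha> vs else 0) = 0"
    using alternating_upto_truncate[OF assms, of "length vs"] unfolding alternating_form_def by blast
  then show "\<alpha> vs = 0" by simp
qed

lemma alternating_upto: "alternating_form \<alpha> \<Longrightarrow> alternating_upto n \<alpha>"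
  by (induction n arbitrary: \<alpha>)
     (auto simp: alternating_form_linear_Cons alternating_form_contract alternating_form_Cons_Cons)

lemma linear_real_add:
  fixes f g :: "'a::real_vector \<Rightarrow> real"
  shows "linear f \<Longrightarrow> linear g \<Longrightarrow> linear (\<lambda>v. f v + g v)"
  by (rule linear_compose_add)

lemma linear_real_mult:
  fixes f :: "'a::real_vector \<Rightarrow> real"
  shows "linear f \<Longrightarrow> linear (\<lambda>v. c * f v)"
  using linear_compose_scale_right[of f c] by simp

lemma alternating_upto_add:
  "alternating_upto n \<alpha> \<Longrightarrow> alternating_upto n \<beta> \<Longrightarrow> alternating_upto n (\<lambda>ws. \<alpha> ws + \<beta> ws)"
  by (induction n arbitrary: \<alpha> \<beta>) (auto simp: linear_real_add)

lemma alternating_upto_mult: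
  "alternating_upto n \<alpha> \<Longrightarrow> alternating_upto n (\<lambda>ws. c * \<alpha> ws)"
  by (induction n arbitrary: \<alpha>) (auto simp: linear_real_mult)

lemma alternating_form_add:
  "alternating_form \<alpha> \<Longrightarrow> alternating_form \<beta> \<Longrightarrow> alternating_form (\<lambda>ws. \<alpha> ws + \<beta> ws)"
  by (rule alternating_formI_upto) (simp add: alternating_upto_add alternating_upto)

lemma alternating_form_zero: "alternating_form (\<lambda>ws. 0)"
  by (auto simp: alternating_form_def linear_zero)

lemma alternating_form_grade:
  assumes "alternating_form \<alpha>"
  shows "alternating_form (grade \<alpha>)"
  unfolding alternating_form_def grade_def
proof (intro conjI allI impI)
  fix vs :: "'a list" and i assume "i < length vs"
  then have "linear (\<lambda>v. \<alpha> (vs[i := v]))"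
    using assms unfolding alternating_form_def by blast
  then show "linear (\<lambda>v. (- 1) ^ length (vs[i := v]) * \<alpha> (vs[i := v]))"
    by (simp add: linear_real_mult)
next
  fix vs :: "'a list" and i j assume "j < length vs" "i < j" "vs ! i = vs ! j"
  then have "\<alpha> vs = 0"
    using assms unfolding alternating_form_def by blast
  then show "(- 1) ^ length vs * \<alpha> vs = 0" by simp
qed

lemma linear_wedge_pt_left:
  assumes "\<And>ws. linear (\<lambda>v. \<alpha> v ws)"
  shows "linear (\<lambda>v. wedge_pt (\<alpha> v) \<beta> vs)"
proof -
  have "\<alpha> (v + w) = (\<lambda>ws. \<alpha> v ws + \<alpha> w ws)" "\<alpha> (c *\<^sub>R v) = (\<lambda>ws. c * \<alpha> v ws)" for v w c
    by (simp_all add: fun_eq_iff linear_add[OF assms] linear_cmul[OF assms])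
  then show ?thesis
    by (intro linearI) (simp_all add: wedge_pt_add_left wedge_pt_scale_left)
qed

lemma linear_wedge_pt_right:
  assumes "\<And>ws. linear (\<lambda>v. \<beta> v ws)"
  shows "linear (\<lambda>v. wedge_pt \<alpha> (\<beta> v) vs)"
proof -
  have "\<beta> (v + w) = (\<lambda>ws. \<beta> v ws + \<beta> w ws)" "\<beta> (c *\<^sub>R v) = (\<lambda>ws. c * \<beta> v ws)" for v w c
    by (simp_all add: fun_eq_iff linear_add[OF assms] linear_cmul[OF assms])
  then show ?thesis
    by (intro linearI) (simp_all add: wedge_pt_add_right wedge_pt_scale_right)
qed

text \<open>A contraction of \<alpha> \<and> \<beta> is a sum of two wedge products of alternating
  forms, so both factors stay arbitrary in the induction. For a repeated vector the two terms in
  which each factor receives one copy cancel, because contraction anticommutes with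
  \<open>grade\<close>.\<close>

lemma alternating_upto_wedge_pt:
  "alternating_form \<alpha> \<Longrightarrow> alternating_form \<beta> \<Longrightarrow> alternating_upto n (wedge_pt \<alpha> \<beta>)"
proof (induction n arbitrary: \<alpha> \<beta>)
  case (Suc n)
  have "linear (\<lambda>v. wedge_pt \<alpha> \<beta> (v # vs))" for vs
    unfolding wedge_pt_Cons
    by (intro linear_real_add linear_wedge_pt_left linear_wedge_pt_right alternating_form_linear_Cons Suc.prems)
  moreover have "alternating_upto n (\<lambda>ws. wedge_pt \<alpha> \<beta> (v # ws))" for v
    unfolding wedge_pt_Cons
    by (intro alternating_upto_add Suc.IH alternating_form_contract alternating_form_grade Suc.prems)
  moreover have "wedge_pt \<alpha> \<beta> (v # v # vs) = 0" for v vs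
    by (simp add: wedge_pt_Cons grade_Cons grade_grade alternating_form_Cons_Cons[OF Suc.prems(1)]
        alternating_form_Cons_Cons[OF Suc.prems(2)] wedge_pt_zero_left wedge_pt_zero_right
        wedge_pt_uminus_left)
  ultimately show ?case by simp
qed simp

lemma alternating_form_wedge_pt:
  "alternating_form \<alpha> \<Longrightarrow> alternating_form \<beta> \<Longrightarrow> alternating_form (wedge_pt \<alpha> \<beta>)"
  by (rule alternating_formI_upto) (rule alternating_upto_wedge_pt)

section \<open>The exterior derivative in coordinates\<close>

lemma nths_Cons_delete_0: "nths (v # vs) (- {0}) = vs"
proof -
  have "{j. Suc j \<in> - {0}} = UNIV" by auto
  then show ?thesis by (simp add: nths_Cons nths_all)
qed

lemma nths_Cons_delete_Suc: "nths (v # vs) (- {Suc i}) = v # nths vs (- {i})"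
proof -
  have "{j. Suc j \<in> - {Suc i}} = - {i}" by auto
  then show ?thesis by (simp add: nths_Cons)
qed

lemma length_nths_delete: "i < length vs \<Longrightarrow> length (nths vs (- {i})) = length vs - 1"
proof (induction vs arbitrary: i)
  case (Cons v vs)
  then show ?case
    by (cases i) (auto simp: nths_Cons_delete_0 nths_Cons_delete_Suc)
qed simp

lemma nths_list_update_delete: "nths (vs[i := x]) (- {i}) = nths vs (- {i})"
proof (induction vs arbitrary: i)
  case (Cons v vs)
  then show ?case
    by (cases i) (auto simp: nths_Cons_delete_0 nths_Cons_delete_Suc)
qed simp

lemma ext_deriv_eucl_Nil: "ext_deriv_eucl \<omega> y [] = 0"
  by (simp add: ext_deriv_eucl_def)

text \<open>Cartan's formula for the constant field \<open>v\<close>, whose Lie derivative is the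
  directional derivative of the coefficients. It reduces statements about d to an induction on the
  argument list.\<close>

lemma ext_deriv_eucl_Cons:
  "ext_deriv_eucl \<omega> y (v # vs) =
     frechet_derivative (\<lambda>z. \<omega> z vs) (at y) v - ext_deriv_eucl (\<lambda>z ws. \<omega> z (v # ws)) y vs"
  unfolding ext_deriv_eucl_def length_Cons sum.lessThan_Suc_shift
  by (simp add: nths_Cons_delete_0 nths_Cons_delete_Suc sum_negf)

lemma ext_deriv_eucl_cong:
  assumes "open S" "y \<in> S" "\<And>z ws. z \<in> S \<Longrightarrow> \<omega> z ws = \<omega>' z ws"
  shows "ext_deriv_eucl \<omega> y vs = ext_deriv_eucl \<omega>' y vs"
  unfolding ext_deriv_eucl_def
  by (intro sum.cong refl arg_cong2[of _ _ _ _ "(*)"] fun_cong[OF frechet_derivative_cong[OF assms(1,2)]] assms(3))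

lemma frechet_derivative_eqI:
  "(f has_derivative f') (at x) \<Longrightarrow> frechet_derivative f (at x) v = f' v"
  using frechet_derivative_at by metis

lemma frechet_derivative_add_real:
  fixes f g :: "'a::real_normed_vector \<Rightarrow> real"
  shows "f differentiable at y \<Longrightarrow> g differentiable at y \<Longrightarrow>
   frechet_derivative (\<lambda>z. f z + g z) (at y) v = frechet_derivative f (at y) v + frechet_derivative g (at y) v"
  by (rule frechet_derivative_eqI) (auto intro!: has_derivative_add simp: frechet_derivative_works)

lemma frechet_derivative_diff_real:
  fixes f g :: "'a::real_normed_vector \<Rightarrow> real"
  shows "f differentiable at y \<Longrightarrow> g differentiable at y \<Longrightarrow>
   frechet_derivative (\<lambda>z. f z - g z) (at y) v = frechet_derivative f (at y) v - frechet_derivative g (at y) v"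
  by (rule frechet_derivative_eqI) (auto intro!: has_derivative_diff simp: frechet_derivative_works)

lemma frechet_derivative_cmult_real:
  fixes f :: "'a::real_normed_vector \<Rightarrow> real"
  shows "f differentiable at y \<Longrightarrow>
   frechet_derivative (\<lambda>z. c * f z) (at y) v = c * frechet_derivative f (at y) v"
  by (rule frechet_derivative_eqI) (auto intro!: has_derivative_mult_right simp: frechet_derivative_works)

lemma frechet_derivative_sum_real:
  fixes f :: "'i \<Rightarrow> 'a::real_normed_vector \<Rightarrow> real"
  shows "(\<And>i. i \<in> A \<Longrightarrow> f i differentiable at y) \<Longrightarrow>
   frechet_derivative (\<lambda>z. \<Sum>i\<in>A. f i z) (at y) v = (\<Sum>i\<in>A. frechet_derivative (f i) (at y) v)"
  by (rule frechet_derivative_eqI) (auto intro!: has_derivative_sum simp: frechet_derivative_works)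

lemma ext_deriv_eucl_add:
  assumes "\<And>ws. (\<lambda>z. \<alpha> z ws) differentiable at y" "\<And>ws. (\<lambda>z. \<beta> z ws) differentiable at y"
  shows "ext_deriv_eucl (\<lambda>z ws. \<alpha> z ws + \<beta> z ws) y vs = ext_deriv_eucl \<alpha> y vs + ext_deriv_eucl \<beta> y vs"
  unfolding ext_deriv_eucl_def
  by (simp add: frechet_derivative_add_real[OF assms] algebra_simps sum.distrib)

lemma ext_deriv_eucl_diff:
  assumes "\<And>ws. (\<lambda>z. \<alpha> z ws) differentiable at y" "\<And>ws. (\<lambda>z. \<beta> z ws) differentiable at y"
  shows "ext_deriv_eucl (\<lambda>z ws. \<alpha> z ws - \<beta> z ws) y vs = ext_deriv_eucl \<alpha> y vs - ext_deriv_eucl \<beta> y vs"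
  unfolding ext_deriv_eucl_def
  by (simp add: frechet_derivative_diff_real[OF assms] algebra_simps sum_subtractf)

lemma ext_deriv_eucl_zero: "ext_deriv_eucl (\<lambda>z ws. 0) y vs = 0"
  by (simp add: ext_deriv_eucl_def)

text \<open>d raises the degree by one, so the sign seen inside and the sign seen outside differ by
  a factor -1. The empty list is separate because its derivative is an empty sum.\<close>

lemma ext_deriv_eucl_grade:
  assumes "\<And>ws. (\<lambda>z. \<alpha> z ws) differentiable at y"
  shows "ext_deriv_eucl (\<lambda>z. grade (\<alpha> z)) y vs = - grade (ext_deriv_eucl \<alpha> y) vs"
proof (cases vs)
  case (Cons v ws)
  have "frechet_derivative (\<lambda>z. grade (\<alpha> z) (nths vs (- {i}))) (at y) u =
    - ((- 1) ^ length vs * frechet_derivative (\<lambda>z. \<alpha> z (nths vs (- {i}))) (at y) u)"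
    if "i < length vs" for i u
    unfolding grade_def frechet_derivative_cmult_real[OF assms] length_nths_delete[OF that]
    using Cons by simp
  then show ?thesis
    unfolding ext_deriv_eucl_def grade_def[of "\<lambda>vs. \<Sum>i<length vs. _ vs i"]
    by (simp add: sum_distrib_left sum_negf mult_ac)
qed (simp add: ext_deriv_eucl_Nil grade_def)

lemma has_derivative_wedge_pt:
  assumes "\<And>ws. (\<lambda>z. \<alpha> z ws) differentiable at y" "\<And>ws. (\<lambda>z. \<beta> z ws) differentiable at y"
  shows "((\<lambda>z. wedge_pt (\<alpha> z) (\<beta> z) vs) has_derivative
    (\<lambda>v. wedge_pt (\<lambda>ws. frechet_derivative (\<lambda>z. \<alpha> z ws) (at y) v) (\<beta> y) vs +
          wedge_pt (\<alpha> y) (\<lambda>ws. frechet_derivative (\<lambda>z. \<beta> z ws) (at y) v) vs)) (at y)"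
proof -
  have d: "((\<lambda>z. \<alpha> z ws) has_derivative frechet_derivative (\<lambda>z. \<alpha> z ws) (at y)) (at y)"
      "((\<lambda>z. \<beta> z ws) has_derivative frechet_derivative (\<lambda>z. \<beta> z ws) (at y)) (at y)" for ws
    using assms by (simp_all add: frechet_derivative_works)
  show ?thesis
    unfolding wedge_pt_def mult.assoc
    by (rule has_derivative_eq_rhs[OF has_derivative_sum[OF has_derivative_mult_right[OF has_derivative_mult[OF d]]]])
       (simp add: algebra_simps sum.distrib)
qed

text \<open>By Cartan's formula and the antiderivation rule, contracting with the first vector
  leaves Leibniz rules on a shorter list for two new pairs: (contracted \<alpha>, \<beta>) and
  (\<open>grade\<close> of \<alpha>, contracted \<beta>). Hence the induction is over arbitrary
  forms.\<close>

lemma ext_deriv_eucl_wedge_pt: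
  assumes "\<And>ws. (\<lambda>z. \<alpha> z ws) differentiable at y" "\<And>ws. (\<lambda>z. \<beta> z ws) differentiable at y"
  shows "ext_deriv_eucl (\<lambda>z. wedge_pt (\<alpha> z) (\<beta> z)) y vs =
    wedge_pt (ext_deriv_eucl \<alpha> y) (\<beta> y) vs + wedge_pt (grade (\<alpha> y)) (ext_deriv_eucl \<beta> y) vs"
  using assms
proof (induction vs arbitrary: \<alpha> \<beta>)
  case Nil
  then show ?case by (simp add: wedge_pt_Nil ext_deriv_eucl_Nil)
next
  case (Cons v vs)
  let ?\<alpha>v = "\<lambda>z ws. \<alpha> z (v # ws)" and ?\<beta>v = "\<lambda>z ws. \<beta> z (v # ws)"
  let ?D\<alpha> = "\<lambda>ws. frechet_derivative (\<lambda>z. \<alpha> z ws) (at y) v"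
  let ?D\<beta> = "\<lambda>ws. frechet_derivative (\<lambda>z. \<beta> z ws) (at y) v"
  have dg: "(\<lambda>z. grade (\<alpha> z) ws) differentiable at y" for ws
    unfolding grade_def using Cons.prems(1) by simp
  have dw: "(\<lambda>z. wedge_pt (\<gamma> z) (\<delta> z) ws) differentiable at y"
    if "\<And>ws. (\<lambda>z. \<gamma> z ws) differentiable at y" "\<And>ws. (\<lambda>z. \<delta> z ws) differentiable at y" for \<gamma> \<delta> ws
    using has_derivative_wedge_pt[where \<alpha> = \<gamma> and \<beta> = \<delta>, OF that] differentiable_def by blast
  have "ext_deriv_eucl (\<lambda>z. wedge_pt (\<alpha> z) (\<beta> z)) y (v # vs) =
      wedge_pt ?D\<alpha> (\<beta> y) vs + wedge_pt (\<alpha> y) ?D\<beta> vs -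
      ext_deriv_eucl (\<lambda>z ws. wedge_pt (?\<alpha>v z) (\<beta> z) ws + wedge_pt (grade (\<alpha> z)) (?\<beta>v z) ws) y vs"
    unfolding ext_deriv_eucl_Cons wedge_pt_Cons
    by (simp add: frechet_derivative_eqI[OF has_derivative_wedge_pt[OF Cons.prems]])
  also have "ext_deriv_eucl (\<lambda>z ws. wedge_pt (?\<alpha>v z) (\<beta> z) ws + wedge_pt (grade (\<alpha> z)) (?\<beta>v z) ws) y vs =
      wedge_pt (ext_deriv_eucl ?\<alpha>v y) (\<beta> y) vs + wedge_pt (grade (?\<alpha>v y)) (ext_deriv_eucl \<beta> y) vs +
      (wedge_pt (\<lambda>ws. - grade (ext_deriv_eucl \<alpha> y) ws) (?\<beta>v y) vs + wedge_pt (\<alpha> y) (ext_deriv_eucl ?\<beta>v y) vs)"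
    by (simp add: ext_deriv_eucl_add[OF dw dw] Cons.prems dg Cons.IH grade_grade
        ext_deriv_eucl_grade[OF Cons.prems(1), abs_def])
  finally show ?case
    by (simp add: wedge_pt_Cons ext_deriv_eucl_Cons wedge_pt_diff_left wedge_pt_diff_right
        wedge_pt_uminus_left grade_Cons grade_grade)
qed

lemma smooth_on_ext_deriv_eucl:
  assumes "open S" "\<And>ws. smooth_on S (\<lambda>z. \<omega> z ws)"
  shows "smooth_on S (\<lambda>z. ext_deriv_eucl \<omega> z vs)"
  unfolding ext_deriv_eucl_def
  by (intro smooth_on_sum smooth_on_mult smooth_on_const smooth_on_frechet_derivative assms)

text \<open>Contracting d d \<omega> with v leaves three terms: the derivative of d \<omega> along
  v, minus d of the derivative of \<omega> along v, plus d d of the contracted form. The first two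
  cancel by symmetry of second derivatives, the third vanishes by induction.\<close>

lemma ext_deriv_eucl_ext_deriv_eucl:
  fixes \<omega> :: "'e::euclidean_space \<Rightarrow> 'e list \<Rightarrow> real"
  assumes "open S" "y \<in> S" "\<And>ws. smooth_on S (\<lambda>z. \<omega> z ws)"
  shows "ext_deriv_eucl (ext_deriv_eucl \<omega>) y vs = 0"
  using assms(3)
proof (induction vs arbitrary: \<omega>)
  case Nil
  then show ?case by (simp add: ext_deriv_eucl_Nil)
next
  case (Cons v vs)
  let ?\<omega>v = "\<lambda>z ws. \<omega> z (v # ws)"
  let ?D\<omega> = "\<lambda>z ws. frechet_derivative (\<lambda>z. \<omega> z ws) (at z) v"
  have dD: "(\<lambda>z. frechet_derivative (\<lambda>z. \<omega> z ws) (at z) u) differentiable at y" for ws u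
    by (rule smooth_on_differentiable[OF smooth_on_frechet_derivative[OF Cons.prems] assms(2)])
  have dd: "(\<lambda>z. ext_deriv_eucl ?\<omega>v z ws) differentiable at y" for ws
    by (rule smooth_on_differentiable[OF smooth_on_ext_deriv_eucl[OF assms(1)] assms(2)]) (rule Cons.prems)
  have "frechet_derivative (\<lambda>z. ext_deriv_eucl \<omega> z vs) (at y) v =
      (\<Sum>i<length vs. (-1) ^ i * frechet_derivative (\<lambda>z. frechet_derivative (\<lambda>z. \<omega> z (nths vs (- {i}))) (at z) (vs ! i)) (at y) v)"
    unfolding ext_deriv_eucl_def
    by (subst frechet_derivative_sum_real) (auto simp: frechet_derivative_cmult_real dD)
  also have "\<dots> = ext_deriv_eucl ?D\<omega> y vs"
    unfolding ext_deriv_eucl_def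
    by (intro sum.cong refl arg_cong2[of _ _ _ _ "(*)"] frechet_derivative_commute[OF assms(1) Cons.prems assms(2)])
  finally have 1: "frechet_derivative (\<lambda>z. ext_deriv_eucl \<omega> z vs) (at y) v = ext_deriv_eucl ?D\<omega> y vs" .
  have "ext_deriv_eucl (\<lambda>z ws. ext_deriv_eucl \<omega> z (v # ws)) y vs =
      ext_deriv_eucl ?D\<omega> y vs - ext_deriv_eucl (ext_deriv_eucl ?\<omega>v) y vs"
    unfolding ext_deriv_eucl_Cons by (rule ext_deriv_eucl_diff[OF dD dd])
  also have "ext_deriv_eucl (ext_deriv_eucl ?\<omega>v) y vs = 0"
    by (rule Cons.IH) (rule Cons.prems)
  finally show ?case
    by (simp add: ext_deriv_eucl_Cons 1)
qed

section \<open>Alternation of the exterior derivative\<close>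

lemma linear_frechet_derivative_param:
  assumes "open S" "y \<in> S" "\<And>z. z \<in> S \<Longrightarrow> linear (\<lambda>x. f x z :: real)" "\<And>x. f x differentiable at y"
  shows "linear (\<lambda>x. frechet_derivative (f x) (at y) v)"
proof (rule linearI)
  fix a b
  have "frechet_derivative (f (a + b)) (at y) = frechet_derivative (\<lambda>z. f a z + f b z) (at y)"
    by (rule frechet_derivative_cong[OF assms(1,2)]) (rule linear_add[OF assms(3)])
  then show "frechet_derivative (f (a + b)) (at y) v = frechet_derivative (f a) (at y) v + frechet_derivative (f b) (at y) v"
    by (simp add: frechet_derivative_add_real assms(4))
next
  fix c b
  have "frechet_derivative (f (c *\<^sub>R b)) (at y) = frechet_derivative (\<lambda>z. c * f b z) (at y)"
    by (rule frechet_derivative_cong[OF assms(1,2)]) (simp add: linear_cmul[OF assms(3)])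
  then show "frechet_derivative (f (c *\<^sub>R b)) (at y) v = c *\<^sub>R frechet_derivative (f b) (at y) v"
    by (simp add: frechet_derivative_cmult_real assms(4))
qed

lemma alternating_form_frechet_derivative:
  assumes "open S" "y \<in> S" "\<And>ws. (\<lambda>z. \<omega> z ws) differentiable at y" "\<And>z. z \<in> S \<Longrightarrow> alternating_form (\<omega> z)"
  shows "alternating_form (\<lambda>ws. frechet_derivative (\<lambda>z. \<omega> z ws) (at y) v)"
  unfolding alternating_form_def
proof (intro conjI allI impI)
  fix vs :: "'b list" and i assume "i < length vs"
  then have "linear (\<lambda>x. \<omega> z (vs[i := x]))" if "z \<in> S" for z
    using assms(4)[OF that] unfolding alternating_form_def by blast
  then show "linear (\<lambda>x. frechet_derivative (\<lambda>z. \<omega> z (vs[i := x])) (at y) v)"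
    by (intro linear_frechet_derivative_param[OF assms(1,2)] assms(3))
next
  fix vs :: "'b list" and i j assume "j < length vs" "i < j" "vs ! i = vs ! j"
  then have "\<omega> z vs = 0" if "z \<in> S" for z
    using assms(4)[OF that] unfolding alternating_form_def by blast
  then have "frechet_derivative (\<lambda>z. \<omega> z vs) (at y) = frechet_derivative (\<lambda>z. 0) (at y)"
    by (intro frechet_derivative_cong[OF assms(1,2)])
  then show "frechet_derivative (\<lambda>z. \<omega> z vs) (at y) v = 0" by simp
qed

text \<open>A contraction of d \<omega> again contains a d, of a contracted form, which is why the
  bounded notion is used. On a repeated vector, Cartan's formula applied twice leaves only d of the
  twice contracted form, and that form is zero near \<open>y\<close>.\<close>

lemma alternating_upto_ext_deriv_eucl:
  assumes "open S" "y \<in> S" "\<And>ws. (\<lambda>z. \<omega> z ws) differentiable at y" "\<And>z. z \<in> S \<Longrightarrow> alternating_form (\<omega> z)"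
  shows "alternating_upto n (ext_deriv_eucl \<omega> y)"
  using assms(3,4)
proof (induction n arbitrary: \<omega>)
  case (Suc n)
  have lin: "linear (\<lambda>v. ext_deriv_eucl (\<lambda>z ws. \<omega> z (v # ws)) y vs)" for vs
    unfolding ext_deriv_eucl_def
    by (intro linear_compose_sum ballI linear_real_mult linear_frechet_derivative_param[OF assms(1,2)]
        alternating_form_linear_Cons Suc.prems)
  have "linear (\<lambda>v. ext_deriv_eucl \<omega> y (v # vs))" for vs
    unfolding ext_deriv_eucl_Cons
    by (intro linear_compose_sub linear_frechet_derivative lin Suc.prems(1))
  moreover have "alternating_upto n (\<lambda>ws. ext_deriv_eucl \<omega> y (v # ws))" for v
  proof -
    have "alternating_upto n (\<lambda>ws. (-1) * ext_deriv_eucl (\<lambda>z ws. \<omega> z (v # ws)) y ws)"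
      by (rule alternating_upto_mult, rule Suc.IH) (auto intro: Suc.prems alternating_form_contract)
    moreover have "alternating_upto n (\<lambda>ws. frechet_derivative (\<lambda>z. \<omega> z ws) (at y) v)"
      by (rule alternating_upto, rule alternating_form_frechet_derivative[OF assms(1,2) Suc.prems])
    ultimately show ?thesis
      unfolding ext_deriv_eucl_Cons using alternating_upto_add by fastforce
  qed
  moreover have "ext_deriv_eucl \<omega> y (v # v # vs) = 0" for v vs
  proof -
    have "ext_deriv_eucl (\<lambda>z ws. \<omega> z (v # v # ws)) y vs = ext_deriv_eucl (\<lambda>z ws. 0) y vs"
      by (intro ext_deriv_eucl_cong[OF assms(1,2)] alternating_form_Cons_Cons Suc.prems)
    then show ?thesis
      by (simp add: ext_deriv_eucl_Cons ext_deriv_eucl_zero)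
  qed
  ultimately show ?case by simp
qed simp

lemma alternating_form_ext_deriv_eucl:
  assumes "open S" "y \<in> S" "\<And>ws. (\<lambda>z. \<omega> z ws) differentiable at y" "\<And>z. z \<in> S \<Longrightarrow> alternating_form (\<omega> z)"
  shows "alternating_form (ext_deriv_eucl \<omega> y)"
  by (rule alternating_formI_upto) (rule alternating_upto_ext_deriv_eucl[OF assms])

section \<open>Forms evaluated on moving vectors, and pullbacks\<close>

lemma alternating_form_expand_Cons:
  fixes \<alpha> :: "'e::euclidean_space list \<Rightarrow> real"
  assumes "alternating_form \<alpha>"
  shows "\<alpha> (v # vs) = (\<Sum>b\<in>Basis. (v \<bullet> b) * \<alpha> (b # vs))"
  using linear_eq_sum_Basis[OF alternating_form_linear_Cons[OF assms], where v = v] by simp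

text \<open>The product rule for a form whose arguments also depend on the point. Expanding the
  first field in the constant basis turns the expression into scalar functions times forms with one
  moving argument fewer.\<close>

lemma has_derivative_form_fields:
  fixes \<omega> :: "'a::euclidean_space \<Rightarrow> 'e::euclidean_space list \<Rightarrow> real"
  assumes "open S" "y \<in> S" "\<And>ws. (\<lambda>z. \<omega> z ws) differentiable at y" "\<And>z. z \<in> S \<Longrightarrow> alternating_form (\<omega> z)"
    and "\<And>g. g \<in> set gs \<Longrightarrow> g differentiable at y"
  shows "((\<lambda>z. \<omega> z (map (\<lambda>g. g z) gs)) has_derivative
     (\<lambda>v. frechet_derivative (\<lambda>z. \<omega> z (map (\<lambda>g. g y) gs)) (at y) v +
       (\<Sum>j<length gs. \<omega> y ((map (\<lambda>g. g y) gs)[j := frechet_derivative (gs ! j) (at y) v])))) (at y)"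
  using assms(3-)
proof (induction gs arbitrary: \<omega>)
  case Nil
  then show ?case by (simp add: frechet_derivative_works)
next
  case (Cons g gs)
  let ?ys = "map (\<lambda>g. g y) gs"
  let ?u = "\<lambda>j v. ?ys[j := frechet_derivative (gs ! j) (at y) v]"
  let ?D = "\<lambda>b v. frechet_derivative (\<lambda>z. \<omega> z (b # ?ys)) (at y) v + (\<Sum>j<length gs. \<omega> y (b # ?u j v))"
  have alt: "alternating_form (\<omega> y)" using Cons.prems(2) assms(2) .
  have dg: "(g has_derivative frechet_derivative g (at y)) (at y)"
    using Cons.prems(3) by (simp add: frechet_derivative_works)
  have dIH: "((\<lambda>z. \<omega> z (b # map (\<lambda>g. g z) gs)) has_derivative ?D b) (at y)" for b
    by (rule Cons.IH[of "\<lambda>z ws. \<omega> z (b # ws)"]) (auto intro: Cons.prems alternating_form_contract)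
  have "((\<lambda>z. \<Sum>b\<in>Basis. (g z \<bullet> b) * \<omega> z (b # map (\<lambda>g. g z) gs)) has_derivative
      (\<lambda>v. \<Sum>b\<in>Basis. (g y \<bullet> b) * ?D b v + (frechet_derivative g (at y) v \<bullet> b) * \<omega> y (b # ?ys))) (at y)"
    by (intro has_derivative_sum has_derivative_mult has_derivative_inner_left dg dIH)
  then have d: "((\<lambda>z. \<omega> z (g z # map (\<lambda>g. g z) gs)) has_derivative
      (\<lambda>v. \<Sum>b\<in>Basis. (g y \<bullet> b) * ?D b v + (frechet_derivative g (at y) v \<bullet> b) * \<omega> y (b # ?ys))) (at y)"
    by (rule has_derivative_transform_within_open[OF _ assms(1,2)])
       (rule alternating_form_expand_Cons[OF Cons.prems(2), symmetric])
  have lin: "linear (\<lambda>x. frechet_derivative (\<lambda>z. \<omega> z (x # ?ys)) (at y) v)" for v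
    by (intro linear_frechet_derivative_param[OF assms(1,2)] alternating_form_linear_Cons Cons.prems)
  have eq: "(\<Sum>b\<in>Basis. (g y \<bullet> b) * ?D b v + (frechet_derivative g (at y) v \<bullet> b) * \<omega> y (b # ?ys)) =
      frechet_derivative (\<lambda>z. \<omega> z (g y # ?ys)) (at y) v +
      (\<omega> y (frechet_derivative g (at y) v # ?ys) + (\<Sum>j<length gs. \<omega> y (g y # ?u j v)))" for v
  proof -
    have e1: "frechet_derivative (\<lambda>z. \<omega> z (g y # ?ys)) (at y) v =
        (\<Sum>b\<in>Basis. (g y \<bullet> b) * frechet_derivative (\<lambda>z. \<omega> z (b # ?ys)) (at y) v)"
      using linear_eq_sum_Basis[OF lin, of "g y" v] by simp
    have e2: "(\<Sum>j<length gs. \<omega> y (g y # ?u j v)) = (\<Sum>b\<in>Basis. \<Sum>j<length gs. (g y \<bullet> b) * \<omega> y (b # ?u j v))"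
      unfolding alternating_form_expand_Cons[OF alt, of "g y"] by (rule sum.swap)
    have e3: "\<omega> y (frechet_derivative g (at y) v # ?ys) =
        (\<Sum>b\<in>Basis. (frechet_derivative g (at y) v \<bullet> b) * \<omega> y (b # ?ys))"
      by (rule alternating_form_expand_Cons[OF alt])
    show ?thesis
      unfolding e1 e2 e3 by (simp only: sum.distrib distrib_left sum_distrib_left ac_simps)
  qed
  show ?case
    using d by (simp add: eq sum.lessThan_Suc_shift del: sum.lessThan_Suc)
qed

lemma smooth_on_form_fields:
  fixes \<omega> :: "'a::euclidean_space \<Rightarrow> 'e::euclidean_space list \<Rightarrow> real"
  assumes "open S" "\<And>ws. smooth_on S (\<lambda>z. \<omega> z ws)" "\<And>z. z \<in> S \<Longrightarrow> alternating_form (\<omega> z)"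
    and "\<And>g. g \<in> set gs \<Longrightarrow> smooth_on S g"
  shows "smooth_on S (\<lambda>z. \<omega> z (map (\<lambda>g. g z) gs))"
  using assms(2-)
proof (induction gs arbitrary: \<omega>)
  case (Cons g gs)
  have "smooth_on S (\<lambda>z. \<Sum>b\<in>Basis. (g z \<bullet> b) * \<omega> z (b # map (\<lambda>g. g z) gs))"
  proof (intro smooth_on_sum smooth_on_mult smooth_on_inner assms(1))
    show "smooth_on S g" using Cons.prems(3) by simp
    show "smooth_on S (\<lambda>z. \<omega> z (b # map (\<lambda>g. g z) gs))" for b
      by (rule Cons.IH[of "\<lambda>z ws. \<omega> z (b # ws)"]) (auto intro: Cons.prems alternating_form_contract)
  qed
  then show ?case
    by (rule smooth_on_cong[OF assms(1), rotated])
       (simp add: alternating_form_expand_Cons[OF Cons.prems(2), symmetric])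
qed simp

text \<open>The second derivatives of a coordinate change contribute nothing to the exterior derivative
  of a pullback.\<close>

lemma alternating_sum_symmetric_eq_0:
  assumes "alternating_form \<alpha>" "\<And>v w. H v w = H w v"
  shows "(\<Sum>i<length vs. (- 1) ^ i * (\<Sum>j<length vs - 1.
     \<alpha> ((map L (nths vs (- {i})))[j := H (vs ! i) (nths vs (- {i}) ! j)]))) = 0"
  using assms(1)
proof (induction vs arbitrary: \<alpha>)
  case (Cons v vs)
  let ?n = "length vs" and ?r = "\<lambda>k. nths vs (- {k})"
  \<comment> \<open>Once the second derivative stands in front, symmetry of \<open>H\<close> makes
    the term where \<open>v\<close> differentiates the slot of \<open>vs ! k\<close> equal to the
    one where \<open>vs ! k\<close> differentiates the slot of \<open>v\<close>. They enter the sum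
    with opposite signs; pairs without \<open>v\<close> are left to the induction.\<close>
  have move: "\<alpha> ((map L vs)[k := H v (vs ! k)]) = (- 1) ^ k * \<alpha> (H (vs ! k) v # map L (?r k))"
    if "k < ?n" for k
  proof -
    have "(map L vs)[k := H v (vs ! k)] ! k = H v (vs ! k)" using that by simp
    moreover have "nths ((map L vs)[k := H v (vs ! k)]) (- {k}) = map L (?r k)"
      by (simp add: nths_list_update_delete nths_map)
    moreover have "k < length ((map L vs)[k := H v (vs ! k)])" using that by simp
    ultimately show ?thesis
      using alternating_form_move_front[OF Cons.prems] assms(2) by metis
  qed
  have "(\<Sum>j<?n. \<alpha> ((map L (v # ?r k))[j := H (vs ! k) ((v # ?r k) ! j)])) =
      \<alpha> (H (vs ! k) v # map L (?r k)) +
      (\<Sum>j<?n - 1. \<alpha> (L v # (map L (?r k))[j := H (vs ! k) (?r k ! j)]))" if k: "k < ?n" for k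
  proof -
    obtain m where m: "?n = Suc m" using k by (cases ?n) auto
    show ?thesis unfolding m sum.lessThan_Suc_shift by simp
  qed
  then have "(\<Sum>i<length (v # vs). (- 1) ^ i * (\<Sum>j<length (v # vs) - 1.
       \<alpha> ((map L (nths (v # vs) (- {i})))[j := H ((v # vs) ! i) (nths (v # vs) (- {i}) ! j)]))) =
     (\<Sum>k<?n. \<alpha> ((map L vs)[k := H v (vs ! k)])) -
     ((\<Sum>k<?n. (- 1) ^ k * \<alpha> (H (vs ! k) v # map L (?r k))) +
      (\<Sum>k<?n. (- 1) ^ k * (\<Sum>j<?n - 1. \<alpha> (L v # (map L (?r k))[j := H (vs ! k) (?r k ! j)]))))"
    unfolding length_Cons sum.lessThan_Suc_shift
    by (simp add: nths_Cons_delete_0 nths_Cons_delete_Suc sum_negf sum_subtractf distrib_left sum.distrib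
        del: list.map nth_Cons_Suc)
  also have "(\<Sum>k<?n. (- 1) ^ k * (\<Sum>j<?n - 1. \<alpha> (L v # (map L (?r k))[j := H (vs ! k) (?r k ! j)]))) = 0"
    by (rule Cons.IH[OF alternating_form_contract[OF Cons.prems]])
  finally show ?case by (simp add: move)
qed simp

lemma ext_deriv_eucl_pullback:
  fixes \<phi> :: "'a::euclidean_space \<Rightarrow> 'e::euclidean_space"
  assumes S: "open S" "y \<in> S" and T: "open T" "\<phi> ` S \<subseteq> T" and \<phi>: "smooth_on S \<phi>"
    and \<omega>: "\<And>ws. smooth_on T (\<lambda>z. \<omega> z ws)" "\<And>z. z \<in> T \<Longrightarrow> alternating_form (\<omega> z)"
  shows "ext_deriv_eucl (\<lambda>z ws. \<omega> (\<phi> z) (map (frechet_derivative \<phi> (at z)) ws)) y vs =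
         ext_deriv_eucl \<omega> (\<phi> y) (map (frechet_derivative \<phi> (at y)) vs)"
proof -
  let ?L = "frechet_derivative \<phi> (at y)"
  let ?H = "\<lambda>v w. frechet_derivative (\<lambda>z. frechet_derivative \<phi> (at z) w) (at y) v"
  have \<phi>y: "\<phi> y \<in> T" using S T by auto
  have d: "((\<lambda>z. \<omega> (\<phi> z) ws) has_derivative (\<lambda>v. frechet_derivative (\<lambda>z. \<omega> z ws) (at (\<phi> y)) (?L v))) (at y)" for ws
    by (rule has_derivative_compose[OF smooth_on_has_derivative[OF \<phi> S(2)] smooth_on_has_derivative[OF \<omega>(1) \<phi>y]])
  have "frechet_derivative (\<lambda>z. \<omega> (\<phi> z) (map (frechet_derivative \<phi> (at z)) ws)) (at y) v =
      frechet_derivative (\<lambda>z. \<omega> z (map ?L ws)) (at (\<phi> y)) (?L v) +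
      (\<Sum>j<length ws. \<omega> (\<phi> y) ((map ?L ws)[j := ?H v (ws ! j)]))" for ws v
  proof -
    \<comment> \<open>The arguments of \<omega> move with the point: they are the fields obtained by
      applying the differential of \<phi> to fixed vectors, and their derivatives are values of the
      Hessian \<open>?H\<close>.\<close>
    let ?gs = "map (\<lambda>w z. frechet_derivative \<phi> (at z) w) ws"
    have "frechet_derivative (\<lambda>z. \<omega> (\<phi> z) (map (\<lambda>g. g z) ?gs)) (at y) v =
      frechet_derivative (\<lambda>z. \<omega> (\<phi> z) (map (\<lambda>g. g y) ?gs)) (at y) v +
      (\<Sum>j<length ?gs. \<omega> (\<phi> y) ((map (\<lambda>g. g y) ?gs)[j := frechet_derivative (?gs ! j) (at y) v]))"
    proof (rule frechet_derivative_eqI, rule has_derivative_form_fields[OF S])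
      show "(\<lambda>z. \<omega> (\<phi> z) ws) differentiable at y" for ws
        using d differentiable_def by blast
      show "alternating_form (\<omega> (\<phi> z))" if "z \<in> S" for z
        using that T by (auto intro: \<omega>)
      show "g differentiable at y" if "g \<in> set ?gs" for g
        using that smooth_on_differentiable[OF smooth_on_frechet_derivative[OF \<phi>] S(2)] by auto
    qed
    moreover have "frechet_derivative (\<lambda>z. \<omega> (\<phi> z) us) (at y) v =
        frechet_derivative (\<lambda>z. \<omega> z us) (at (\<phi> y)) (?L v)" for us
      using frechet_derivative_eqI[OF d] .
    ultimately show ?thesis by (simp add: o_def)
  qed
  then have "ext_deriv_eucl (\<lambda>z ws. \<omega> (\<phi> z) (map (frechet_derivative \<phi> (at z)) ws)) y vs =
     (\<Sum>i<length vs. (- 1) ^ i * frechet_derivative (\<lambda>z. \<omega> z (map ?L (nths vs (- {i})))) (at (\<phi> y)) (?L (vs ! i))) +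
     (\<Sum>i<length vs. (- 1) ^ i * (\<Sum>j<length (nths vs (- {i})).
        \<omega> (\<phi> y) ((map ?L (nths vs (- {i})))[j := ?H (vs ! i) (nths vs (- {i}) ! j)])))"
    unfolding ext_deriv_eucl_def by (simp add: distrib_left sum.distrib)
  also have "(\<Sum>i<length vs. (- 1) ^ i * (\<Sum>j<length (nths vs (- {i})).
        \<omega> (\<phi> y) ((map ?L (nths vs (- {i})))[j := ?H (vs ! i) (nths vs (- {i}) ! j)]))) =
     (\<Sum>i<length vs. (- 1) ^ i * (\<Sum>j<length vs - 1.
        \<omega> (\<phi> y) ((map ?L (nths vs (- {i})))[j := ?H (vs ! i) (nths vs (- {i}) ! j)])))"
    by (simp add: length_nths_delete)
  also have "\<dots> = 0"
    by (rule alternating_sum_symmetric_eq_0[OF \<omega>(2)[OF \<phi>y] frechet_derivative_commute[OF S(1) \<phi> S(2)]])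
  finally show ?thesis
    unfolding ext_deriv_eucl_def by (simp add: nths_map)
qed

section \<open>Forms and ideals on a manifold\<close>

lemma alternating_form_compose_linear:
  assumes "alternating_form \<alpha>" "linear L"
  shows "alternating_form (\<lambda>vs. \<alpha> (map L vs))"
  unfolding alternating_form_def
proof (intro conjI allI impI)
  fix vs :: "'b list" and i assume "i < length vs"
  then have "linear (\<lambda>v. \<alpha> ((map L vs)[i := v]))"
    using assms(1) unfolding alternating_form_def by simp
  then show "linear (\<lambda>v. \<alpha> (map L (vs[i := v])))"
    using linear_compose[OF assms(2), of "\<lambda>v. \<alpha> ((map L vs)[i := v])"] by (simp add: o_def map_update)
next
  fix vs :: "'b list" and i j assume ij: "j < length vs" "i < j" "vs ! i = vs ! j"
  then have "j < length (map L vs)" "map L vs ! i = map L vs ! j" by simp_all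
  then show "\<alpha> (map L vs) = 0"
    using assms(1) ij(2) unfolding alternating_form_def by blast
qed

lemma wedge_pt_scalar:
  assumes "\<And>v vs. \<alpha> (v # vs) = 0"
  shows "wedge_pt \<alpha> \<beta> vs = \<alpha> [] * \<beta> vs"
proof (induction vs arbitrary: \<beta>)
  case (Cons v vs)
  have "grade \<alpha> ws = \<alpha> ws" for ws
    by (cases ws) (simp_all add: grade_def assms)
  then have "grade \<alpha> = \<alpha>" by blast
  then show ?case
    using Cons[of "\<lambda>ws. \<beta> (v # ws)"] by (simp add: wedge_pt_Cons assms wedge_pt_zero_left)
qed (simp add: wedge_pt_Nil)

definition grade_form :: "('m, 'e) form \<Rightarrow> ('m, 'e) form" where
  "grade_form \<omega> = (\<lambda>x. grade (\<omega> x))"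

text \<open>A function as a form of degree 0. \<open>form_ideal\<close> demands closure under wedge
  products, and wedging with these forms yields closure under multiplication by smooth
  functions.\<close>

definition form0 :: "'m set \<Rightarrow> ('m \<Rightarrow> real) \<Rightarrow> ('m, 'e) form" where
  "form0 U f = (\<lambda>x vs. if x \<in> U \<and> vs = [] then f x else 0)"

section \<open>Charts and coordinate changes\<close>

locale smooth_mfd =
  fixes M :: "('m, 'e::euclidean_space) manifold"
  assumes mfd: "smooth_manifold M"
begin

lemma chart_open: "c \<in> charts M \<Longrightarrow> open_in M (fst c)"
  using mfd unfolding smooth_manifold_def by blast

lemma chart_homeomorphic:
  "c \<in> charts M \<Longrightarrow> homeomorphic_map (subtopology (mtop M) (fst c)) (top_of_set (snd c ` fst c)) (snd c)"
  using mfd unfolding smooth_manifold_def by blast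

lemma topspace_chart: "c \<in> charts M \<Longrightarrow> topspace (subtopology (mtop M) (fst c)) = fst c"
  using openin_subset[OF chart_open, of c] by (simp add: inf.absorb2)

lemma chart_inj: "c \<in> charts M \<Longrightarrow> inj_on (snd c) (fst c)"
  using homeomorphic_imp_injective_map[OF chart_homeomorphic] topspace_chart by metis

lemma chart_inv_chart: "c \<in> charts M \<Longrightarrow> x \<in> fst c \<Longrightarrow> chart_inv c (snd c x) = x"
  unfolding chart_inv_def using chart_inj by (rule inv_into_f_f)

lemma open_chart_image:
  assumes "c \<in> charts M" "open_in M W"
  shows "open (snd c ` (fst c \<inter> W))"
proof -
  have "openin (subtopology (mtop M) (fst c)) (fst c \<inter> W)"
    using assms(2) openin_subtopology_Int2 by blast
  then have "openin (top_of_set (snd c ` fst c)) (snd c ` (fst c \<inter> W))"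
    using homeomorphic_imp_open_map[OF chart_homeomorphic[OF assms(1)]] unfolding open_map_def by blast
  moreover have "open (snd c ` fst c)"
    using mfd assms(1) unfolding smooth_manifold_def by blast
  ultimately show ?thesis using openin_open_trans by blast
qed

lemma chart_at:
  assumes "x \<in> pts M"
  shows "chart_at M x \<in> charts M" "x \<in> fst (chart_at M x)"
proof -
  have "\<exists>c. c \<in> charts M \<and> x \<in> fst c"
    using mfd assms unfolding smooth_manifold_def by blast
  from someI_ex[OF this] show "chart_at M x \<in> charts M" "x \<in> fst (chart_at M x)"
    unfolding chart_at_def by auto
qed

lemma chart_pts: "c \<in> charts M \<Longrightarrow> x \<in> fst c \<Longrightarrow> x \<in> pts M"
  using openin_subset[OF chart_open] by blast

lemma transition_smooth:
  "c \<in> charts M \<Longrightarrow> c' \<in> charts M \<Longrightarrow>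
    smooth_on (snd c ` (fst c \<inter> fst c')) (snd c' \<circ> chart_inv c)"
  using mfd unfolding smooth_manifold_def by blast

lemma transition_has_derivative:
  assumes "c \<in> charts M" "c' \<in> charts M" "x \<in> fst c" "x \<in> fst c'"
  shows "((snd c' \<circ> chart_inv c) has_derivative coord_change c c' x) (at (snd c x))"
  unfolding coord_change_def
  by (rule smooth_on_has_derivative[OF transition_smooth[OF assms(1,2)]]) (use assms in auto)

lemma linear_coord_change:
  "c \<in> charts M \<Longrightarrow> c' \<in> charts M \<Longrightarrow> x \<in> fst c \<Longrightarrow> x \<in> fst c' \<Longrightarrow> linear (coord_change c c' x)"
  using transition_has_derivative has_derivative_linear by blast

lemma coord_change_self:
  assumes "c \<in> charts M" "x \<in> fst c"
  shows "coord_change c c x = id"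
proof -
  have "coord_change c c x = frechet_derivative id (at (snd c x))"
    unfolding coord_change_def
    by (rule frechet_derivative_cong[OF open_chart_image[OF assms(1) chart_open[OF assms(1)]]])
       (use assms chart_inv_chart[OF assms(1)] in auto)
  then show ?thesis by simp
qed

lemma coord_change_compose:
  assumes c: "c \<in> charts M" "c' \<in> charts M" "c'' \<in> charts M" and x: "x \<in> fst c" "x \<in> fst c'" "x \<in> fst c''"
  shows "coord_change c' c'' x (coord_change c c' x v) = coord_change c c'' x v"
proof -
  have "((snd c'' \<circ> chart_inv c') \<circ> (snd c' \<circ> chart_inv c) has_derivative coord_change c' c'' x \<circ> coord_change c c' x)
     (at (snd c x))"
    using transition_has_derivative[OF c(2,3) x(2,3)] chart_inv_chart[OF c(1) x(1)]
    by (intro diff_chain_at transition_has_derivative c x) simp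
  then have "((snd c'' \<circ> chart_inv c) has_derivative coord_change c' c'' x \<circ> coord_change c c' x) (at (snd c x))"
    by (rule has_derivative_transform_within_open[OF _ open_chart_image[OF c(1) chart_open[OF c(2)]]])
       (use c x chart_inv_chart[OF c(1)] chart_inv_chart[OF c(2)] in auto)
  then show ?thesis
    using transition_has_derivative[OF c(1,3) x(1,3)] has_derivative_unique
    by (metis comp_apply)
qed

lemma chart_rep_eq:
  assumes "c \<in> charts M" "x \<in> fst c"
  shows "chart_rep M c \<omega> (snd c x) vs = \<omega> x (map (coord_change c (chart_at M x) x) vs)"
  unfolding chart_rep_def Let_def chart_inv_chart[OF assms] ..

lemma chart_rep_chart_at:
  assumes "x \<in> pts M"
  shows "chart_rep M (chart_at M x) \<omega> (snd (chart_at M x) x) = \<omega> x"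
  using chart_rep_eq[OF chart_at[OF assms]] coord_change_self[OF chart_at[OF assms]] by auto

lemma chart_rep_change:
  assumes "c \<in> charts M" "c' \<in> charts M" "x \<in> fst c" "x \<in> fst c'"
  shows "chart_rep M c \<omega> (snd c x) vs = chart_rep M c' \<omega> (snd c' x) (map (coord_change c c' x) vs)"
proof -
  have "x \<in> pts M" using assms chart_pts by blast
  then show ?thesis
    using assms by (simp add: chart_rep_eq o_def coord_change_compose chart_at)
qed

lemma chart_rep_wedge:
  "chart_rep M c (\<alpha> \<and>\<^sub>f \<beta>) y vs = wedge_pt (chart_rep M c \<alpha> y) (chart_rep M c \<beta> y) vs"
  by (simp add: chart_rep_def wedge_def Let_def wedge_pt_def nths_map)

lemma chart_rep_add: "chart_rep M c (\<alpha> + \<beta>) y vs = chart_rep M c \<alpha> y vs + chart_rep M c \<beta> y vs"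
  by (simp add: chart_rep_def Let_def)

lemma chart_rep_grade: "chart_rep M c (grade_form \<alpha>) y vs = grade (chart_rep M c \<alpha> y) vs"
  by (simp add: chart_rep_def Let_def grade_form_def grade_def)

lemma alternating_chart_rep:
  assumes "\<omega> \<in> forms M U" "c \<in> charts M" "y \<in> snd c ` (fst c \<inter> U)"
  shows "alternating_form (chart_rep M c \<omega> y)"
proof -
  obtain x where x: "y = snd c x" "x \<in> fst c" "x \<in> U" using assms(3) by auto
  have "alternating_form (\<lambda>vs. \<omega> x (map (coord_change c (chart_at M x) x) vs))"
    using assms x unfolding forms_def
    by (intro alternating_form_compose_linear linear_coord_change chart_at chart_pts) auto
  then show ?thesis
    using chart_rep_eq[OF assms(2) x(2)] x(1) by presburger
qed

lemma smooth_chart_rep: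
  "\<omega> \<in> forms M U \<Longrightarrow> c \<in> charts M \<Longrightarrow> smooth_on (snd c ` (fst c \<inter> U)) (\<lambda>y. chart_rep M c \<omega> y vs)"
  unfolding forms_def by blast

lemma forms_alternating: "\<omega> \<in> forms M U \<Longrightarrow> x \<in> U \<Longrightarrow> alternating_form (\<omega> x)"
  unfolding forms_def by blast

lemma forms_outside: "\<omega> \<in> forms M U \<Longrightarrow> x \<notin> U \<Longrightarrow> \<omega> x vs = 0"
  unfolding forms_def by simp

lemma formsI:
  assumes "\<And>x vs. x \<notin> U \<Longrightarrow> \<omega> x vs = 0" "\<And>x. x \<in> U \<Longrightarrow> alternating_form (\<omega> x)"
    "\<And>c vs. c \<in> charts M \<Longrightarrow> smooth_on (snd c ` (fst c \<inter> U)) (\<lambda>y. chart_rep M c \<omega> y vs)"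
  shows "\<omega> \<in> forms M U"
  unfolding forms_def using assms by (auto simp: fun_eq_iff)

section \<open>The algebra of smooth forms on an open set\<close>

lemma forms_zero: "open_in M U \<Longrightarrow> 0 \<in> forms M U"
  by (rule formsI)
     (auto simp: chart_rep_def zero_fun_def alternating_form_zero smooth_on_const Let_def)

lemma forms_add:
  assumes "open_in M U" "\<alpha> \<in> forms M U" "\<beta> \<in> forms M U"
  shows "\<alpha> + \<beta> \<in> forms M U"
proof (rule formsI)
  show "alternating_form ((\<alpha> + \<beta>) x)" if "x \<in> U" for x
    using alternating_form_add[OF forms_alternating[OF assms(2) that] forms_alternating[OF assms(3) that]]
    by (simp add: plus_fun_def)
qed (auto simp: forms_outside[OF assms(2)] forms_outside[OF assms(3)] chart_rep_add
    intro!: smooth_on_add open_chart_image assms smooth_chart_rep)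

lemma forms_wedge:
  assumes "open_in M U" "\<alpha> \<in> forms M U" "\<beta> \<in> forms M U"
  shows "\<alpha> \<and>\<^sub>f \<beta> \<in> forms M U"
proof (rule formsI)
  show "alternating_form ((\<alpha> \<and>\<^sub>f \<beta>) x)" if "x \<in> U" for x
    using that assms by (simp add: wedge_def alternating_form_wedge_pt forms_alternating)
  show "smooth_on (snd c ` (fst c \<inter> U)) (\<lambda>y. chart_rep M c (\<alpha> \<and>\<^sub>f \<beta>) y vs)" if "c \<in> charts M" for c vs
    unfolding chart_rep_wedge wedge_pt_def
    by (intro smooth_on_sum smooth_on_mult smooth_on_const smooth_chart_rep[OF assms(2)]
        smooth_chart_rep[OF assms(3)] open_chart_image that assms)
qed (simp add: wedge_def wedge_pt_def forms_outside[OF assms(2)])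

lemma forms_grade:
  assumes "open_in M U" "\<alpha> \<in> forms M U"
  shows "grade_form \<alpha> \<in> forms M U"
proof (rule formsI)
  show "alternating_form (grade_form \<alpha> x)" if "x \<in> U" for x
    using that assms by (simp add: grade_form_def alternating_form_grade forms_alternating)
  show "smooth_on (snd c ` (fst c \<inter> U)) (\<lambda>y. chart_rep M c (grade_form \<alpha>) y vs)" if "c \<in> charts M" for c vs
    unfolding chart_rep_grade grade_def
    by (intro smooth_on_mult smooth_on_const smooth_chart_rep[OF assms(2)] open_chart_image that assms)
qed (simp add: grade_form_def grade_def forms_outside[OF assms(2)])

section \<open>The exterior derivative on the manifold\<close>

lemma ext_deriv_chart_at:
  "x \<in> U \<Longrightarrow> ext_deriv M U \<omega> x vs =
     ext_deriv_eucl (chart_rep M (chart_at M x) \<omega>) (snd (chart_at M x) x) vs"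
  by (simp add: ext_deriv_def Let_def)

text \<open>The selected chart may jump from point to point, so the definition of
  \<open>ext_deriv\<close> says nothing about how its values vary. Naturality under the transition
  map identifies it, throughout any chart of the atlas, with the derivative in coordinates.
  Smoothness of d \<omega> and d d \<omega> = 0 depend on this.\<close>

lemma chart_rep_ext_deriv:
  assumes U: "open_in M U" and \<omega>: "\<omega> \<in> forms M U" and c: "c \<in> charts M" and y: "y \<in> snd c ` (fst c \<inter> U)"
  shows "chart_rep M c (ext_deriv M U \<omega>) y vs = ext_deriv_eucl (chart_rep M c \<omega>) y vs"
proof -
  obtain x where x: "y = snd c x" "x \<in> fst c" "x \<in> U" using y by auto
  define c0 where "c0 = chart_at M x"
  have c0: "c0 \<in> charts M" "x \<in> fst c0"
    using chart_at[OF chart_pts[OF c x(2)]] by (auto simp: c0_def)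
  define \<phi> where "\<phi> = snd c0 \<circ> chart_inv c"
  define S where "S = snd c ` (fst c \<inter> (fst c0 \<inter> U))"
  define T where "T = snd c0 ` (fst c0 \<inter> U)"
  have S: "open S" "y \<in> S"
    unfolding S_def using c0 x openin_Int[OF chart_open[OF c0(1)] U] by (auto intro!: open_chart_image[OF c])
  have T: "open T" "\<phi> ` S \<subseteq> T"
    unfolding T_def using open_chart_image[OF c0(1) U] chart_inv_chart[OF c] by (auto simp: S_def \<phi>_def)
  have \<phi>: "smooth_on S \<phi>"
    unfolding \<phi>_def S_def by (rule smooth_on_subset[OF transition_smooth[OF c c0(1)]]) auto
  have "ext_deriv_eucl (chart_rep M c \<omega>) y vs =
    ext_deriv_eucl (\<lambda>z ws. chart_rep M c0 \<omega> (\<phi> z) (map (frechet_derivative \<phi> (at z)) ws)) y vs"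
  proof (rule ext_deriv_eucl_cong[OF S])
    fix z ws assume "z \<in> S"
    then obtain x' where "z = snd c x'" "x' \<in> fst c" "x' \<in> fst c0" by (auto simp: S_def)
    then show "chart_rep M c \<omega> z ws = chart_rep M c0 \<omega> (\<phi> z) (map (frechet_derivative \<phi> (at z)) ws)"
      using chart_rep_change[OF c c0(1), of x' \<omega> ws] chart_inv_chart[OF c]
      by (simp add: \<phi>_def coord_change_def)
  qed
  also have "\<dots> = ext_deriv_eucl (chart_rep M c0 \<omega>) (\<phi> y) (map (frechet_derivative \<phi> (at y)) vs)"
    by (rule ext_deriv_eucl_pullback[OF S T \<phi>])
       (use \<omega> c0 in \<open>auto simp: T_def intro: smooth_chart_rep alternating_chart_rep\<close>)
  also have "\<dots> = chart_rep M c (ext_deriv M U \<omega>) y vs"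
    unfolding x(1) chart_rep_eq[OF c x(2)] ext_deriv_chart_at[OF x(3)]
    by (simp add: \<phi>_def c0_def coord_change_def chart_inv_chart[OF c x(2)])
  finally show ?thesis by simp
qed

lemma chart_rep_differentiable:
  "open_in M U \<Longrightarrow> \<omega> \<in> forms M U \<Longrightarrow> c \<in> charts M \<Longrightarrow> y \<in> snd c ` (fst c \<inter> U) \<Longrightarrow>
    (\<lambda>y. chart_rep M c \<omega> y vs) differentiable (at y)"
  using smooth_on_differentiable[OF smooth_chart_rep] by blast

lemma open_in_pts: "open_in M U \<Longrightarrow> x \<in> U \<Longrightarrow> x \<in> pts M"
  using openin_subset by blast

lemma chart_at_image:
  "open_in M U \<Longrightarrow> x \<in> U \<Longrightarrow> snd (chart_at M x) x \<in> snd (chart_at M x) ` (fst (chart_at M x) \<inter> U)"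
  using chart_at open_in_pts by blast

lemma forms_ext_deriv:
  assumes U: "open_in M U" and \<omega>: "\<omega> \<in> forms M U"
  shows "ext_deriv M U \<omega> \<in> forms M U"
proof (rule formsI)
  show "ext_deriv M U \<omega> x vs = 0" if "x \<notin> U" for x vs
    using that by (simp add: ext_deriv_def)
  show "alternating_form (ext_deriv M U \<omega> x)" if x: "x \<in> U" for x
  proof -
    note c = chart_at[OF open_in_pts[OF U x]]
    have "alternating_form (ext_deriv_eucl (chart_rep M (chart_at M x) \<omega>) (snd (chart_at M x) x))"
      by (rule alternating_form_ext_deriv_eucl[OF open_chart_image[OF c(1) U] chart_at_image[OF U x]])
         (use chart_rep_differentiable[OF U \<omega> c(1) chart_at_image[OF U x]] alternating_chart_rep[OF \<omega> c(1)] in auto)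
    then show ?thesis
      using ext_deriv_chart_at[OF x, abs_def] by presburger
  qed
  show "smooth_on (snd c ` (fst c \<inter> U)) (\<lambda>y. chart_rep M c (ext_deriv M U \<omega>) y vs)" if c: "c \<in> charts M" for c vs
    by (rule smooth_on_cong[OF open_chart_image[OF c U] chart_rep_ext_deriv[OF U \<omega> c, symmetric]])
       (auto intro!: smooth_on_ext_deriv_eucl open_chart_image[OF c U] smooth_chart_rep \<omega> c)
qed

lemma ext_deriv_zero: "ext_deriv M U 0 = 0"
  by (simp add: ext_deriv_def fun_eq_iff chart_rep_def Let_def ext_deriv_eucl_def)

lemma ext_deriv_add:
  assumes U: "open_in M U" and "\<alpha> \<in> forms M U" "\<beta> \<in> forms M U"
  shows "ext_deriv M U (\<alpha> + \<beta>) = ext_deriv M U \<alpha> + ext_deriv M U \<beta>"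
proof (intro ext)
  fix x vs
  show "ext_deriv M U (\<alpha> + \<beta>) x vs = (ext_deriv M U \<alpha> + ext_deriv M U \<beta>) x vs"
  proof (cases "x \<in> U")
    case True
    note d = chart_rep_differentiable[OF U _ chart_at(1)[OF open_in_pts[OF U True]] chart_at_image[OF U True]]
    show ?thesis
      using ext_deriv_eucl_add[OF d[OF assms(2)] d[OF assms(3)], where vs = vs]
      by (simp add: ext_deriv_chart_at[OF True] chart_rep_add[abs_def])
  qed (simp add: ext_deriv_def)
qed

lemma ext_deriv_wedge:
  assumes U: "open_in M U" and "\<alpha> \<in> forms M U" "\<beta> \<in> forms M U"
  shows "ext_deriv M U (\<alpha> \<and>\<^sub>f \<beta>) = ext_deriv M U \<alpha> \<and>\<^sub>f \<beta> + grade_form \<alpha> \<and>\<^sub>f ext_deriv M U \<beta>"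
proof (intro ext)
  fix x vs
  show "ext_deriv M U (\<alpha> \<and>\<^sub>f \<beta>) x vs = (ext_deriv M U \<alpha> \<and>\<^sub>f \<beta> + grade_form \<alpha> \<and>\<^sub>f ext_deriv M U \<beta>) x vs"
  proof (cases "x \<in> U")
    case True
    note p = open_in_pts[OF U True]
    note d = chart_rep_differentiable[OF U _ chart_at(1)[OF p] chart_at_image[OF U True]]
    have "ext_deriv_eucl (\<lambda>z. wedge_pt (chart_rep M (chart_at M x) \<alpha> z) (chart_rep M (chart_at M x) \<beta> z))
        (snd (chart_at M x) x) vs = (ext_deriv M U \<alpha> \<and>\<^sub>f \<beta> + grade_form \<alpha> \<and>\<^sub>f ext_deriv M U \<beta>) x vs"
      using ext_deriv_eucl_wedge_pt[OF d[OF assms(2)] d[OF assms(3)], where vs = vs]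
      unfolding plus_fun_def wedge_def grade_form_def ext_deriv_chart_at[OF True, abs_def] chart_rep_chart_at[OF p] .
    then show ?thesis
      by (simp add: ext_deriv_chart_at[OF True] chart_rep_wedge[abs_def])
  qed (simp add: ext_deriv_def wedge_def wedge_pt_def grade_form_def grade_def
         forms_outside[OF assms(2)] forms_outside[OF assms(3)])
qed

lemma ext_deriv_ext_deriv:
  assumes U: "open_in M U" and \<omega>: "\<omega> \<in> forms M U"
  shows "ext_deriv M U (ext_deriv M U \<omega>) = 0"
proof (intro ext)
  fix x vs
  show "ext_deriv M U (ext_deriv M U \<omega>) x vs = 0 x vs"
  proof (cases "x \<in> U")
    case True
    note c = chart_at[OF open_in_pts[OF U True]]
    have "ext_deriv M U (ext_deriv M U \<omega>) x vs =
       ext_deriv_eucl (ext_deriv_eucl (chart_rep M (chart_at M x) \<omega>)) (snd (chart_at M x) x) vs"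
      unfolding ext_deriv_chart_at[OF True]
      by (rule ext_deriv_eucl_cong[OF open_chart_image[OF c(1) U] chart_at_image[OF U True]])
         (rule chart_rep_ext_deriv[OF U \<omega> c(1)])
    also have "\<dots> = 0"
      by (rule ext_deriv_eucl_ext_deriv_eucl[OF open_chart_image[OF c(1) U] chart_at_image[OF U True]])
         (rule smooth_chart_rep[OF \<omega> c(1)])
    finally show ?thesis by simp
  qed (simp add: ext_deriv_def)
qed

text \<open>The derivative at \<open>x\<close> sees only a neighbourhood of \<open>x\<close>.
  Openness is asked of \<open>V\<close> alone, so \<open>U\<close> may be taken to be
  \<open>UNIV\<close>.\<close>

lemma ext_deriv_local:
  assumes V: "open_in M V" "V \<subseteq> U" and x: "x \<in> V" and eq: "\<And>z vs. z \<in> V \<Longrightarrow> \<omega>' z vs = \<omega> z vs"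
  shows "ext_deriv M V \<omega>' x vs = ext_deriv M U \<omega> x vs"
proof -
  note c = chart_at[OF open_in_pts[OF V(1) x]]
  have "x \<in> U" using V x by auto
  then show ?thesis
    unfolding ext_deriv_chart_at[OF x] ext_deriv_chart_at[OF \<open>x \<in> U\<close>]
    by (intro ext_deriv_eucl_cong[OF open_chart_image[OF c(1) V(1)] chart_at_image[OF V(1) x]])
       (use chart_rep_eq[OF c(1)] eq in auto)
qed

lemma homogeneous_ext_deriv:
  assumes "homogeneous k \<omega>"
  shows "homogeneous (Suc k) (ext_deriv M U \<omega>)"
  unfolding homogeneous_def
proof (intro allI impI)
  fix x and vs :: "'e list" assume "length vs \<noteq> Suc k"
  then have "length (nths vs (- {i})) \<noteq> k" if "i < length vs" for i
    using length_nths_delete[OF that] that by auto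
  then have "frechet_derivative (\<lambda>z. chart_rep M c \<omega> z (nths vs (- {i}))) (at y) w = 0" if "i < length vs" for i c y w
    using assms that unfolding homogeneous_def chart_rep_def Let_def by simp
  then show "ext_deriv M U \<omega> x vs = 0"
    unfolding ext_deriv_def ext_deriv_eucl_def Let_def by auto
qed

section \<open>Smooth functions and their non-vanishing sets\<close>

lemma smooth_fun_const: "smooth_fun M U (\<lambda>x. a)"
  by (simp add: smooth_fun_def o_def smooth_on_const)

lemma smooth_fun_mult:
  "open_in M U \<Longrightarrow> smooth_fun M U f \<Longrightarrow> smooth_fun M U g \<Longrightarrow> smooth_fun M U (\<lambda>x. f x * g x)"
  by (auto simp: smooth_fun_def o_def intro!: smooth_on_mult open_chart_image)

lemma smooth_fun_divide:
  assumes "open_in M U" "smooth_fun M U f" "smooth_fun M U g" "\<And>x. x \<in> U \<Longrightarrow> g x \<noteq> 0"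
  shows "smooth_fun M U (\<lambda>x. f x / g x)"
  unfolding smooth_fun_def o_def
proof
  fix c assume c: "c \<in> charts M"
  show "smooth_on (snd c ` (fst c \<inter> U)) (\<lambda>y. f (chart_inv c y) / g (chart_inv c y))"
    using assms c chart_inv_chart[OF c]
    by (intro smooth_on_divide open_chart_image) (auto simp: smooth_fun_def o_def)
qed

lemma smooth_fun_sum:
  "open_in M U \<Longrightarrow> (\<And>i. i \<in> A \<Longrightarrow> smooth_fun M U (f i)) \<Longrightarrow> smooth_fun M U (\<lambda>x. \<Sum>i\<in>A. f i x)"
  by (auto simp: smooth_fun_def o_def intro!: smooth_on_sum open_chart_image)

lemma smooth_fun_det:
  fixes A :: "'m \<Rightarrow> real^'n^'n"
  shows "open_in M U \<Longrightarrow> (\<And>i j. smooth_fun M U (\<lambda>x. A x $ i $ j)) \<Longrightarrow> smooth_fun M U (\<lambda>x. det (A x))"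
  by (auto simp: smooth_fun_def o_def intro!: smooth_on_det open_chart_image)

lemma smooth_fun_subset: "smooth_fun M U f \<Longrightarrow> V \<subseteq> U \<Longrightarrow> smooth_fun M V f"
  unfolding smooth_fun_def by (meson Int_mono image_mono order_refl smooth_on_subset)

lemma smooth_fun_cong:
  assumes "open_in M U" "smooth_fun M U f" "\<And>x. x \<in> U \<Longrightarrow> f x = g x"
  shows "smooth_fun M U g"
  unfolding smooth_fun_def
proof
  fix c assume c: "c \<in> charts M"
  show "smooth_on (snd c ` (fst c \<inter> U)) (g \<circ> chart_inv c)"
    by (rule smooth_on_cong[OF open_chart_image[OF c assms(1)], of "f \<circ> chart_inv c"])
       (use assms c chart_inv_chart[OF c] in \<open>auto simp: smooth_fun_def\<close>)
qed

text \<open>Continuity is available in coordinates; the open set found there is carried back by the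
  chart homeomorphism. This permits shrinking a domain to the points where a determinant is
  non-zero.\<close>

lemma open_in_nonzero:
  assumes U: "open_in M U" and f: "smooth_fun M U f"
  shows "open_in M {x\<in>U. f x \<noteq> 0}"
proof (subst openin_subopen, intro ballI)
  fix x assume "x \<in> {x\<in>U. f x \<noteq> 0}"
  then have x: "x \<in> U" "f x \<noteq> 0" by auto
  note c = chart_at[OF open_in_pts[OF U x(1)]]
  let ?c = "chart_at M x"
  let ?W = "snd ?c ` (fst ?c \<inter> U) \<inter> (f \<circ> chart_inv ?c) -` (- {0})"
  have "continuous_on (snd ?c ` (fst ?c \<inter> U)) (f \<circ> chart_inv ?c)"
    using f c(1) unfolding smooth_fun_def by (blast intro: smooth_on_continuous_on)
  then have "open ?W"
    by (rule continuous_open_preimage[OF _ open_chart_image[OF c(1) U]]) auto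
  then have "openin (top_of_set (snd ?c ` fst ?c)) ?W"
    by (intro open_subset) auto
  then have "openin (subtopology (mtop M) (fst ?c)) {x \<in> topspace (subtopology (mtop M) (fst ?c)). snd ?c x \<in> ?W}"
    using homeomorphic_imp_continuous_map[OF chart_homeomorphic[OF c(1)]] unfolding continuous_map_def by blast
  then have "open_in M {x \<in> fst ?c. snd ?c x \<in> ?W}"
    using openin_trans_full[OF _ chart_open[OF c(1)]] unfolding topspace_chart[OF c(1)] by blast
  moreover have "{x \<in> fst ?c. snd ?c x \<in> ?W} \<subseteq> {x\<in>U. f x \<noteq> 0}"
    using chart_inv_chart[OF c(1)] inj_onD[OF chart_inj[OF c(1)]] by auto blast
  moreover have "x \<in> {x \<in> fst ?c. snd ?c x \<in> ?W}"
    using c(2) x chart_inv_chart[OF c] by auto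
  ultimately show "\<exists>T. open_in M T \<and> x \<in> T \<and> T \<subseteq> {x \<in> U. f x \<noteq> 0}" by blast
qed

section \<open>Ideals of forms\<close>

lemma form0_forms:
  assumes U: "open_in M U" and f: "smooth_fun M U f"
  shows "form0 U f \<in> forms M U"
proof (rule formsI)
  show "alternating_form (form0 U f x)" for x
    by (rule alternating_formI) (auto simp: form0_def linear_zero alternating_form_zero)
  show "smooth_on (snd c ` (fst c \<inter> U)) (\<lambda>y. chart_rep M c (form0 U f) y vs)" if c: "c \<in> charts M" for c vs
  proof (rule smooth_on_cong[OF open_chart_image[OF c U]])
    show "smooth_on (snd c ` (fst c \<inter> U)) (\<lambda>y. if vs = [] then (f \<circ> chart_inv c) y else 0)"
      using f c by (cases "vs = []") (simp_all add: smooth_fun_def smooth_on_const o_def)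
  qed (use chart_inv_chart[OF c] in \<open>auto simp: chart_rep_def form0_def Let_def\<close>)
qed (simp add: form0_def)

lemma form0_wedge:
  assumes "\<omega> \<in> forms M U"
  shows "form0 U f \<and>\<^sub>f \<omega> = f *\<^sub>f \<omega>"
  by (auto simp: fun_eq_iff wedge_def scale_form_def wedge_pt_scalar form0_def forms_outside[OF assms])

lemma form_ideal_forms: "open_in M U \<Longrightarrow> form_ideal M U (forms M U)"
  unfolding form_ideal_def using forms_zero forms_add forms_wedge by blast

text \<open>The hull is an intersection of ideals. The family is not empty because
  \<open>forms M U\<close> belongs to it, and this also keeps the hull among the smooth
  forms.\<close>

lemma form_ideal_hull:
  assumes "open_in M U" "G \<subseteq> forms M U"
  shows "form_ideal M U (form_ideal M U hull G)"
proof -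
  let ?H = "form_ideal M U hull G"
  have I: "\<omega> \<in> ?H" if "\<And>t. form_ideal M U t \<Longrightarrow> G \<subseteq> t \<Longrightarrow> \<omega> \<in> t" for \<omega>
    unfolding hull_def using that by blast
  have D: "\<omega> \<in> t" if "\<omega> \<in> ?H" "form_ideal M U t" "G \<subseteq> t" for \<omega> t
    using hull_minimal[OF that(3), of "form_ideal M U"] that by blast
  have ops: "0 \<in> t" "\<omega> \<in> t \<Longrightarrow> \<psi> \<in> t \<Longrightarrow> \<omega> + \<psi> \<in> t" "\<alpha> \<in> forms M U \<Longrightarrow> \<omega> \<in> t \<Longrightarrow> \<alpha> \<and>\<^sub>f \<omega> \<in> t"
    "\<alpha> \<in> forms M U \<Longrightarrow> \<omega> \<in> t \<Longrightarrow> \<omega> \<and>\<^sub>f \<alpha> \<in> t" if "form_ideal M U t" for t \<omega> \<psi> \<alpha>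
    using that unfolding form_ideal_def by blast+
  show ?thesis
    unfolding form_ideal_def[of M U ?H]
  proof (intro conjI ballI)
    show "?H \<subseteq> forms M U"
      by (rule hull_minimal[OF assms(2)]) (rule form_ideal_forms[OF assms(1)])
    show "0 \<in> ?H" by (rule I) (rule ops)
  next
    fix \<omega> \<psi> assume "\<omega> \<in> ?H" "\<psi> \<in> ?H"
    then show "\<omega> + \<psi> \<in> ?H" by (intro I) (auto intro: ops D)
  next
    fix \<alpha> \<omega> assume "\<alpha> \<in> forms M U" "\<omega> \<in> ?H"
    then show "\<alpha> \<and>\<^sub>f \<omega> \<in> ?H" "\<omega> \<and>\<^sub>f \<alpha> \<in> ?H" by (intro I; auto intro: ops D)+
  qed
qed

lemma form_ideal_scale:
  assumes "open_in M U" "form_ideal M U J" "smooth_fun M U f" "\<omega> \<in> J"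
  shows "f *\<^sub>f \<omega> \<in> J"
proof -
  have "form0 U f \<and>\<^sub>f \<omega> \<in> J"
    using assms form0_forms unfolding form_ideal_def by blast
  moreover have "\<omega> \<in> forms M U" using assms unfolding form_ideal_def by blast
  ultimately show ?thesis by (simp add: form0_wedge)
qed

lemma form_ideal_uminus:
  assumes "open_in M U" "form_ideal M U J" "\<omega> \<in> J"
  shows "- \<omega> \<in> J"
proof -
  have "- \<omega> = (\<lambda>x. - 1) *\<^sub>f \<omega>" by (simp add: scale_form_def fun_eq_iff)
  then show ?thesis using form_ideal_scale[OF assms(1,2) smooth_fun_const assms(3)] by metis
qed

lemma form_ideal_add: "form_ideal M U J \<Longrightarrow> \<omega> \<in> J \<Longrightarrow> \<psi> \<in> J \<Longrightarrow> \<omega> + \<psi> \<in> J"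
  unfolding form_ideal_def by blast

lemma form_ideal_diff:
  assumes "open_in M U" "form_ideal M U J" "\<omega> \<in> J" "\<psi> \<in> J"
  shows "\<omega> - \<psi> \<in> J"
  using form_ideal_add[OF assms(2,3) form_ideal_uminus[OF assms(1,2,4)]] by simp

lemma form_ideal_sum:
  "form_ideal M U J \<Longrightarrow> (\<And>i. i \<in> A \<Longrightarrow> \<omega> i \<in> J) \<Longrightarrow> (\<Sum>i\<in>A. \<omega> i) \<in> J"
  by (induction A rule: infinite_finite_induct) (auto simp: form_ideal_def)

lemma grade_form_homogeneous:
  assumes "homogeneous k \<omega>"
  shows "grade_form \<omega> = (if even k then \<omega> else - \<omega>)"
proof (intro ext)
  fix x vs
  show "grade_form \<omega> x vs = (if even k then \<omega> else - \<omega>) x vs"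
    using assms unfolding homogeneous_def
    by (cases "length vs = k") (auto simp: grade_form_def grade_def)
qed

lemma grade_form_zero: "grade_form 0 = 0"
  by (simp add: fun_eq_iff grade_form_def grade_def)

lemma grade_form_wedge: "grade_form (\<alpha> \<and>\<^sub>f \<beta>) = grade_form \<alpha> \<and>\<^sub>f grade_form \<beta>"
  by (simp add: fun_eq_iff grade_form_def wedge_def wedge_pt_grade)

lemma grade_form_add: "grade_form (\<alpha> + \<beta>) = grade_form \<alpha> + grade_form \<beta>"
  by (simp add: fun_eq_iff grade_form_def grade_def algebra_simps)

text \<open>By the Leibniz rule it suffices to check closedness under \<open>d\<close> on homogeneous generators.\<close>

lemma differential_ideal_hull:
  assumes U: "open_in M U" and G: "G \<subseteq> forms M U" "\<And>g. g \<in> G \<Longrightarrow> \<exists>k. homogeneous k g"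
    and d: "\<And>g. g \<in> G \<Longrightarrow> ext_deriv M U g \<in> form_ideal M U hull G"
  shows "differential_ideal M U (form_ideal M U hull G)"
proof -
  define J where "J = form_ideal M U hull G"
  have J: "form_ideal M U J" unfolding J_def by (rule form_ideal_hull[OF U G(1)])
  have GJ: "G \<subseteq> J" unfolding J_def by (rule hull_subset)
  have JF: "J \<subseteq> forms M U" using J unfolding form_ideal_def by blast
  have Jw: "\<alpha> \<and>\<^sub>f \<omega> \<in> J" "\<omega> \<and>\<^sub>f \<alpha> \<in> J" if "\<alpha> \<in> forms M U" "\<omega> \<in> J" for \<alpha> \<omega>
    using J that unfolding form_ideal_def by blast+
  have Jmin: "J \<subseteq> t" if "form_ideal M U t" "G \<subseteq> t" for t
    unfolding J_def by (rule hull_minimal[OF that(2)]) (rule that(1))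
  \<comment> \<open>The Leibniz rule for \<omega> \<and> \<alpha> contains \<open>grade_form\<close>
    of \<omega>, so \<open>J\<close> must be stable under the degree involution. The elements whose
    image stays in \<open>J\<close> form an ideal, and a homogeneous generator changes at most by a
    sign.\<close>
  have "form_ideal M U {\<omega> \<in> J. grade_form \<omega> \<in> J}"
    unfolding form_ideal_def
    using JF form_ideal_add[OF J] Jw forms_grade[OF U] J[unfolded form_ideal_def]
    by (simp add: grade_form_wedge grade_form_add grade_form_zero subset_iff)
  moreover have "grade_form g \<in> J" if g: "g \<in> G" for g
  proof -
    obtain k where "homogeneous k g" using G(2)[OF g] by blast
    moreover have "g \<in> J" using GJ g by blast
    ultimately show ?thesis
      using form_ideal_uminus[OF U J] by (simp add: grade_form_homogeneous)
  qed
  ultimately have "J \<subseteq> {\<omega> \<in> J. grade_form \<omega> \<in> J}"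
    using GJ by (intro Jmin) auto
  then have gr: "grade_form \<omega> \<in> J" if "\<omega> \<in> J" for \<omega> using that by blast
  \<comment> \<open>The same device for d: the elements of \<open>J\<close> whose derivative lies in
    \<open>J\<close> form an ideal, so by minimality it suffices that it contains
    \<open>G\<close>.\<close>
  have "form_ideal M U {\<omega> \<in> J. ext_deriv M U \<omega> \<in> J}"
    unfolding form_ideal_def
  proof (intro conjI ballI CollectI subsetI)
    show "0 \<in> J" "ext_deriv M U 0 \<in> J"
      using J unfolding ext_deriv_zero form_ideal_def by blast+
    fix \<omega> assume \<omega>: "\<omega> \<in> {\<omega> \<in> J. ext_deriv M U \<omega> \<in> J}"
    then show "\<omega> \<in> forms M U" using JF by blast
    fix \<psi> assume \<psi>: "\<psi> \<in> {\<omega> \<in> J. ext_deriv M U \<omega> \<in> J}"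
    show "\<omega> + \<psi> \<in> J" using \<omega> \<psi> form_ideal_add[OF J] by blast
    have "\<omega> \<in> forms M U" "\<psi> \<in> forms M U" using \<omega> \<psi> JF by auto
    then show "ext_deriv M U (\<omega> + \<psi>) \<in> J"
      using \<omega> \<psi> form_ideal_add[OF J] by (simp add: ext_deriv_add[OF U])
  next
    fix \<alpha> \<omega> assume \<alpha>: "\<alpha> \<in> forms M U" and "\<omega> \<in> {\<omega> \<in> J. ext_deriv M U \<omega> \<in> J}"
    then have \<omega>: "\<omega> \<in> J" "ext_deriv M U \<omega> \<in> J" "\<omega> \<in> forms M U" using JF by auto
    show "\<alpha> \<and>\<^sub>f \<omega> \<in> J" "\<omega> \<and>\<^sub>f \<alpha> \<in> J" by (intro Jw \<alpha> \<omega>)+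
    show "ext_deriv M U (\<alpha> \<and>\<^sub>f \<omega>) \<in> J" "ext_deriv M U (\<omega> \<and>\<^sub>f \<alpha>) \<in> J"
      unfolding ext_deriv_wedge[OF U \<alpha> \<omega>(3)] ext_deriv_wedge[OF U \<omega>(3) \<alpha>]
      by (intro form_ideal_add[OF J] Jw \<alpha> \<omega> gr forms_ext_deriv[OF U] forms_grade[OF U])+
  qed
  moreover have "G \<subseteq> {\<omega> \<in> J. ext_deriv M U \<omega> \<in> J}"
    using GJ d unfolding J_def by blast
  ultimately have "J \<subseteq> {\<omega> \<in> J. ext_deriv M U \<omega> \<in> J}"
    by (intro Jmin)
  then show ?thesis
    using J unfolding differential_ideal_def J_def by blast
qed

end

section \<open>Coframes, dual frames and structure equations\<close>

lemma sum_UNIV_sum: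
  fixes g :: "'a::finite + 'b::finite \<Rightarrow> 'c::comm_monoid_add"
  shows "(\<Sum>k\<in>UNIV. g k) = (\<Sum>a\<in>UNIV. g (Inl a)) + (\<Sum>b\<in>UNIV. g (Inr b))"
  by (subst UNIV_Plus_UNIV[symmetric], subst sum.Plus) (simp_all add: o_def)

lemma sum_fun_apply: "(\<Sum>i\<in>A. f i) x = (\<Sum>i\<in>A. f i x)" for f :: "'i \<Rightarrow> 'a \<Rightarrow> 'b::comm_monoid_add"
  by (induction A rule: infinite_finite_induct) auto

text \<open>The inner product with \<open>v\<close> itself is among the functionals spanned, and it
  takes the value |v|^2 at \<open>v\<close>.\<close>

lemma basis_functionals_injective:
  fixes h :: "'k::finite \<Rightarrow> 'e::euclidean_space \<Rightarrow>\<^sub>L real"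
  assumes "span (range h) = UNIV" "\<And>k. h k v = 0"
  shows "v = 0"
proof -
  have "subspace {f. blinfun_apply f v = 0}"
    by (auto simp: subspace_def plus_blinfun.rep_eq scaleR_blinfun.rep_eq)
  then have "span (range h) \<subseteq> {f. blinfun_apply f v = 0}"
    using assms(2) by (intro span_minimal) auto
  then have "blinfun_apply (blinfun_inner_left v) v = 0"
    using assms(1) by blast
  then show ?thesis by simp
qed

text \<open>Two bounds: the inner products with \<open>Basis\<close> span the dual space, and
  evaluating all functionals embeds the space into the coordinate space indexed by
  \<open>'k\<close>.\<close>

lemma basis_functionals_card:
  fixes h :: "'k::finite \<Rightarrow> 'e::euclidean_space \<Rightarrow>\<^sub>L real"
  assumes "inj h" "independent (range h)" "span (range h) = UNIV"
  shows "CARD('k) = DIM('e)"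
proof (rule antisym)
  have "f \<in> span (blinfun_inner_left ` Basis)" for f :: "'e \<Rightarrow>\<^sub>L real"
  proof -
    have "f = (\<Sum>b\<in>Basis. f b *\<^sub>R blinfun_inner_left b)"
    proof (rule blinfun_eqI)
      fix v
      have "f v = (\<Sum>b\<in>Basis. (v \<bullet> b) *\<^sub>R f b)"
        by (rule linear_eq_sum_Basis) (rule bounded_linear.linear[OF blinfun.bounded_linear_right])
      then show "f v = (\<Sum>b\<in>Basis. f b *\<^sub>R blinfun_inner_left b) v"
        by (simp add: blinfun.sum_left blinfun.scaleR_left mult.commute inner_commute)
    qed
    also have "\<dots> \<in> span (blinfun_inner_left ` Basis)"
      by (intro span_sum span_scale span_base imageI)
    finally show ?thesis .
  qed
  then have "range h \<subseteq> span (blinfun_inner_left ` Basis)" by blast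
  then have "card (range h) \<le> card (blinfun_inner_left ` (Basis :: 'e set))"
    using independent_span_bound[OF _ assms(2), of "blinfun_inner_left ` Basis"] by simp
  also have "\<dots> \<le> DIM('e)" by (rule card_image_le) simp
  finally show "CARD('k) \<le> DIM('e)" using assms(1) by (simp add: card_image)
  define F where "F v = (\<chi> k. h k v)" for v
  have F: "linear F"
    by (intro linearI) (simp_all add: F_def vec_eq_iff blinfun.add_right blinfun.scaleR_right)
  have "inj F"
    unfolding linear_injective_0[OF F]
    using basis_functionals_injective[OF assms(3)] by (auto simp: F_def vec_eq_iff)
  then have "dim (range F) = DIM('e)"
    using dim_image_eq[OF F, of UNIV] by simp
  moreover have "dim (range F) \<le> DIM(real^'k)" by (rule dim_subset_UNIV)
  ultimately show "DIM('e) \<le> CARD('k)" by simp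
qed

lemma dual_basis_exists:
  fixes h :: "'k::finite \<Rightarrow> 'e::euclidean_space \<Rightarrow>\<^sub>L real"
  assumes "inj h" "independent (range h)" "span (range h) = UNIV"
  shows "\<exists>e. \<forall>k l. h k (e l) = (if k = l then 1 else 0)"
proof -
  define F where "F v = (\<chi> k. h k v)" for v
  have F: "linear F"
    by (intro linearI) (simp_all add: F_def vec_eq_iff blinfun.add_right blinfun.scaleR_right)
  have "inj F"
    unfolding linear_injective_0[OF F]
    using basis_functionals_injective[OF assms(3)] by (auto simp: F_def vec_eq_iff)
  then have "dim (range F) = DIM(real^'k)"
    using dim_image_eq[OF F, of UNIV] basis_functionals_card[OF assms] by simp
  then have "span (range F) = UNIV"
    unfolding dim_eq_full .
  moreover have "subspace (range F)"
    by (rule linear_subspace_image[OF F subspace_UNIV])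
  ultimately have surj: "surj F" by (simp add: span_eq_iff[THEN iffD2])
  have "h k (inv F (axis l 1)) = (if k = l then 1 else 0)" for k l
  proof -
    have "h k (inv F (axis l 1)) = F (inv F (axis l 1)) $ k" by (simp add: F_def)
    also have "\<dots> = (if k = l then 1 else 0)" by (simp add: surj_f_inv_f[OF surj] axis_def)
    finally show ?thesis .
  qed
  then show ?thesis by (intro exI[of _ "\<lambda>l. inv F (axis l 1)"] allI)
qed

lemma dual_basis_expansion:
  fixes h :: "'k::finite \<Rightarrow> 'e::euclidean_space \<Rightarrow>\<^sub>L real"
  assumes "span (range h) = UNIV" "\<And>k l. h k (e l) = (if k = l then 1 else 0)"
  shows "v = (\<Sum>k\<in>UNIV. h k v *\<^sub>R e k)"
proof -
  have "h l (v - (\<Sum>k\<in>UNIV. h k v *\<^sub>R e k)) = 0" for l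
    by (simp add: blinfun.diff_right blinfun.sum_right blinfun.scaleR_right assms(2) if_distrib cong: if_cong)
  then show ?thesis
    using basis_functionals_injective[OF assms(1)] by fastforce
qed

text \<open>On the domain of a coframe the dual vectors are uniquely determined, so the choice at
  each point is harmless there and smoothness can still be proved.\<close>

definition dual_frame :: "('k \<Rightarrow> 'm \<Rightarrow> 'e::euclidean_space \<Rightarrow>\<^sub>L real) \<Rightarrow> 'm \<Rightarrow> 'k \<Rightarrow> 'e" where
  "dual_frame \<eta> x = (SOME e. \<forall>k l. \<eta> k x (e l) = (if k = l then 1 else 0))"

lemma dual_frame:
  fixes \<eta> :: "'k::finite \<Rightarrow> 'm \<Rightarrow> 'e::euclidean_space \<Rightarrow>\<^sub>L real"
  assumes "coframe_on M U UNIV \<eta>" "x \<in> U"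
  shows "\<eta> k x (dual_frame \<eta> x l) = (if k = l then 1 else 0)"
proof -
  have "\<exists>e. \<forall>k l. \<eta> k x (e l) = (if k = l then 1 else 0)"
    using assms by (intro dual_basis_exists) (auto simp: coframe_on_def)
  from someI_ex[OF this] show ?thesis by (simp add: dual_frame_def)
qed

lemma dual_frame_expansion:
  fixes \<eta> :: "'k::finite \<Rightarrow> 'm \<Rightarrow> 'e::euclidean_space \<Rightarrow>\<^sub>L real"
  assumes "coframe_on M U UNIV \<eta>" "x \<in> U"
  shows "v = (\<Sum>k\<in>UNIV. \<eta> k x v *\<^sub>R dual_frame \<eta> x k)"
  using assms dual_frame[OF assms] by (intro dual_basis_expansion) (auto simp: coframe_on_def)

lemma form1_singleton: "x \<in> U \<Longrightarrow> form1 U \<zeta> x [v] = \<zeta> x v"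
  by (simp add: form1_def)

lemma homogeneous_form1: "homogeneous 1 (form1 U \<zeta>)"
  by (simp add: homogeneous_def form1_def)

lemma wedge_form1:
  "(form1 U \<zeta> \<and>\<^sub>f form1 U \<xi>) x [v, w] = (if x \<in> U then \<zeta> x v * \<xi> x w - \<zeta> x w * \<xi> x v else 0)"
  by (simp add: wedge_def wedge_pt_Cons wedge_pt_Nil grade_def form1_def)

lemma wedge_form1_length:
  assumes "length vs \<noteq> 2"
  shows "(form1 U \<zeta> \<and>\<^sub>f form1 U \<xi>) x vs = 0"
proof -
  have "form1 U \<zeta> x (nths vs S) * form1 U \<xi> x (nths vs (- S)) = 0" for S
    using length_nths_Compl[of vs S] assms by (auto simp: form1_def)
  then show ?thesis
    unfolding wedge_def wedge_pt_def mult.assoc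
    by (simp only: mult_zero_right sum.neutral_const)
qed

section \<open>Smooth dual frames and expansions in a coframe\<close>

context smooth_mfd
begin

lemma coframe_form1: "coframe_on M U UNIV \<eta> \<Longrightarrow> form1 U (\<eta> k) \<in> forms M U"
  by (simp add: coframe_on_def)

lemma form1_subset:
  assumes "form1 U \<zeta> \<in> forms M U" "open_in M V" "V \<subseteq> U"
  shows "form1 V \<zeta> \<in> forms M V"
proof (rule formsI)
  show "alternating_form (form1 V \<zeta> x)" if "x \<in> V" for x
  proof -
    have "form1 V \<zeta> x = form1 U \<zeta> x" using that assms(3) by (auto simp: form1_def)
    then show ?thesis using forms_alternating[OF assms(1)] that assms(3) by auto
  qed
  show "smooth_on (snd c ` (fst c \<inter> V)) (\<lambda>y. chart_rep M c (form1 V \<zeta>) y vs)" if c: "c \<in> charts M" for c vs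
  proof (rule smooth_on_cong[OF open_chart_image[OF c assms(2)]])
    show "smooth_on (snd c ` (fst c \<inter> V)) (\<lambda>y. chart_rep M c (form1 U \<zeta>) y vs)"
      by (rule smooth_on_subset[OF smooth_chart_rep[OF assms(1) c]]) (use assms(3) in auto)
  qed (use assms(3) chart_rep_eq[OF c] in \<open>auto simp: form1_def\<close>)
qed (simp add: form1_def)

lemma coframe_on_subset:
  assumes "coframe_on M U K \<eta>" "open_in M V" "V \<subseteq> U"
  shows "coframe_on M V K \<eta>"
  using assms form1_subset[OF _ assms(2,3)] unfolding coframe_on_def by blast

text \<open>In the coordinates of \<open>c\<close> the l-th dual vector solves a linear system with
  right-hand side \<open>axis l 1\<close>, whose matrix \<open>N\<close> consists of the smooth
  components of the coframe. Cramer's rule writes the solution as a quotient of smooth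
  functions.\<close>

lemma smooth_dual_frame:
  fixes \<eta> :: "'k::finite \<Rightarrow> 'm \<Rightarrow> 'e \<Rightarrow>\<^sub>L real"
  assumes U: "open_in M U" and cof: "coframe_on M U UNIV \<eta>" and c: "c \<in> charts M"
  shows "smooth_on (snd c ` (fst c \<inter> U))
    (\<lambda>y. coord_change (chart_at M (chart_inv c y)) c (chart_inv c y) (dual_frame \<eta> (chart_inv c y) l))"
    (is "smooth_on ?S ?E")
proof (cases "?S = {}")
  case True
  then show ?thesis by (auto intro: smooth_on_local)
next
  case False
  then obtain x0 where "x0 \<in> U" by auto
  have S: "open ?S" by (rule open_chart_image[OF c U])
  \<comment> \<open>A point of the domain is what forces this equality. It allows
    \<open>Basis\<close> to be relabelled by \<open>'k\<close>, which makes the matrix of the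
    coframe square.\<close>
  have "CARD('k) = DIM('e)"
    using cof \<open>x0 \<in> U\<close> basis_functionals_card[of "\<lambda>k. \<eta> k x0"] by (auto simp: coframe_on_def)
  then obtain \<beta> :: "'k \<Rightarrow> 'e" where \<beta>: "bij_betw \<beta> UNIV Basis"
    using finite_same_card_bij[of "UNIV :: 'k set" "Basis :: 'e set"] by auto
  have \<beta>_inner: "\<beta> i \<bullet> \<beta> j = (if i = j then 1 else 0)" for i j
    using inner_Basis[of "\<beta> i" "\<beta> j"] bij_betwE[OF \<beta>] bij_betw_imp_inj_on[OF \<beta>] by (auto simp: inj_eq)
  have sum_\<beta>: "(\<Sum>b\<in>Basis. g b) = (\<Sum>j\<in>UNIV. g (\<beta> j))" for g :: "'e \<Rightarrow> real"
    using sum.reindex_bij_betw[OF \<beta>, of g] by simp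
  define N :: "'e \<Rightarrow> real^'k^'k" where "N y = (\<chi> k j. chart_rep M c (form1 U (\<eta> k)) y [\<beta> j])" for y
  have lin: "linear (\<lambda>v. chart_rep M c (form1 U (\<eta> k)) y [v])" if "y \<in> ?S" for k y
    by (intro alternating_form_linear_Cons alternating_chart_rep[OF coframe_form1[OF cof] c that])
  have N_mult: "(N y *v (\<chi> j. v \<bullet> \<beta> j)) $ k = chart_rep M c (form1 U (\<eta> k)) y [v]" if "y \<in> ?S" for y v k
    unfolding linear_eq_sum_Basis[OF lin[OF that], where v = v] sum_\<beta> real_scaleR_def
    by (simp add: N_def matrix_vector_mult_def sum_\<beta> mult.commute)
  have rep: "chart_rep M c (form1 U (\<eta> k)) (snd c x) [v] = \<eta> k x (coord_change c (chart_at M x) x v)"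
    if "x \<in> fst c" "x \<in> U" for x v k
    using chart_rep_eq[OF c that(1)] that(2) by (simp add: form1_singleton)
  \<comment> \<open>A null vector of the matrix, read as a tangent vector in the chart
    \<open>c\<close> and passed to the selected chart, is annihilated by the whole coframe. The
    passage has an inverse, so the vector is zero.\<close>
  have det: "det (N y) \<noteq> 0" if y: "y \<in> ?S" for y
  proof -
    obtain x where x: "y = snd c x" "x \<in> fst c" "x \<in> U" using y by auto
    note c0 = chart_at[OF chart_pts[OF c x(2)]]
    have "w = 0" if w: "N y *v w = 0" for w
    proof -
      define v where "v = (\<Sum>j\<in>UNIV. w $ j *\<^sub>R \<beta> j)"
      have vw: "(\<chi> j. v \<bullet> \<beta> j) = w"
        by (simp add: v_def vec_eq_iff inner_sum_left \<beta>_inner if_distrib cong: if_cong)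
      have "\<eta> k x (coord_change c (chart_at M x) x v) = 0" for k
        using N_mult[OF y, of v k] rep[OF x(2,3), of k v] w unfolding vw by (simp add: x(1))
      then have "coord_change c (chart_at M x) x v = 0"
        using basis_functionals_injective[of "\<lambda>k. \<eta> k x"] cof x(3) by (auto simp: coframe_on_def)
      then have "v = 0"
        using coord_change_compose[OF c c0(1) c x(2) c0(2) x(2), of v] coord_change_self[OF c x(2)]
          linear_0[OF linear_coord_change[OF c0(1) c c0(2) x(2)]] by simp
      then show ?thesis using vw by (auto simp: vec_eq_iff)
    qed
    then show ?thesis
      using invertible_det_nz invertible_left_inverse matrix_left_invertible_ker by blast
  qed
  have E: "(\<chi> j. ?E y \<bullet> \<beta> j) = (\<chi> k. det (\<chi> i j. if j = k then axis l 1 $ i else N y $ i $ j) / det (N y))"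
    if y: "y \<in> ?S" for y
  proof -
    obtain x where x: "y = snd c x" "x \<in> fst c" "x \<in> U" using y by auto
    note c0 = chart_at[OF chart_pts[OF c x(2)]]
    have "N y *v (\<chi> j. ?E y \<bullet> \<beta> j) = axis l 1"
      unfolding vec_eq_iff N_mult[OF y] unfolding x(1) rep[OF x(2,3)] chart_inv_chart[OF c x(2)]
      using coord_change_compose[OF c0(1) c c0(1) c0(2) x(2) c0(2)] coord_change_self[OF c0] dual_frame[OF cof x(3)]
      by (simp add: axis_def)
    then show ?thesis using cramer[OF det[OF y]] by blast
  qed
  show ?thesis
  proof (rule smooth_on_euclidean[OF S])
    fix b :: 'e assume "b \<in> Basis"
    then obtain k where b: "b = \<beta> k" using \<beta> by (auto simp: bij_betw_def)
    have sN: "smooth_on ?S (\<lambda>y. N y $ i $ j)" for i j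
      unfolding N_def vec_lambda_beta by (rule smooth_chart_rep[OF coframe_form1[OF cof] c])
    have "smooth_on ?S (\<lambda>y. (\<chi> i j. if j = k then axis l 1 $ i else N y $ i $ j) $ i $ j)" for i j
      by (cases "j = k") (simp_all add: smooth_on_const sN)
    then have "smooth_on ?S (\<lambda>y. det (\<chi> i j. if j = k then axis l 1 $ i else N y $ i $ j) / det (N y))"
      by (intro smooth_on_divide smooth_on_det S det sN)
    then show "smooth_on ?S (\<lambda>y. ?E y \<bullet> b)"
    proof (rule smooth_on_cong[OF S, rotated])
      fix y assume "y \<in> ?S"
      from arg_cong[OF E[OF this], of "\<lambda>u. u $ k"]
      show "det (\<chi> i j. if j = k then axis l 1 $ i else N y $ i $ j) / det (N y) = ?E y \<bullet> b"
        by (simp add: b)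
    qed
  qed
qed

text \<open>The list of indices covers coefficients in every degree at once; degrees 1 and 2 are
  used. The moving arguments are smooth in each chart although the selected charts are not related
  to each other.\<close>

lemma smooth_fun_coefficient:
  fixes \<eta> :: "'k::finite \<Rightarrow> 'm \<Rightarrow> 'e \<Rightarrow>\<^sub>L real"
  assumes U: "open_in M U" and cof: "coframe_on M U UNIV \<eta>" and \<omega>: "\<omega> \<in> forms M U"
  shows "smooth_fun M U (\<lambda>x. \<omega> x (map (dual_frame \<eta> x) ks))"
  unfolding smooth_fun_def
proof
  fix c assume c: "c \<in> charts M"
  let ?E = "\<lambda>k y. coord_change (chart_at M (chart_inv c y)) c (chart_inv c y) (dual_frame \<eta> (chart_inv c y) k)"
  let ?gs = "map ?E ks"
  have "smooth_on (snd c ` (fst c \<inter> U)) (\<lambda>y. chart_rep M c \<omega> y (map (\<lambda>g. g y) ?gs))"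
    by (rule smooth_on_form_fields[OF open_chart_image[OF c U]])
       (auto intro: smooth_chart_rep[OF \<omega> c] alternating_chart_rep[OF \<omega> c] smooth_dual_frame[OF U cof c])
  then show "smooth_on (snd c ` (fst c \<inter> U)) ((\<lambda>x. \<omega> x (map (dual_frame \<eta> x) ks)) \<circ> chart_inv c)"
  proof (rule smooth_on_cong[OF open_chart_image[OF c U], rotated])
    fix y assume "y \<in> snd c ` (fst c \<inter> U)"
    then obtain x where x: "y = snd c x" "x \<in> fst c" "x \<in> U" by auto
    note c0 = chart_at[OF chart_pts[OF c x(2)]]
    have "coord_change c (chart_at M x) x (coord_change (chart_at M x) c x v) = v" for v
      using coord_change_compose[OF c0(1) c c0(1) c0(2) x(2) c0(2)] coord_change_self[OF c0] by simp
    then show "chart_rep M c \<omega> y (map (\<lambda>g. g y) ?gs) = ((\<lambda>x. \<omega> x (map (dual_frame \<eta> x) ks)) \<circ> chart_inv c) y"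
      unfolding x(1) chart_rep_eq[OF c x(2)] by (simp add: chart_inv_chart[OF c x(2)] o_def)
  qed
qed

text \<open>The sum runs over ordered pairs, so each wedge product occurs twice, up to sign in both
  factors; this is the origin of the factor 1/2, here and in \<open>struct_coeff\<close>.\<close>

lemma two_form_expansion:
  fixes \<eta> :: "'k::finite \<Rightarrow> 'm \<Rightarrow> 'e \<Rightarrow>\<^sub>L real"
  assumes cof: "coframe_on M U UNIV \<eta>" and \<omega>: "\<omega> \<in> forms M U" "homogeneous 2 \<omega>"
  shows "\<omega> = (\<Sum>k\<in>UNIV. \<Sum>l\<in>UNIV.
     (\<lambda>x. 1/2 * \<omega> x [dual_frame \<eta> x k, dual_frame \<eta> x l]) *\<^sub>f (form1 U (\<eta> k) \<and>\<^sub>f form1 U (\<eta> l)))"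
proof (intro ext)
  fix x and vs :: "'e list"
  let ?e = "dual_frame \<eta> x"
  let ?R = "\<Sum>k\<in>UNIV. \<Sum>l\<in>UNIV. 1/2 * \<omega> x [?e k, ?e l] * (form1 U (\<eta> k) \<and>\<^sub>f form1 U (\<eta> l)) x vs"
  have "\<omega> x vs = ?R"
  proof (cases "x \<in> U \<and> length vs = 2")
    case True
    then obtain v w where vs: "vs = [v, w]" by (auto simp: length_Suc_conv numeral_2_eq_2)
    have alt: "alternating_form (\<omega> x)" using True \<omega>(1) forms_alternating by blast
    have lin1: "linear (\<lambda>v. \<omega> x (v # ws))" for ws by (rule alternating_form_linear_Cons[OF alt])
    have lin2: "linear (\<lambda>w. \<omega> x [v, w])" for v
      by (rule alternating_form_linear_Cons[OF alternating_form_contract[OF alt]])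
    have ex: "\<omega> x [v, w] = (\<Sum>k\<in>UNIV. \<Sum>l\<in>UNIV. \<eta> k x v * \<eta> l x w * \<omega> x [?e k, ?e l])" for v w
    proof -
      have "\<omega> x [v, w] = \<omega> x [\<Sum>k\<in>UNIV. \<eta> k x v *\<^sub>R ?e k, w]"
        using dual_frame_expansion[OF cof, of x v] True by simp
      also have "\<dots> = (\<Sum>k\<in>UNIV. \<eta> k x v * \<omega> x [?e k, w])"
        by (simp add: linear_sum[OF lin1] linear_cmul[OF lin1])
      also have "\<dots> = (\<Sum>k\<in>UNIV. \<eta> k x v * \<omega> x [?e k, \<Sum>l\<in>UNIV. \<eta> l x w *\<^sub>R ?e l])"
        using dual_frame_expansion[OF cof, of x w] True by simp
      also have "\<dots> = (\<Sum>k\<in>UNIV. \<Sum>l\<in>UNIV. \<eta> k x v * \<eta> l x w * \<omega> x [?e k, ?e l])"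
        by (simp add: linear_sum[OF lin2] linear_cmul[OF lin2] sum_distrib_left mult.assoc)
      finally show ?thesis .
    qed
    have "\<omega> x [v, w] = 1/2 * \<omega> x [v, w] - 1/2 * \<omega> x [w, v]"
      using alternating_form_swap[OF alt, of v w "[]"] by simp
    also have "\<dots> = ?R"
      unfolding ex[of v w] ex[of w v] vs wedge_form1
      using True by (simp add: sum_distrib_left sum_subtractf[symmetric] algebra_simps)
    finally show ?thesis by (simp add: vs)
  next
    case False
    then have "\<omega> x vs = 0"
      using forms_outside[OF \<omega>(1)] \<omega>(2) unfolding homogeneous_def by blast
    moreover have "(form1 U (\<eta> k) \<and>\<^sub>f form1 U (\<eta> l)) x vs = 0" for k l
      using False wedge_form1_length[of vs] by (auto simp: wedge_def wedge_pt_def form1_def)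
    ultimately show ?thesis by simp
  qed
  then show "\<omega> x vs = (\<Sum>k\<in>UNIV. \<Sum>l\<in>UNIV.
     (\<lambda>x. 1/2 * \<omega> x [dual_frame \<eta> x k, dual_frame \<eta> x l]) *\<^sub>f (form1 U (\<eta> k) \<and>\<^sub>f form1 U (\<eta> l))) x vs"
    by (simp add: sum_fun_apply scale_form_def)
qed

text \<open>A covector in the span of the \<theta> vanishes on the dual vectors belonging to \<rho>,
  so no other terms survive. The coefficients are written with \<open>map\<close> to match
  \<open>smooth_fun_coefficient\<close>.\<close>

lemma section_expansion:
  fixes \<theta> :: "'r::finite \<Rightarrow> 'm \<Rightarrow> 'e \<Rightarrow>\<^sub>L real" and \<rho> :: "'k::finite \<Rightarrow> 'm \<Rightarrow> 'e \<Rightarrow>\<^sub>L real"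
  assumes cof: "coframe_on M U UNIV (case_sum \<theta> \<rho>)"
    and \<zeta>: "\<And>x. x \<in> U \<Longrightarrow> \<zeta> x \<in> span (range (\<lambda>i. \<theta> i x))"
  shows "form1 U \<zeta> = (\<Sum>i\<in>UNIV.
     (\<lambda>x. form1 U \<zeta> x (map (dual_frame (case_sum \<theta> \<rho>) x) [Inl i])) *\<^sub>f form1 U (\<theta> i))"
proof (intro ext)
  fix x and vs :: "'e list"
  let ?e = "dual_frame (case_sum \<theta> \<rho>) x"
  have "form1 U \<zeta> x vs = (\<Sum>i\<in>UNIV. form1 U \<zeta> x [?e (Inl i)] * form1 U (\<theta> i) x vs)"
  proof (cases "x \<in> U \<and> length vs = 1")
    case True
    then obtain v where vs: "vs = [v]" by (auto simp: length_Suc_conv)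
    have "subspace {f. \<forall>k. blinfun_apply f (?e (Inr k)) = 0}"
      by (auto simp: subspace_def plus_blinfun.rep_eq scaleR_blinfun.rep_eq)
    moreover have "\<theta> i x (?e (Inr k)) = 0" for i k
      using dual_frame[OF cof, of x "Inl i" "Inr k"] True by simp
    ultimately have "span (range (\<lambda>i. \<theta> i x)) \<subseteq> {f. \<forall>k. blinfun_apply f (?e (Inr k)) = 0}"
      by (intro span_minimal) auto
    then have 0: "\<zeta> x (?e (Inr k)) = 0" for k using \<zeta> True by blast
    have "\<zeta> x v = \<zeta> x (\<Sum>k\<in>UNIV. case_sum \<theta> \<rho> k x v *\<^sub>R ?e k)"
      using dual_frame_expansion[OF cof, of x v] True by simp
    also have "\<dots> = (\<Sum>i\<in>UNIV. \<theta> i x v * \<zeta> x (?e (Inl i)))"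
      by (simp add: blinfun.add_right blinfun.sum_right blinfun.scaleR_right sum_UNIV_sum 0)
    finally show ?thesis
      using True by (simp add: vs form1_singleton mult.commute)
  qed (auto simp: form1_def)
  then show "form1 U \<zeta> x vs = (\<Sum>i\<in>UNIV.
     (\<lambda>x. form1 U \<zeta> x (map (dual_frame (case_sum \<theta> \<rho>) x) [Inl i])) *\<^sub>f form1 U (\<theta> i)) x vs"
    by (simp add: sum_fun_apply scale_form_def)
qed

section \<open>Algebraic generators of the Pfaffian ideal\<close>

lemma sections_forms: "pfaffian_sections M I U \<subseteq> forms M U"
  by (auto simp: pfaffian_sections_def)

lemma sections_subset_hull:
  fixes \<theta> :: "'r::finite \<Rightarrow> 'm \<Rightarrow> 'e \<Rightarrow>\<^sub>L real" and \<rho> :: "'k::finite \<Rightarrow> 'm \<Rightarrow> 'e \<Rightarrow>\<^sub>L real"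
  assumes U: "open_in M U" and cof: "coframe_on M U UNIV (case_sum \<theta> \<rho>)"
    and I: "\<And>x. x \<in> U \<Longrightarrow> I x = span (range (\<lambda>i. \<theta> i x))"
    and J: "form_ideal M U J" "\<And>i. form1 U (\<theta> i) \<in> J"
  shows "pfaffian_sections M I U \<subseteq> J"
proof
  fix \<omega> assume "\<omega> \<in> pfaffian_sections M I U"
  then obtain \<zeta> where \<zeta>: "\<omega> = form1 U \<zeta>" "\<And>x. x \<in> U \<Longrightarrow> \<zeta> x \<in> I x" "form1 U \<zeta> \<in> forms M U"
    unfolding pfaffian_sections_def by blast
  show "\<omega> \<in> J"
    unfolding \<zeta>(1)
    by (subst section_expansion[OF cof])
       (use \<zeta>(2) I in \<open>auto intro!: form_ideal_sum form_ideal_scale U J smooth_fun_coefficient[OF U cof \<zeta>(3), of "[_]", simplified]\<close>)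
qed

lemma coframe_section:
  assumes "form1 U (\<theta> i) \<in> forms M U" "\<And>x. x \<in> U \<Longrightarrow> I x = span (range (\<lambda>i. \<theta> i x))"
  shows "form1 U (\<theta> i) \<in> pfaffian_sections M I U"
  unfolding pfaffian_sections_def using assms by (auto intro: span_base)

lemma pfaffian_ideal_memI:
  "(\<And>J. differential_ideal M U J \<Longrightarrow> pfaffian_sections M I U \<subseteq> J \<Longrightarrow> \<omega> \<in> J) \<Longrightarrow> \<omega> \<in> pfaffian_ideal M I U"
  unfolding pfaffian_ideal_def hull_def by blast

text \<open>The derivatives of the listed generators are again listed or zero, so the algebraic
  ideal is already closed under d. The complement \<rho> completes the \<theta> to a coframe, which
  supplies smooth coefficients for arbitrary sections of \<open>I\<close>.\<close>

lemma pfaffian_ideal_eq_hull: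
  fixes \<theta> :: "'r::finite \<Rightarrow> 'm \<Rightarrow> 'e \<Rightarrow>\<^sub>L real" and \<rho> :: "'k::finite \<Rightarrow> 'm \<Rightarrow> 'e \<Rightarrow>\<^sub>L real"
  assumes U: "open_in M U" and cof: "coframe_on M U UNIV (case_sum \<theta> \<rho>)"
    and I: "\<And>x. x \<in> U \<Longrightarrow> I x = span (range (\<lambda>i. \<theta> i x))"
  shows "pfaffian_ideal M I U =
    form_ideal M U hull (range (\<lambda>i. form1 U (\<theta> i)) \<union> range (\<lambda>i. ext_deriv M U (form1 U (\<theta> i))))"
    (is "_ = form_ideal M U hull ?G")
proof (rule antisym)
  have \<theta>: "form1 U (\<theta> i) \<in> forms M U" for i
    using coframe_form1[OF cof, of "Inl i"] by simp
  have GF: "?G \<subseteq> forms M U"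
    using \<theta> forms_ext_deriv[OF U] by auto
  have fi: "form_ideal M U (form_ideal M U hull ?G)"
    by (rule form_ideal_hull[OF U GF])
  have "differential_ideal M U (form_ideal M U hull ?G)"
  proof (rule differential_ideal_hull[OF U GF])
    show "\<exists>k. homogeneous k g" if "g \<in> ?G" for g
      using that homogeneous_form1 homogeneous_ext_deriv by blast
    show "ext_deriv M U g \<in> form_ideal M U hull ?G" if "g \<in> ?G" for g
    proof (cases "g \<in> range (\<lambda>i. form1 U (\<theta> i))")
      case True
      then show ?thesis by (auto intro: hull_inc)
    next
      case False
      then have "ext_deriv M U g = 0" using that ext_deriv_ext_deriv[OF U \<theta>] by auto
      then show ?thesis using fi by (simp add: form_ideal_def)
    qed
  qed
  moreover have "pfaffian_sections M I U \<subseteq> form_ideal M U hull ?G"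
    by (rule sections_subset_hull[OF U cof I fi]) (auto intro: hull_inc)
  ultimately show "pfaffian_ideal M I U \<subseteq> form_ideal M U hull ?G"
    unfolding pfaffian_ideal_def by (simp add: hull_minimal)
  show "form_ideal M U hull ?G \<subseteq> pfaffian_ideal M I U"
  proof
    fix \<omega> assume \<omega>: "\<omega> \<in> form_ideal M U hull ?G"
    show "\<omega> \<in> pfaffian_ideal M I U"
    proof (rule pfaffian_ideal_memI)
      fix J assume J: "differential_ideal M U J" "pfaffian_sections M I U \<subseteq> J"
      then have "form1 U (\<theta> i) \<in> J" for i
        using coframe_section[OF \<theta> I] by blast
      then have "?G \<subseteq> J" "form_ideal M U J"
        using J(1) unfolding differential_ideal_def by auto
      then have "form_ideal M U hull ?G \<subseteq> J" by (rule hull_minimal)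
      then show "\<omega> \<in> J" using \<omega> by blast
    qed
  qed
qed

section \<open>Existence of structure coefficients\<close>

lemma ext_deriv_UNIV:
  "open_in M V \<Longrightarrow> x \<in> V \<Longrightarrow> ext_deriv M V (form1 V \<zeta>) x vs = ext_deriv M UNIV (form1 UNIV \<zeta>) x vs"
  by (rule ext_deriv_local) (auto simp: form1_def)

text \<open>The coefficients \<open>A\<close> and \<open>B\<close> of the structure equations, as values of \<open>d\<theta>\<close> on the dual
  frame; written with \<open>UNIV\<close> so that they do not depend on the domain of the coframe.\<close>

definition struct_coeff ::
  "('k \<Rightarrow> 'm \<Rightarrow> 'e \<Rightarrow>\<^sub>L real) \<Rightarrow> ('m \<Rightarrow> 'e \<Rightarrow>\<^sub>L real) \<Rightarrow> 'k \<Rightarrow> 'k \<Rightarrow> 'm \<Rightarrow> real" where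
  "struct_coeff \<eta> \<zeta> k l x =
     1/2 * ext_deriv M UNIV (form1 UNIV \<zeta>) x [dual_frame \<eta> x k, dual_frame \<eta> x l]"

text \<open>Of the expansion of d \<theta> in the coframe, the terms with a factor \<theta> lie in
  the ideal of sections and the mixed ones are removed by \<open>cross\<close>; what remains are the
  two blocks of the structure equations.\<close>

lemma structure_coeffs_struct_coeff:
  fixes \<theta> :: "'r::finite \<Rightarrow> 'm \<Rightarrow> 'e \<Rightarrow>\<^sub>L real"
    and \<sigma> :: "'p::finite \<Rightarrow> 'm \<Rightarrow> 'e \<Rightarrow>\<^sub>L real" and \<tau> :: "'q::finite \<Rightarrow> 'm \<Rightarrow> 'e \<Rightarrow>\<^sub>L real"
  defines "\<eta> \<equiv> case_sum \<theta> (case_sum \<sigma> \<tau>)"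
  assumes U: "open_in M U" and cof: "coframe_on M U UNIV \<eta>"
    and I: "\<And>x. x \<in> U \<Longrightarrow> I x = span (range (\<lambda>i. \<theta> i x))"
    and cross: "\<And>x i a \<alpha>. x \<in> U \<Longrightarrow> ext_deriv M U (form1 U (\<theta> i)) x
        [dual_frame \<eta> x (Inr (Inl a)), dual_frame \<eta> x (Inr (Inr \<alpha>))] = 0"
  shows "structure_coeffs M I U \<theta> \<sigma> \<tau>
     (\<lambda>i a b. struct_coeff \<eta> (\<theta> i) (Inr (Inl a)) (Inr (Inl b)))
     (\<lambda>i \<alpha> \<beta>. struct_coeff \<eta> (\<theta> i) (Inr (Inr \<alpha>)) (Inr (Inr \<beta>)))"
proof -
  let ?d = "\<lambda>i. ext_deriv M U (form1 U (\<theta> i))"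
  have \<eta>: "form1 U (\<eta> k) \<in> forms M U" for k
    using coframe_form1[OF cof] .
  have \<theta>: "form1 U (\<theta> i) \<in> forms M U" for i
    using \<eta>[of "Inl i"] by (simp add: \<eta>_def)
  have d: "?d i \<in> forms M U" for i
    by (rule forms_ext_deriv[OF U \<theta>])
  have hom: "homogeneous 2 (?d i)" for i
    using homogeneous_ext_deriv[OF homogeneous_form1, of U U "\<theta> i"] by (simp add: numeral_2_eq_2)
  have eq: "struct_coeff \<eta> (\<theta> i) k l x = 1/2 * ?d i x [dual_frame \<eta> x k, dual_frame \<eta> x l]" if "x \<in> U" for i k l x
    unfolding struct_coeff_def ext_deriv_UNIV[OF U that] ..
  have smooth: "smooth_fun M U (struct_coeff \<eta> (\<theta> i) k l)" for i k l
  proof (rule smooth_fun_cong[OF U])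
    show "smooth_fun M U (\<lambda>x. 1/2 * ?d i x (map (dual_frame \<eta> x) [k, l]))"
      by (intro smooth_fun_mult[OF U] smooth_fun_const smooth_fun_coefficient[OF U cof d])
  qed (simp add: eq)
  have skew: "struct_coeff \<eta> (\<theta> i) k l x = - struct_coeff \<eta> (\<theta> i) l k x" if "x \<in> U" for i k l x
    unfolding eq[OF that]
    using alternating_form_swap[OF forms_alternating[OF d that], of i "dual_frame \<eta> x k" "dual_frame \<eta> x l" "[]"]
    by linarith
  let ?H = "form_ideal M U hull pfaffian_sections M I U"
  have H: "form_ideal M U ?H"
    by (rule form_ideal_hull[OF U sections_forms])
  have \<theta>H: "form1 U (\<theta> i) \<in> ?H" for i
    by (intro hull_inc coframe_section \<theta> I)
  have "form1 U (\<eta> (Inl i)) \<in> ?H" for i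
    using \<theta>H by (simp add: \<eta>_def)
  then have Hw: "form1 U (\<eta> (Inl i)) \<and>\<^sub>f form1 U (\<eta> k) \<in> ?H" "form1 U (\<eta> k) \<and>\<^sub>f form1 U (\<eta> (Inl i)) \<in> ?H" for i k
    using H \<eta> unfolding form_ideal_def by blast+
  have cong: "cong_mod M I U (?d i)
      ((\<Sum>a\<in>UNIV. \<Sum>b\<in>UNIV. struct_coeff \<eta> (\<theta> i) (Inr (Inl a)) (Inr (Inl b)) *\<^sub>f (form1 U (\<sigma> a) \<and>\<^sub>f form1 U (\<sigma> b))) +
       (\<Sum>\<alpha>\<in>UNIV. \<Sum>\<beta>\<in>UNIV. struct_coeff \<eta> (\<theta> i) (Inr (Inr \<alpha>)) (Inr (Inr \<beta>)) *\<^sub>f (form1 U (\<tau> \<alpha>) \<and>\<^sub>f form1 U (\<tau> \<beta>))))" for i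
  proof -
    let ?t = "\<lambda>k l. struct_coeff \<eta> (\<theta> i) k l *\<^sub>f (form1 U (\<eta> k) \<and>\<^sub>f form1 U (\<eta> l))"
    have t: "?t k l = (\<lambda>x. 1/2 * ?d i x [dual_frame \<eta> x k, dual_frame \<eta> x l]) *\<^sub>f (form1 U (\<eta> k) \<and>\<^sub>f form1 U (\<eta> l))" for k l
    proof (intro ext)
      fix x vs
      show "?t k l x vs = ((\<lambda>x. 1/2 * ?d i x [dual_frame \<eta> x k, dual_frame \<eta> x l]) *\<^sub>f (form1 U (\<eta> k) \<and>\<^sub>f form1 U (\<eta> l))) x vs"
        by (cases "x \<in> U") (auto simp: scale_form_def eq wedge_def wedge_pt_def form1_def)
    qed
    have "?d i = (\<Sum>k\<in>UNIV. \<Sum>l\<in>UNIV. ?t k l)"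
      unfolding t by (rule two_form_expansion[OF cof d hom])
    moreover have "?t (Inr (Inl a)) (Inr (Inr \<alpha>)) = 0" "?t (Inr (Inr \<alpha>)) (Inr (Inl a)) = 0" for a \<alpha>
    proof -
      have "struct_coeff \<eta> (\<theta> i) (Inr (Inl a)) (Inr (Inr \<alpha>)) x = 0"
        "struct_coeff \<eta> (\<theta> i) (Inr (Inr \<alpha>)) (Inr (Inl a)) x = 0" if "x \<in> U" for x
        using cross[OF that] skew[OF that, of i "Inr (Inr \<alpha>)" "Inr (Inl a)"] by (simp_all add: eq[OF that])
      moreover have "(form1 U (\<eta> k) \<and>\<^sub>f form1 U (\<eta> l)) x vs = 0" if "x \<notin> U" for k l x vs
        using that by (simp add: wedge_def wedge_pt_def form1_def)
      ultimately show "?t (Inr (Inl a)) (Inr (Inr \<alpha>)) = 0" "?t (Inr (Inr \<alpha>)) (Inr (Inl a)) = 0"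
        unfolding scale_form_def fun_eq_iff zero_fun_def
        by (intro allI; case_tac "x \<in> U"; simp)+
    qed
    ultimately have "?d i - ((\<Sum>a\<in>UNIV. \<Sum>b\<in>UNIV. ?t (Inr (Inl a)) (Inr (Inl b))) +
       (\<Sum>\<alpha>\<in>UNIV. \<Sum>\<beta>\<in>UNIV. ?t (Inr (Inr \<alpha>)) (Inr (Inr \<beta>)))) =
      (\<Sum>j\<in>UNIV. \<Sum>l\<in>UNIV. ?t (Inl j) l) + (\<Sum>k\<in>UNIV. \<Sum>j\<in>UNIV. ?t (Inr k) (Inl j))"
      by (simp add: sum_UNIV_sum sum.distrib algebra_simps)
    also have "\<dots> \<in> ?H"
      by (intro form_ideal_add[OF H] form_ideal_sum[OF H] form_ideal_scale[OF U H] Hw smooth)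
    finally show ?thesis
      unfolding cong_mod_def by (simp add: \<eta>_def)
  qed
  show ?thesis
    unfolding structure_coeffs_def using smooth skew cong by blast
qed

end

section \<open>Smooth splitting of constant rank kernels\<close>

text \<open>Solving \<open>C u = C v\<close> by a square system: here \<open>C\<^sub>0\<close> is the value of a constant rank family
  \<open>C\<close> at a base point, and the Gram type matrix is invertible at the base point, hence nearby.\<close>

lemma inner_gram_matrix:
  fixes C C\<^sub>0 :: "real^'r \<Rightarrow> 'w::euclidean_space"
  assumes C: "linear C" "linear C\<^sub>0"
  shows "s \<bullet> ((\<chi> m n. C (axis n 1) \<bullet> C\<^sub>0 (axis m 1) + (\<Sum>b\<in>B. b $ n * b $ m)) *v t) =
    C t \<bullet> C\<^sub>0 s + (\<Sum>b\<in>B. (t \<bullet> b) * (s \<bullet> b))"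
proof -
  have ex: "L t = (\<Sum>n\<in>UNIV. t $ n *\<^sub>R L (axis n 1))" if "linear L" for L :: "real^'r \<Rightarrow> 'w" and t
    by (subst (1) basis_expansion[of t, symmetric])
       (simp add: linear_sum[OF that] linear_cmul[OF that] scalar_mult_eq_scaleR)
  have "C t \<bullet> C\<^sub>0 s = (\<Sum>m\<in>UNIV. \<Sum>n\<in>UNIV. s $ m * (C (axis n 1) \<bullet> C\<^sub>0 (axis m 1) * t $ n))"
    unfolding ex[OF C(1), of t] ex[OF C(2), of s]
    by (simp add: inner_sum_left inner_sum_right sum_distrib_left mult_ac)
  moreover have "(\<Sum>b\<in>B. (t \<bullet> b) * (s \<bullet> b)) = (\<Sum>m\<in>UNIV. \<Sum>n\<in>UNIV. s $ m * ((\<Sum>b\<in>B. b $ n * b $ m) * t $ n))"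
  proof -
    have "(\<Sum>b\<in>B. (t \<bullet> b) * (s \<bullet> b)) = (\<Sum>b\<in>B. \<Sum>m\<in>UNIV. \<Sum>n\<in>UNIV. s $ m * (b $ n * b $ m * t $ n))"
      by (simp add: inner_vec_def sum_product mult_ac)
    also have "\<dots> = (\<Sum>m\<in>UNIV. \<Sum>n\<in>UNIV. \<Sum>b\<in>B. s $ m * (b $ n * b $ m * t $ n))"
      by (subst sum.swap, rule sum.cong[OF refl], rule sum.swap)
    finally show ?thesis by (simp add: sum_distrib_left sum_distrib_right)
  qed
  ultimately show ?thesis
    by (simp add: inner_vec_def[of s] matrix_vector_mult_def sum_distrib_left sum.distrib algebra_simps)
qed

text \<open>At the base point the matrix represents |\<open>C\<^sub>0 t\<close>|^2 plus the squares
  of the inner products of t with \<open>B\<close>. If this vanishes, t lies in the kernel and is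
  orthogonal to a spanning set of it.\<close>

lemma det_gram_matrix_nonzero:
  fixes C\<^sub>0 :: "real^'r \<Rightarrow> 'w::euclidean_space"
  assumes C: "linear C\<^sub>0" and B: "finite B" "span B = {t. C\<^sub>0 t = 0}"
  shows "det (\<chi> m n. C\<^sub>0 (axis n 1) \<bullet> C\<^sub>0 (axis m 1) + (\<Sum>b\<in>B. b $ n * b $ m)) \<noteq> 0"
    (is "det ?G \<noteq> 0")
proof -
  have "t = 0" if t: "?G *v t = 0" for t
  proof -
    have "C\<^sub>0 t \<bullet> C\<^sub>0 t + (\<Sum>b\<in>B. (t \<bullet> b) * (t \<bullet> b)) = 0"
      using inner_gram_matrix[OF C C, of t B t] by (simp add: t)
    moreover have "(\<Sum>b\<in>B. (t \<bullet> b) * (t \<bullet> b)) \<ge> 0" by (intro sum_nonneg) simp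
    ultimately have "C\<^sub>0 t \<bullet> C\<^sub>0 t = 0" "(\<Sum>b\<in>B. (t \<bullet> b) * (t \<bullet> b)) = 0"
      using inner_ge_zero[of "C\<^sub>0 t"] by linarith+
    then have "C\<^sub>0 t = 0" "\<And>b. b \<in> B \<Longrightarrow> orthogonal t b"
      by (auto simp: sum_nonneg_eq_0_iff[OF B(1)] orthogonal_def)
    then have "orthogonal t t"
      using orthogonal_to_span[of t B t] B(2) by blast
    then show "t = 0" by (simp add: orthogonal_self)
  qed
  then show ?thesis
    using invertible_det_nz invertible_left_inverse matrix_left_invertible_ker by blast
qed

text \<open>\<open>G\<close> is the transpose of \<open>C\<^sub>0\<close> composed with
  \<open>C\<close>, plus \<open>P\<close>. On ker \<open>C\<close> it coincides with
  \<open>P\<close>, whose values lie in ker \<open>C\<^sub>0\<close>. As \<open>G\<close> is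
  injective and the two kernels have equal dimension, \<open>P\<close> maps ker \<open>C\<close>
  onto ker \<open>C\<^sub>0\<close>; this forces u - v into ker \<open>C\<close>. Without equal
  dimensions \<open>C u\<close> would be matched only on the range of
  \<open>C\<^sub>0\<close>.\<close>

lemma gram_matrix_solution:
  fixes C C\<^sub>0 :: "real^'r \<Rightarrow> 'w::euclidean_space" and B :: "(real^'r) set"
  defines "G \<equiv> \<chi> m n. C (axis n 1) \<bullet> C\<^sub>0 (axis m 1) + (\<Sum>b\<in>B. b $ n * b $ m)"
  assumes C: "linear C" "linear C\<^sub>0" and B: "finite B" "span B = {t. C\<^sub>0 t = 0}"
    and dim: "dim {t. C t = 0} = dim {t. C\<^sub>0 t = 0}" and det: "det G \<noteq> 0"
    and u: "G *v u = (\<chi> m. C v \<bullet> C\<^sub>0 (axis m 1))"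
  shows "C u = C v"
proof -
  define P where "P t = (\<Sum>b\<in>B. (t \<bullet> b) *\<^sub>R b)" for t
  have P: "linear P"
    unfolding P_def by (intro linearI) (simp_all add: inner_add_left sum.distrib scaleR_add_left scaleR_sum_right)
  have P_ker: "C\<^sub>0 (P t) = 0" for t
  proof -
    have "P t \<in> span B" unfolding P_def by (intro span_sum span_scale span_base)
    then show ?thesis using B(2) by blast
  qed
  have G: "s \<bullet> (G *v t) = C t \<bullet> C\<^sub>0 s + s \<bullet> P t" for s t
    unfolding G_def inner_gram_matrix[OF C] P_def by (simp add: inner_sum_right)
  have inj: "t = 0" if "G *v t = 0" for t
    using det that invertible_det_nz[of G] invertible_left_inverse[of G] matrix_left_invertible_ker[of G] by blast
  have eq: "(C u - C v) \<bullet> C\<^sub>0 s + s \<bullet> P u = 0" for s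
  proof -
    have "s \<bullet> (\<chi> m. C v \<bullet> C\<^sub>0 (axis m 1)) = C v \<bullet> C\<^sub>0 s"
    proof -
      have "C\<^sub>0 s = (\<Sum>n\<in>UNIV. s $ n *\<^sub>R C\<^sub>0 (axis n 1))"
        by (subst (1) basis_expansion[of s, symmetric])
           (simp add: linear_sum[OF C(2)] linear_cmul[OF C(2)] scalar_mult_eq_scaleR)
      then show ?thesis by (simp add: inner_vec_def[of s] inner_sum_right)
    qed
    then show ?thesis
      using G[of s u] u by (simp add: inner_diff_left)
  qed
  \<comment> \<open>\<open>P u\<close> lies in the kernel of \<open>C\<^sub>0\<close>; used as test
    vector \<open>s\<close> it leaves only its own square.\<close>
  have "P u = 0"
    using eq[of "P u"] P_ker[of u] by simp
  define w where "w = u - v"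
  have "C w \<bullet> C\<^sub>0 s = 0" for s
    using eq[of s] \<open>P u = 0\<close> by (simp add: w_def linear_diff[OF C(1)])
  then have Gw: "G *v w = P w"
    using G[of _ w] by (intro vector_eq_ldot[THEN iffD1]) simp
  let ?N = "{t. C t = 0}" and ?K = "{t. C\<^sub>0 t = 0}"
  have N: "subspace ?N" "subspace ?K"
    using C by (simp_all add: subspace_def linear_0 linear_add linear_cmul)
  have GN: "G *v n = P n" if "n \<in> ?N" for n
    using G[of _ n] that by (intro vector_eq_ldot[THEN iffD1]) simp
  have "inj_on P ?N"
  proof (rule inj_onI)
    fix a b assume "a \<in> ?N" "b \<in> ?N" "P a = P b"
    then have "G *v (a - b) = 0" by (simp add: GN matrix_vector_mult_diff_distrib)
    then show "a = b" using inj by fastforce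
  qed
  then have "dim (P ` ?N) = dim ?N"
    using dim_image_eq[OF P, of ?N] N(1) by (metis span_eq_iff)
  moreover have "P ` ?N \<subseteq> ?K" using P_ker by auto
  ultimately have "P ` ?N = ?K"
    using dim N by (intro subspace_dim_equal linear_subspace_image[OF P]) simp_all
  then obtain n where n: "n \<in> ?N" "P n = P w"
    using P_ker[of w] by (metis (mono_tags, lifting) imageE mem_Collect_eq)
  then have "G *v (n - w) = 0"
    using GN[OF n(1)] Gw by (simp add: matrix_vector_mult_diff_distrib)
  then have "n = w" using inj by fastforce
  then show ?thesis using n(1) by (simp add: w_def linear_diff[OF C(1)])
qed

section \<open>Ranks and kernels of the coefficient maps\<close>

lemma linear_coeff_map: "linear (coeff_map A y)"
  by (intro linearI)
     (simp_all add: coeff_map_def vec_eq_iff sum.distrib algebra_simps sum_distrib_left)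

lemma coeff_map_axis: "coeff_map A y (axis i 1) = (\<chi> a b. A i a b y)"
  by (simp add: coeff_map_def axis_def vec_eq_iff if_distrib if_distribR cong: if_cong)

lemma dim_kernel_range:
  fixes f :: "'a::euclidean_space \<Rightarrow> 'b::euclidean_space"
  assumes f: "linear f"
  shows "dim (kernel f) + dim (range f) = DIM('a)"
proof -
  let ?K = "kernel f" and ?P = "{y \<in> UNIV. \<forall>x\<in>kernel f. orthogonal x y}"
  have K: "subspace ?K"
    using f by (simp add: kernel_def subspace_def linear_0 linear_add linear_cmul)
  have P: "subspace ?P"
    by (auto simp: subspace_def orthogonal_clauses)
  have "inj_on f ?P"
  proof (rule inj_onI)
    fix a b assume ab: "a \<in> ?P" "b \<in> ?P" "f a = f b"
    then have "a - b \<in> ?K" by (simp add: kernel_def linear_diff[OF f])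
    moreover have "a - b \<in> ?P" using P ab by (intro subspace_diff)
    ultimately have "orthogonal (a - b) (a - b)" by blast
    then show "a = b" by (simp add: orthogonal_self)
  qed
  then have "dim (f ` ?P) = dim ?P"
    using dim_image_eq[OF f, of ?P] P by (simp add: span_eq_iff[THEN iffD2])
  moreover have "f ` ?P = range f"
  proof (intro equalityI subsetI)
    fix z assume "z \<in> range f"
    then obtain x where x: "z = f x" by blast
    obtain a b where ab: "a \<in> span ?K" "\<And>w. w \<in> span ?K \<Longrightarrow> orthogonal b w" "x = a + b"
      using orthogonal_subspace_decomp_exists[of ?K x] by blast
    then have "f a = 0" using K by (simp add: span_eq_iff[THEN iffD2] kernel_def)
    then have "z = f b" using x ab(3) by (simp add: linear_add[OF f])
    moreover have "b \<in> ?P" using ab(2) by (auto intro: span_base simp: orthogonal_commute)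
    ultimately show "z \<in> f ` ?P" by blast
  qed auto
  moreover have "dim ?P + dim ?K = DIM('a)"
    using dim_subspace_orthogonal_to_vectors[OF K subspace_UNIV] by simp
  ultimately show ?thesis by simp
qed

text \<open>The kernel of the pair is the intersection of the two kernels. As their sum is
  everything, the dimension formula expresses its dimension by the two ranks alone.\<close>

lemma kernel_sum_Int_dim:
  fixes f :: "real^'r \<Rightarrow> 'v::euclidean_space" and g :: "real^'r \<Rightarrow> 'w::euclidean_space"
  assumes "linear f" "linear g" "dim {t + u | t u. t \<in> kernel f \<and> u \<in> kernel g} = CARD('r)"
  shows "dim {t. (f t, g t) = 0} = CARD('r) - dim (range f) - dim (range g)"
    and "{t + u | t u. t \<in> kernel f \<and> u \<in> kernel g} = UNIV"
proof -
  have s: "subspace (kernel f)" "subspace (kernel g)"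
    using assms by (simp_all add: kernel_def subspace_def linear_0 linear_add linear_cmul)
  have d: "dim (kernel f) + dim (range f) = CARD('r)" "dim (kernel g) + dim (range g) = CARD('r)"
    using dim_kernel_range[OF assms(1)] dim_kernel_range[OF assms(2)] by simp_all
  have "{t. (f t, g t) = 0} = kernel f \<inter> kernel g"
    by (auto simp: kernel_def zero_prod_def)
  then show "dim {t. (f t, g t) = 0} = CARD('r) - dim (range f) - dim (range g)"
    using dim_sums_Int[OF s] d assms(3) by simp
  have "span {t + u | t u. t \<in> kernel f \<and> u \<in> kernel g} = {t + u | t u. t \<in> kernel f \<and> u \<in> kernel g}"
    using subspace_sums[OF s] by (rule span_eq_iff[THEN iffD2])
  moreover have "span {t + u | t u. t \<in> kernel f \<and> u \<in> kernel g} = UNIV"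
    using assms(3) by (simp add: dim_eq_full[symmetric])
  ultimately show "{t + u | t u. t \<in> kernel f \<and> u \<in> kernel g} = UNIV"
    by (rule trans[OF sym])
qed

context smooth_mfd
begin

lemma smooth_fun_add:
  "open_in M U \<Longrightarrow> smooth_fun M U f \<Longrightarrow> smooth_fun M U g \<Longrightarrow> smooth_fun M U (\<lambda>x. f x + g x)"
  by (auto simp: smooth_fun_def o_def intro!: smooth_on_add open_chart_image)

text \<open>At each y the i-th unit vector splits as t + w with t in ker A and w in ker B, but t and
  w depend on choices. The value \<open>C y w\<close> does not: it consists of A at the unit vector
  and of 0, which is smooth in y. The Gram system produces from this value a smooth vector with the
  same image as w.\<close>

lemma smooth_kernel_splitting:
  fixes A :: "'r::finite \<Rightarrow> 'p::finite \<Rightarrow> 'p \<Rightarrow> 'm \<Rightarrow> real" and B :: "'r \<Rightarrow> 'q::finite \<Rightarrow> 'q \<Rightarrow> 'm \<Rightarrow> real"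
  assumes U: "open_in M U" "x \<in> U"
    and A: "\<And>i a b. smooth_fun M U (A i a b)" and B: "\<And>i a b. smooth_fun M U (B i a b)"
    and k: "\<And>y. y \<in> U \<Longrightarrow> dim (range (coeff_map A y)) = k"
    and l: "\<And>y. y \<in> U \<Longrightarrow> dim (range (coeff_map B y)) = l"
    and ker: "\<And>y. y \<in> U \<Longrightarrow>
      dim {t + u | t u. t \<in> kernel (coeff_map A y) \<and> u \<in> kernel (coeff_map B y)} = CARD('r)"
  obtains V u where "open_in M V" "x \<in> V" "V \<subseteq> U"
    "\<And>i j. smooth_fun M V (\<lambda>y. u i y $ j)"
    "\<And>i y. y \<in> V \<Longrightarrow> coeff_map A y (u i y) = (\<chi> a b. A i a b y)"
    "\<And>i y. y \<in> V \<Longrightarrow> coeff_map B y (u i y) = 0"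
proof -
  define C where "C y t = (coeff_map A y t, coeff_map B y t)" for y t
  have C: "linear (C y)" for y
    unfolding C_def
    by (intro linearI) (simp_all add: linear_add[OF linear_coeff_map] linear_cmul[OF linear_coeff_map])
  have dimC: "dim {t. C y t = 0} = CARD('r) - k - l" if "y \<in> U" for y
    using kernel_sum_Int_dim(1)[OF linear_coeff_map linear_coeff_map ker[OF that]] k[OF that] l[OF that]
    by (simp add: C_def)
  have "subspace {t. C x t = 0}"
    using C by (simp add: subspace_def linear_0 linear_add linear_cmul)
  then obtain D where D: "finite D" "span D = {t. C x t = 0}"
    using basis_exists[of "{t. C x t = 0}"] finiteI_independent span_subspace by metis
  \<comment> \<open>Only the factor \<open>C y\<close> varies; the value \<open>C x\<close> and the
    basis \<open>D\<close> of its kernel are frozen at the base point, so smoothness of the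
    coefficients passes to the entries.\<close>
  define G :: "'m \<Rightarrow> real^'r^'r" where
    "G y = (\<chi> m n. C y (axis n 1) \<bullet> C x (axis m 1) + (\<Sum>b\<in>D. b $ n * b $ m))" for y
  \<comment> \<open>The right-hand side of the Gram system for the prescribed image: the value of A
    at the i-th unit vector, and 0 for B.\<close>
  define h :: "'r \<Rightarrow> 'm \<Rightarrow> real^'r" where
    "h i y = (\<chi> m. (coeff_map A y (axis i 1), 0) \<bullet> C x (axis m 1))" for i y
  define V where "V = {y\<in>U. det (G y) \<noteq> 0}"
  have inner_A: "smooth_fun M U (\<lambda>y. coeff_map A y (axis n 1) \<bullet> c)" for n c
    unfolding coeff_map_axis inner_vec_def vec_lambda_beta inner_real_def
    by (intro smooth_fun_sum smooth_fun_mult smooth_fun_const U A)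
  have inner_B: "smooth_fun M U (\<lambda>y. coeff_map B y (axis n 1) \<bullet> c)" for n c
    unfolding coeff_map_axis inner_vec_def vec_lambda_beta inner_real_def
    by (intro smooth_fun_sum smooth_fun_mult smooth_fun_const U B)
  have smooth_G: "smooth_fun M U (\<lambda>y. G y $ m $ n)" for m n
    unfolding G_def vec_lambda_beta C_def inner_Pair
    by (intro smooth_fun_add smooth_fun_const U inner_A inner_B)
  have smooth_h: "smooth_fun M U (\<lambda>y. h i y $ m)" for i m
    unfolding h_def vec_lambda_beta C_def inner_Pair
    by (intro smooth_fun_add smooth_fun_const U inner_A)
  have V: "open_in M V" "V \<subseteq> U"
    unfolding V_def using open_in_nonzero[OF U(1) smooth_fun_det[OF U(1) smooth_G]] by auto
  define u :: "'r \<Rightarrow> 'm \<Rightarrow> real^'r" where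
    "u i y = (\<chi> j. det (\<chi> m n. if n = j then h i y $ m else G y $ m $ n) / det (G y))" for i y
  have "smooth_fun M V (\<lambda>y. u i y $ j)" for i j
  proof -
    have "smooth_fun M U (\<lambda>y. (\<chi> m n. if n = j then h i y $ m else G y $ m $ n) $ m $ n)" for m n
      by (cases "n = j") (simp_all add: smooth_G smooth_h)
    then show ?thesis
      unfolding u_def vec_lambda_beta
      by (intro smooth_fun_divide V smooth_fun_subset[OF smooth_fun_det[OF U(1)]] smooth_G)
         (simp_all add: V_def)
  qed
  moreover have "coeff_map A y (u i y) = (\<chi> a b. A i a b y) \<and> coeff_map B y (u i y) = 0"
    if y: "y \<in> V" for i y
  proof -
    have "y \<in> U" "det (G y) \<noteq> 0" using y by (auto simp: V_def)
    have "axis i 1 \<in> {t + u | t u. t \<in> kernel (coeff_map A y) \<and> u \<in> kernel (coeff_map B y)}"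
      using kernel_sum_Int_dim(2)[OF linear_coeff_map linear_coeff_map ker[OF \<open>y \<in> U\<close>]] by simp
    then obtain t w where tw: "axis i 1 = t + w" "coeff_map A y t = 0" "coeff_map B y w = 0"
      by (auto simp: kernel_def)
    then have Aw: "coeff_map A y (axis i 1) = coeff_map A y w"
      by (simp add: linear_add[OF linear_coeff_map])
    have "G y *v u i y = h i y"
      using cramer[OF \<open>det (G y) \<noteq> 0\<close>] unfolding u_def by blast
    also have "\<dots> = (\<chi> m. C y w \<bullet> C x (axis m 1))"
      by (simp add: h_def Aw C_def tw(3))
    finally have "C y (u i y) = C y w"
      using \<open>det (G y) \<noteq> 0\<close> dimC[OF \<open>y \<in> U\<close>] dimC[OF U(2)] unfolding G_def
      by (intro gram_matrix_solution[OF C C D]) simp_all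
    then show ?thesis
      by (simp add: C_def tw(3) Aw[symmetric] coeff_map_axis)
  qed
  moreover have "x \<in> V"
    using det_gram_matrix_nonzero[OF C D] U(2) by (simp add: V_def G_def)
  ultimately show ?thesis
    using that[of V u] V by blast
qed

end

section \<open>The decomposition of the ideal\<close>

lemma bij_betw_map_sum:
  assumes "bij_betw f A B" "bij_betw g C D"
  shows "bij_betw (map_sum f g) (A <+> C) (B <+> D)"
  unfolding bij_betw_def
proof
  show "inj_on (map_sum f g) (A <+> C)"
    using assms[THEN bij_betw_imp_inj_on] by (auto intro!: inj_onI dest: inj_onD)
  show "map_sum f g ` (A <+> C) = B <+> D"
    using assms[THEN bij_betw_imp_surj_on]
    by (simp only: Plus_def image_Un image_image map_sum.simps) (simp only: image_image[symmetric])
qed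

lemma coframe_on_reindex:
  assumes "coframe_on M U L \<eta>" "bij_betw h K L" "\<And>k. k \<in> K \<Longrightarrow> \<eta>' k = \<eta> (h k)"
  shows "coframe_on M U K \<eta>'"
proof -
  have K: "h ` K = L" "inj_on h K" using assms(2) by (auto simp: bij_betw_def)
  have img: "(\<lambda>k. \<eta>' k x) ` K = (\<lambda>k. \<eta> k x) ` L" for x
    unfolding K(1)[symmetric] image_image using assms(3) by (intro image_cong) auto
  have "inj_on (\<lambda>k. \<eta>' k x) K" if "inj_on (\<lambda>k. \<eta> k x) L" for x
    using that K assms(3) unfolding inj_on_def by (metis imageI)
  moreover have "form1 U (\<eta>' k) \<in> forms M U" if "k \<in> K" for k
    using assms(1,3) K(1) that unfolding coframe_on_def by auto
  ultimately show ?thesis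
    using assms(1) unfolding coframe_on_def img by blast
qed

lemma sum_scale_form: "(\<Sum>j\<in>A. f j *\<^sub>f \<omega>) = (\<lambda>x. \<Sum>j\<in>A. f j x) *\<^sub>f \<omega>"
  by (simp add: fun_eq_iff sum_fun_apply scale_form_def sum_distrib_right)

lemma scale_form_sum: "f *\<^sub>f (\<Sum>j\<in>A. \<omega> j) = (\<Sum>j\<in>A. f *\<^sub>f \<omega> j)"
  by (simp add: fun_eq_iff sum_fun_apply scale_form_def sum_distrib_left)

lemma scale_form_scale_form: "f *\<^sub>f g *\<^sub>f \<omega> = (\<lambda>x. f x * g x) *\<^sub>f \<omega>"
  by (simp add: fun_eq_iff scale_form_def)

definition quadratic_form ::
  "'m set \<Rightarrow> ('k::finite \<Rightarrow> 'm \<Rightarrow> 'e::euclidean_space \<Rightarrow>\<^sub>L real) \<Rightarrow> ('k \<Rightarrow> 'k \<Rightarrow> 'm \<Rightarrow> real) \<Rightarrow> ('m, 'e) form" where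
  "quadratic_form U \<sigma> F = (\<Sum>a\<in>UNIV. \<Sum>b\<in>UNIV. F a b *\<^sub>f (form1 U (\<sigma> a) \<and>\<^sub>f form1 U (\<sigma> b)))"

lemma wedge_form1_outside: "x \<notin> U \<Longrightarrow> (form1 U \<zeta> \<and>\<^sub>f \<omega>) x vs = 0"
  by (simp add: wedge_def wedge_pt_def form1_def)

text \<open>The identity of coefficients is required on \<open>U\<close> only, because outside
  \<open>U\<close> the wedge products vanish whatever the coefficients are.\<close>

lemma sum_scale_quadratic_form:
  assumes "\<And>x a b. x \<in> U \<Longrightarrow> (\<Sum>j\<in>UNIV. f x $ j * A j a b x) = F a b x"
  shows "(\<Sum>j\<in>UNIV. (\<lambda>x. f x $ j) *\<^sub>f quadratic_form U \<sigma> (A j)) = quadratic_form U \<sigma> F"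
proof -
  have "(\<Sum>j\<in>UNIV. (\<lambda>x. f x $ j) *\<^sub>f quadratic_form U \<sigma> (A j)) =
      (\<Sum>a\<in>UNIV. \<Sum>b\<in>UNIV. \<Sum>j\<in>UNIV. (\<lambda>x. f x $ j * A j a b x) *\<^sub>f (form1 U (\<sigma> a) \<and>\<^sub>f form1 U (\<sigma> b)))"
    unfolding quadratic_form_def scale_form_sum scale_form_scale_form
    by (subst sum.swap, rule sum.cong[OF refl], rule sum.swap)
  also have "\<dots> = quadratic_form U \<sigma> F"
    unfolding quadratic_form_def sum_scale_form
  proof (intro sum.cong refl ext)
    fix a b x vs
    show "((\<lambda>x. \<Sum>j\<in>UNIV. f x $ j * A j a b x) *\<^sub>f (form1 U (\<sigma> a) \<and>\<^sub>f form1 U (\<sigma> b))) x vs =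
        (F a b *\<^sub>f (form1 U (\<sigma> a) \<and>\<^sub>f form1 U (\<sigma> b))) x vs"
      by (cases "x \<in> U") (simp_all add: scale_form_def assms wedge_form1_outside)
  qed
  finally show ?thesis .
qed

lemma quadratic_form_zero: "quadratic_form U \<sigma> (\<lambda>a b x. 0) = 0"
  by (simp add: quadratic_form_def fun_eq_iff sum_fun_apply scale_form_def)

lemma two_form_comb_quadratic_form:
  fixes \<sigma> :: "'p::finite \<Rightarrow> 'm \<Rightarrow> 'e::euclidean_space \<Rightarrow>\<^sub>L real"
  assumes "\<And>a b. smooth_fun M U (F a b)" "bij_betw h {..<CARD('p)} UNIV"
  shows "two_form_comb M U CARD('p) (\<lambda>a. \<sigma> (h a)) (quadratic_form U \<sigma> F)"
  unfolding two_form_comb_def quadratic_form_def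
proof (intro exI[of _ "\<lambda>a b. F (h a) (h b)"] conjI allI impI assms(1))
  show "(\<Sum>a\<in>UNIV. \<Sum>b\<in>UNIV. F a b *\<^sub>f (form1 U (\<sigma> a) \<and>\<^sub>f form1 U (\<sigma> b))) =
    (\<Sum>b<CARD('p). \<Sum>c<CARD('p). F (h b) (h c) *\<^sub>f (form1 U (\<sigma> (h b)) \<and>\<^sub>f form1 U (\<sigma> (h c))))"
    unfolding sum.reindex_bij_betw[OF assms(2), symmetric] ..
qed

text \<open>A skew array over a single index is zero. This yields the bounds p, q \<ge> 2 that
  decomposability asks for.\<close>

lemma card_ge_2_if_skew:
  fixes A :: "'r::finite \<Rightarrow> 'k::finite \<Rightarrow> 'k \<Rightarrow> 'm \<Rightarrow> real"
  assumes "\<And>i a b. A i a b x = - A i b a x" "coeff_map A x \<noteq> 0"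
  shows "CARD('k) \<ge> 2"
proof -
  have "\<exists>i a b. A i a b x \<noteq> 0"
  proof (rule ccontr)
    assume "\<not> ?thesis"
    then have "coeff_map A x = 0" by (simp add: fun_eq_iff coeff_map_def vec_eq_iff)
    then show False using assms(2) by blast
  qed
  then obtain i a b where ab: "A i a b x \<noteq> 0" by blast
  then have "a \<noteq> b" using assms(1)[of i a a] by auto
  then have "card {a, b} = 2" by simp
  then show ?thesis using card_mono[of UNIV "{a, b}"] by simp
qed

section \<open>Exchange of generators, and the mixed terms\<close>

context smooth_mfd
begin

lemma form_ideal_hull_minimal: "G \<subseteq> J \<Longrightarrow> form_ideal M U J \<Longrightarrow> form_ideal M U hull G \<subseteq> J"
  by (rule hull_minimal)

text \<open>The covectors outside \<iota> vanish on \<open>S\<close>, so the expansion in the dual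
  frame puts \<open>S\<close> into the span of the dual vectors along \<iota>. That span has at most
  the dimension of \<open>S\<close>, so the two are equal.\<close>

lemma dual_frame_in_subspace:
  fixes \<eta> :: "'k::finite \<Rightarrow> 'm \<Rightarrow> 'e \<Rightarrow>\<^sub>L real" and \<iota> :: "'p::finite \<Rightarrow> 'k"
  assumes cof: "coframe_on M U UNIV \<eta>" "x \<in> U" and S: "subspace S" "dim S = CARD('p)"
    and 0: "\<And>k v. v \<in> S \<Longrightarrow> k \<notin> range \<iota> \<Longrightarrow> \<eta> k x v = 0"
  shows "dual_frame \<eta> x (\<iota> a) \<in> S"
proof -
  let ?E = "range (\<lambda>a. dual_frame \<eta> x (\<iota> a))"
  have "S \<subseteq> span ?E"
  proof
    fix v assume v: "v \<in> S"
    have "dual_frame \<eta> x k \<in> span ?E" if "k \<in> range \<iota>" for k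
      using that by (auto intro: span_base)
    then have "\<eta> k x v *\<^sub>R dual_frame \<eta> x k \<in> span ?E" for k
      using 0[OF v, of k] by (cases "k \<in> range \<iota>") (auto intro: span_scale simp: span_zero)
    then have "(\<Sum>k\<in>UNIV. \<eta> k x v *\<^sub>R dual_frame \<eta> x k) \<in> span ?E"
      by (intro span_sum)
    then show "v \<in> span ?E" using dual_frame_expansion[OF cof, of v] by simp
  qed
  moreover have "dim (span ?E) \<le> dim S"
    unfolding dim_span S(2) by (rule order.trans[OF dim_le_card' card_image_le]) auto
  ultimately have "S = span ?E"
    using S(1) by (intro subspace_dim_equal) auto
  then show ?thesis by (auto intro: span_base)
qed

text \<open>The structure equations hold modulo the ideal of sections, and that ideal lies in both
  hulls because both contain the \<theta>. Inside either hull the congruences can thus be used to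
  exchange generators without tracking the terms in \<theta>.\<close>

lemma pfaffian_ideal_eq_split_hull:
  fixes \<theta> :: "'r::finite \<Rightarrow> 'm \<Rightarrow> 'e \<Rightarrow>\<^sub>L real"
    and \<sigma> :: "'p::finite \<Rightarrow> 'm \<Rightarrow> 'e \<Rightarrow>\<^sub>L real" and \<tau> :: "'q::finite \<Rightarrow> 'm \<Rightarrow> 'e \<Rightarrow>\<^sub>L real"
  assumes U: "open_in M U" and cof: "coframe_on M U UNIV (case_sum \<theta> (case_sum \<sigma> \<tau>))"
    and I: "\<And>x. x \<in> U \<Longrightarrow> I x = span (range (\<lambda>i. \<theta> i x))"
    and AB: "structure_coeffs M I U \<theta> \<sigma> \<tau> A B"
    and u: "\<And>i j. smooth_fun M U (\<lambda>y. u i y $ j)"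
      "\<And>i y. y \<in> U \<Longrightarrow> coeff_map A y (u i y) = (\<chi> a b. A i a b y)"
      "\<And>i y. y \<in> U \<Longrightarrow> coeff_map B y (u i y) = 0"
  shows "pfaffian_ideal M I U = form_ideal M U hull
    (range (\<lambda>i. form1 U (\<theta> i)) \<union> range (\<lambda>i. quadratic_form U \<sigma> (A i)) \<union> range (\<lambda>i. quadratic_form U \<tau> (B i)))"
    (is "_ = form_ideal M U hull ?G")
proof -
  let ?\<theta> = "\<lambda>i. form1 U (\<theta> i)" and ?d = "\<lambda>i. ext_deriv M U (form1 U (\<theta> i))"
  let ?\<Phi> = "\<lambda>i. quadratic_form U \<sigma> (A i)" and ?\<Psi> = "\<lambda>i. quadratic_form U \<tau> (B i)"
  let ?K = "form_ideal M U hull (range ?\<theta> \<union> range ?d)" and ?N = "form_ideal M U hull ?G"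
  let ?S = "form_ideal M U hull pfaffian_sections M I U"
  have \<theta>: "?\<theta> i \<in> forms M U" for i
    using coframe_form1[OF cof, of "Inl i"] by simp
  have \<sigma>: "form1 U (\<sigma> a) \<in> forms M U" for a
    using coframe_form1[OF cof, of "Inr (Inl a)"] by simp
  have \<tau>: "form1 U (\<tau> a) \<in> forms M U" for a
    using coframe_form1[OF cof, of "Inr (Inr a)"] by simp
  note fi = form_ideal_forms[OF U]
  have "?\<Phi> i \<in> forms M U" "?\<Psi> i \<in> forms M U" for i
    using AB unfolding quadratic_form_def structure_coeffs_def
    by (intro form_ideal_sum[OF fi] form_ideal_scale[OF U fi] forms_wedge[OF U] \<sigma> \<tau>; blast)+
  then have K: "form_ideal M U ?K" and N: "form_ideal M U ?N"
    using \<theta> forms_ext_deriv[OF U \<theta>] by (auto intro!: form_ideal_hull[OF U])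
  have diff: "?d i - (?\<Phi> i + ?\<Psi> i) \<in> ?S" for i
    using AB unfolding structure_coeffs_def cong_mod_def quadratic_form_def by blast
  have S_sub: "?S \<subseteq> J" if "form_ideal M U J" "\<And>i. ?\<theta> i \<in> J" for J
    by (intro form_ideal_hull_minimal sections_subset_hull[OF U cof I] that)
  have SK: "?S \<subseteq> ?K"
    by (rule S_sub[OF K]) (auto intro: hull_inc)
  have SN: "?S \<subseteq> ?N"
    by (rule S_sub[OF N]) (auto intro: hull_inc)
  have "?K \<subseteq> ?N"
  proof (rule form_ideal_hull_minimal[OF _ N])
    have "?d i \<in> ?N" for i
    proof -
      have "?\<Phi> i \<in> ?N" "?\<Psi> i \<in> ?N" by (auto intro!: hull_inc)
      then have "(?d i - (?\<Phi> i + ?\<Psi> i)) + (?\<Phi> i + ?\<Psi> i) \<in> ?N"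
        using diff[of i] SN by (intro form_ideal_add[OF N]) auto
      then show ?thesis by simp
    qed
    moreover have "?\<theta> i \<in> ?N" for i by (rule hull_inc; blast)
    ultimately show "range ?\<theta> \<union> range ?d \<subseteq> ?N" by blast
  qed
  moreover have "?N \<subseteq> ?K"
  proof (rule form_ideal_hull_minimal[OF _ K])
    have sum: "?\<Phi> i + ?\<Psi> i \<in> ?K" for i
    proof -
      have "?d i \<in> ?K" by (rule hull_inc; blast)
      then have "?d i - (?d i - (?\<Phi> i + ?\<Psi> i)) \<in> ?K"
        by (rule form_ideal_diff[OF U K _ subsetD[OF SK diff]])
      then show ?thesis by simp
    qed
    have \<Phi>: "?\<Phi> i \<in> ?K" for i
    proof -
      \<comment> \<open>The vector \<open>u i\<close> has the same image under A as the i-th unit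
        vector and image 0 under B: this combination keeps exactly \<open>?\<Phi> i\<close> of the
        \<sigma> block and nothing of the \<tau> block.\<close>
      have "(\<Sum>j\<in>UNIV. (\<lambda>x. u i x $ j) *\<^sub>f (?\<Phi> j + ?\<Psi> j)) \<in> ?K"
        by (intro form_ideal_sum[OF K] form_ideal_scale[OF U K] u sum)
      moreover have "(\<Sum>j\<in>UNIV. (\<lambda>x. u i x $ j) *\<^sub>f (?\<Phi> j + ?\<Psi> j)) =
        (\<Sum>j\<in>UNIV. (\<lambda>x. u i x $ j) *\<^sub>f ?\<Phi> j) + (\<Sum>j\<in>UNIV. (\<lambda>x. u i x $ j) *\<^sub>f ?\<Psi> j)"
        by (simp add: fun_eq_iff sum_fun_apply scale_form_def distrib_left sum.distrib)
      moreover have "(\<Sum>j\<in>UNIV. (\<lambda>x. u i x $ j) *\<^sub>f ?\<Phi> j) = ?\<Phi> i"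
        using u(2) by (intro sum_scale_quadratic_form) (simp add: coeff_map_def vec_eq_iff)
      moreover have "(\<Sum>j\<in>UNIV. (\<lambda>x. u i x $ j) *\<^sub>f ?\<Psi> j) = quadratic_form U \<tau> (\<lambda>a b x. 0)"
        using u(3) by (intro sum_scale_quadratic_form) (simp add: coeff_map_def vec_eq_iff)
      ultimately show ?thesis by (simp add: quadratic_form_zero)
    qed
    have "(?\<Phi> i + ?\<Psi> i) - ?\<Phi> i \<in> ?K" for i
      by (rule form_ideal_diff[OF U K sum \<Phi>])
    moreover have "?\<theta> i \<in> ?K" for i by (rule hull_inc; blast)
    ultimately show "?G \<subseteq> ?K" using \<Phi> by auto
  qed
  ultimately show ?thesis
    using pfaffian_ideal_eq_hull[OF U cof I] by simp
qed

lemma pfaffian_ideal_generators: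
  fixes \<theta> :: "'r::finite \<Rightarrow> 'm \<Rightarrow> 'e \<Rightarrow>\<^sub>L real" and \<rho> :: "'k::finite \<Rightarrow> 'm \<Rightarrow> 'e \<Rightarrow>\<^sub>L real"
  assumes U: "open_in M U" and cof: "coframe_on M U UNIV (case_sum \<theta> \<rho>)"
    and I: "\<And>x. x \<in> U \<Longrightarrow> I x = span (range (\<lambda>i. \<theta> i x))"
  shows "form1 U (\<theta> i) \<in> pfaffian_ideal M I U" "ext_deriv M U (form1 U (\<theta> i)) \<in> pfaffian_ideal M I U"
proof -
  have eq: "pfaffian_ideal M I U =
    form_ideal M U hull (range (\<lambda>i. form1 U (\<theta> i)) \<union> range (\<lambda>i. ext_deriv M U (form1 U (\<theta> i))))"
    by (rule pfaffian_ideal_eq_hull[OF U cof I])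
  show "form1 U (\<theta> i) \<in> pfaffian_ideal M I U" "ext_deriv M U (form1 U (\<theta> i)) \<in> pfaffian_ideal M I U"
    unfolding eq by (auto intro!: hull_inc)
qed

text \<open>The \<theta>, as 1-forms of the ideal, vanish on \<open>E1\<close>, and adaptedness
  kills one of the other blocks on each summand; hence the dual vectors of \<sigma> and \<tau> lie
  in \<open>S\<^sub>1 x\<close> and \<open>S\<^sub>2 x\<close>. They span an integral plane, where d
  \<theta>, a member of the ideal, takes the value 0.\<close>

lemma mixed_terms_vanish:
  fixes \<theta> :: "'r::finite \<Rightarrow> 'm \<Rightarrow> 'e \<Rightarrow>\<^sub>L real"
    and \<sigma> :: "'p::finite \<Rightarrow> 'm \<Rightarrow> 'e \<Rightarrow>\<^sub>L real" and \<tau> :: "'q::finite \<Rightarrow> 'm \<Rightarrow> 'e \<Rightarrow>\<^sub>L real"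
  defines "\<eta> \<equiv> case_sum \<theta> (case_sum \<sigma> \<tau>)"
  assumes U: "open_in M U" and ac: "adapted_coframe M I S\<^sub>1 S\<^sub>2 U \<theta> \<sigma> \<tau>" and x: "x \<in> U"
    and S1: "subspace (S\<^sub>1 x)" "dim (S\<^sub>1 x) = CARD('p)" and S2: "subspace (S\<^sub>2 x)" "dim (S\<^sub>2 x) = CARD('q)"
    and ds: "E1 M (pfaffian_ideal M I) x = {X + Y | X Y. X \<in> S\<^sub>1 x \<and> Y \<in> S\<^sub>2 x}" "S\<^sub>1 x \<inter> S\<^sub>2 x = {0}"
    and int: "\<And>X Y. X \<in> S\<^sub>1 x \<Longrightarrow> Y \<in> S\<^sub>2 x \<Longrightarrow> dim (span {X, Y}) = 2 \<Longrightarrow>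
      integral_2plane M (pfaffian_ideal M I) x (span {X, Y})"
  shows "ext_deriv M U (form1 U (\<theta> i)) x [dual_frame \<eta> x (Inr (Inl a)), dual_frame \<eta> x (Inr (Inr \<alpha>))] = 0"
proof -
  have cof: "coframe_on M U UNIV \<eta>" and I: "\<And>x. x \<in> U \<Longrightarrow> I x = span (range (\<lambda>i. \<theta> i x))"
    and \<sigma>: "\<And>a v. v \<in> S\<^sub>2 x \<Longrightarrow> \<sigma> a x v = 0" and \<tau>: "\<And>a v. v \<in> S\<^sub>1 x \<Longrightarrow> \<tau> a x v = 0"
    using ac x unfolding adapted_coframe_def \<eta>_def by auto
  note gen = pfaffian_ideal_generators[OF U cof[unfolded \<eta>_def] I]
  have \<theta>0: "\<theta> i x v = 0" if "v \<in> E1 M (pfaffian_ideal M I) x" for i v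
  proof -
    have "form1 U (\<theta> i) x [v] = 0"
      using that gen(1)[of i] U x homogeneous_form1 unfolding E1_def by blast
    then show ?thesis by (simp add: form1_singleton x)
  qed
  have "v \<in> E1 M (pfaffian_ideal M I) x" if "v \<in> S\<^sub>1 x \<union> S\<^sub>2 x" for v
  proof -
    have "v = v + 0" "v = 0 + v" by simp_all
    then show ?thesis
      unfolding ds(1) using that subspace_0[OF S1(1)] subspace_0[OF S2(1)] by blast
  qed
  with \<theta>0 have \<theta>S: "\<theta> i x v = 0" if "v \<in> S\<^sub>1 x \<union> S\<^sub>2 x" for i v using that by blast
  let ?X = "dual_frame \<eta> x (Inr (Inl a))" and ?Y = "dual_frame \<eta> x (Inr (Inr \<alpha>))"
  have X: "?X \<in> S\<^sub>1 x"
  proof (rule dual_frame_in_subspace[OF cof x S1])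
    fix k :: "'r + 'p + 'q" and v assume "v \<in> S\<^sub>1 x" "k \<notin> range (\<lambda>a. Inr (Inl a))"
    then show "\<eta> k x v = 0"
      using \<theta>S \<tau> by (auto simp: \<eta>_def split: sum.split)
  qed
  have Y: "?Y \<in> S\<^sub>2 x"
  proof (rule dual_frame_in_subspace[OF cof x S2])
    fix k :: "'r + 'p + 'q" and v assume "v \<in> S\<^sub>2 x" "k \<notin> range (\<lambda>a. Inr (Inr a))"
    then show "\<eta> k x v = 0"
      using \<theta>S \<sigma> by (auto simp: \<eta>_def split: sum.split)
  qed
  have nz: "dual_frame \<eta> x k \<noteq> 0" for k
    using dual_frame[OF cof x, of k k] by auto
  \<comment> \<open>Directness of the sum gives the independence which makes the spanned plane
    two-dimensional, as \<open>int\<close> demands.\<close>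
  have "?X \<notin> span {?Y}"
  proof
    assume "?X \<in> span {?Y}"
    moreover have "span {?Y} \<subseteq> S\<^sub>2 x" using Y S2(1) by (intro span_minimal) auto
    ultimately have "?X \<in> S\<^sub>1 x \<inter> S\<^sub>2 x" using X by blast
    then show False using ds(2) nz by blast
  qed
  moreover have "?X \<noteq> ?Y" using calculation by (metis insertI1 span_base)
  ultimately have "independent {?X, ?Y}"
    using nz by (simp add: independent_insert)
  then have "dim (span {?X, ?Y}) = 2"
    using \<open>?X \<noteq> ?Y\<close> by (simp add: dim_eq_card_independent)
  then have "integral_2plane M (pfaffian_ideal M I) x (span {?X, ?Y})"
    by (rule int[OF X Y])
  moreover have "set [?X, ?Y] \<subseteq> span {?X, ?Y}" by (auto intro: span_base)
  ultimately show ?thesis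
    using gen(2)[of i] U x unfolding integral_2plane_def by blast
qed

end

theorem theorem2p3:
  fixes M :: "('m, 'e::euclidean_space) manifold"
    and I :: "'m \<Rightarrow> ('e \<Rightarrow>\<^sub>L real) set"
    and S\<^sub>1 S\<^sub>2 :: "'m \<Rightarrow> 'e set"
  assumes manifold: "smooth_manifold M"
    and pfaffian: "pfaffian_system M CARD('r::finite) I"
    and S1: "tangent_subbundle M CARD('p::finite) S\<^sub>1"
    and S2: "tangent_subbundle M CARD('q::finite) S\<^sub>2"
    and direct_sum: "\<forall>x\<in>pts M. E1 M (pfaffian_ideal M I) x = {X + Y | X Y. X \<in> S\<^sub>1 x \<and> Y \<in> S\<^sub>2 x} \<and>
                                S\<^sub>1 x \<inter> S\<^sub>2 x = {0}"
    and singular: "\<forall>x\<in>pts M. \<forall>X\<in>S\<^sub>1 x \<union> S\<^sub>2 x. X \<noteq> 0 \<longrightarrow>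
                     singular_vector M (pfaffian_ideal M I) x X"
    and integral: "\<forall>x\<in>pts M. \<forall>X\<in>S\<^sub>1 x. \<forall>Y\<in>S\<^sub>2 x. dim (span {X, Y}) = 2 \<longrightarrow>
                     integral_2plane M (pfaffian_ideal M I) x (span {X, Y})"
    and coframes: "\<forall>x\<in>pts M. \<exists>U \<theta> \<sigma> \<tau>.
       open_in M U \<and> x \<in> U \<and>
       adapted_coframe M I S\<^sub>1 S\<^sub>2 U (\<theta> :: 'r \<Rightarrow> 'm \<Rightarrow> 'e \<Rightarrow>\<^sub>L real)
         (\<sigma> :: 'p \<Rightarrow> 'm \<Rightarrow> 'e \<Rightarrow>\<^sub>L real) (\<tau> :: 'q \<Rightarrow> 'm \<Rightarrow> 'e \<Rightarrow>\<^sub>L real) \<and>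
       (\<forall>A B. structure_coeffs M I U \<theta> \<sigma> \<tau> A B \<longrightarrow>
          (\<forall>y\<in>U. coeff_map A y \<noteq> 0 \<and> coeff_map B y \<noteq> 0) \<and>
          (\<exists>k. \<forall>y\<in>U. dim (range (coeff_map A y)) = k) \<and>
          (\<exists>l. \<forall>y\<in>U. dim (range (coeff_map B y)) = l) \<and>
          (\<forall>y\<in>U. dim {t + u | t u. t \<in> kernel (coeff_map A y) \<and> u \<in> kernel (coeff_map B y)}
                   = CARD('r)))"
  shows "decomposable M (pfaffian_ideal M I)"
proof (cases "pts M = {}")
  case True
  \<comment> \<open>Without points no coefficients bound p and q from below, so the smallest
    admissible type is named; its condition at points is vacuous.\<close>
  then have "decomposable_of_type M (pfaffian_ideal M I) 2 2"
    by (simp add: decomposable_of_type_def)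
  then show ?thesis unfolding decomposable_def by blast
next
  case False
  interpret smooth_mfd M by unfold_locales (rule manifold)
  obtain hr hp hq where h: "bij_betw hr {..<CARD('r)} (UNIV :: 'r set)"
    "bij_betw hp {..<CARD('p)} (UNIV :: 'p set)" "bij_betw hq {..<CARD('q)} (UNIV :: 'q set)"
    using ex_bij_betw_nat_finite[OF finite] unfolding atLeast0LessThan by metis
  have local: "CARD('p) \<ge> 2 \<and> CARD('q) \<ge> 2 \<and> (\<exists>U r s t \<theta> \<sigma> \<tau> \<Omega> \<Psi>.
        open_in M U \<and> x \<in> U \<and> s \<ge> (1::nat) \<and> t \<ge> (1::nat) \<and>
        coframe_on M U ({..<r::nat} <+> ({..<CARD('p)} <+> {..<CARD('q)})) (case_sum \<theta> (case_sum \<sigma> \<tau>)) \<and>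
        (\<forall>a<s. two_form_comb M U CARD('p) \<sigma> (\<Omega> a)) \<and>
        (\<forall>a<t. two_form_comb M U CARD('q) \<tau> (\<Psi> a)) \<and>
        pfaffian_ideal M I U = form_ideal M U hull
                ((\<lambda>i. form1 U (\<theta> i)) ` {..<r} \<union> \<Omega> ` {..<s} \<union> \<Psi> ` {..<t}))"
    if x: "x \<in> pts M" for x
  proof -
    obtain U and \<theta> :: "'r \<Rightarrow> 'm \<Rightarrow> 'e \<Rightarrow>\<^sub>L real" and \<sigma> :: "'p \<Rightarrow> 'm \<Rightarrow> 'e \<Rightarrow>\<^sub>L real"
      and \<tau> :: "'q \<Rightarrow> 'm \<Rightarrow> 'e \<Rightarrow>\<^sub>L real"
      where U: "open_in M U" "x \<in> U" and ac: "adapted_coframe M I S\<^sub>1 S\<^sub>2 U \<theta> \<sigma> \<tau>"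
        and hyp: "\<forall>A B. structure_coeffs M I U \<theta> \<sigma> \<tau> A B \<longrightarrow>
          (\<forall>y\<in>U. coeff_map A y \<noteq> 0 \<and> coeff_map B y \<noteq> 0) \<and>
          (\<exists>k. \<forall>y\<in>U. dim (range (coeff_map A y)) = k) \<and>
          (\<exists>l. \<forall>y\<in>U. dim (range (coeff_map B y)) = l) \<and>
          (\<forall>y\<in>U. dim {t + u | t u. t \<in> kernel (coeff_map A y) \<and> u \<in> kernel (coeff_map B y)}
                   = CARD('r))"
      using coframes[rule_format, OF x] by blast
    let ?\<eta> = "case_sum \<theta> (case_sum \<sigma> \<tau>)"
    define A where "A i a b = struct_coeff ?\<eta> (\<theta> i) (Inr (Inl a)) (Inr (Inl b))" for i a b
    define B where "B i a b = struct_coeff ?\<eta> (\<theta> i) (Inr (Inr a)) (Inr (Inr b))" for i a b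
    have cof: "coframe_on M U UNIV ?\<eta>" and I: "\<And>x. x \<in> U \<Longrightarrow> I x = span (range (\<lambda>i. \<theta> i x))"
      using ac unfolding adapted_coframe_def by auto
    have cross: "ext_deriv M U (form1 U (\<theta> i)) y [dual_frame ?\<eta> y (Inr (Inl a)), dual_frame ?\<eta> y (Inr (Inr \<alpha>))] = 0"
      if y: "y \<in> U" for y i a \<alpha>
    proof -
      have y': "y \<in> pts M" by (rule open_in_pts[OF U(1) y])
      show ?thesis
        by (rule mixed_terms_vanish[OF U(1) ac y])
           (use S1 S2 direct_sum integral y' in \<open>auto simp: tangent_subbundle_def\<close>)
    qed
    \<comment> \<open>Stated for every smaller open set: the case \<open>U\<close> unlocks the
      hypotheses on \<open>A\<close> and \<open>B\<close>, and the case of the smaller domain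
      carrying the smooth vectors \<open>u\<close> serves to exchange the generators.\<close>
    have AB: "structure_coeffs M I V \<theta> \<sigma> \<tau> A B" if V: "open_in M V" "V \<subseteq> U" for V
    proof -
      have "ext_deriv M V (form1 V (\<theta> i)) y [dual_frame ?\<eta> y (Inr (Inl a)), dual_frame ?\<eta> y (Inr (Inr \<alpha>))] = 0"
        if "y \<in> V" for y i a \<alpha>
        using cross[of y i a \<alpha>] that V ext_deriv_UNIV[OF V(1) that] ext_deriv_UNIV[OF U(1), of y] by auto
      then show ?thesis
        unfolding A_def B_def
        by (intro structure_coeffs_struct_coeff[OF V(1) coframe_on_subset[OF cof V] I]) (use V in auto)
    qed
    note ABU = AB[OF U(1) order_refl]
    have smooth: "\<And>i a b. smooth_fun M U (A i a b)" "\<And>i a b. smooth_fun M U (B i a b)"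
      and skew: "\<And>i a b. A i a b x = - A i b a x" "\<And>i a b. B i a b x = - B i b a x"
      using ABU U(2) unfolding structure_coeffs_def by blast+
    obtain k l where kl: "\<And>y. y \<in> U \<Longrightarrow> dim (range (coeff_map A y)) = k"
      "\<And>y. y \<in> U \<Longrightarrow> dim (range (coeff_map B y)) = l"
      and ker: "\<And>y. y \<in> U \<Longrightarrow>
        dim {t + u | t u. t \<in> kernel (coeff_map A y) \<and> u \<in> kernel (coeff_map B y)} = CARD('r)"
      and nz: "coeff_map A x \<noteq> 0" "coeff_map B x \<noteq> 0"
      using hyp[rule_format, OF ABU] U(2) by blast
    obtain V u where V: "open_in M V" "x \<in> V" "V \<subseteq> U"
      and u: "\<And>i j. smooth_fun M V (\<lambda>y. u i y $ j)"
      "\<And>i y. y \<in> V \<Longrightarrow> coeff_map A y (u i y) = (\<chi> a b. A i a b y)"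
      "\<And>i y. y \<in> V \<Longrightarrow> coeff_map B y (u i y) = 0"
      using smooth_kernel_splitting[OF U smooth kl ker] by metis
    have cofV: "coframe_on M V UNIV ?\<eta>"
      by (rule coframe_on_subset[OF cof V(1,3)])
    have IV: "I y = span (range (\<lambda>i. \<theta> i y))" if "y \<in> V" for y
      using I V(3) that by blast
    \<comment> \<open>The hypotheses index the coframe by finite types, while
      \<open>decomposable_of_type\<close> numbers everything by naturals below a bound;
      \<open>hr\<close> translates between the two.\<close>
    have img: "range f = (\<lambda>n. f (hr n)) ` {..<CARD('r)}" for f :: "'r \<Rightarrow> ('m, 'e) form"
      using h(1) by (metis bij_betw_imp_surj_on image_image)
    have "pfaffian_ideal M I V = form_ideal M V hull ((\<lambda>i. form1 V (\<theta> (hr i))) ` {..<CARD('r)} \<union>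
       (\<lambda>i. quadratic_form V \<sigma> (A (hr i))) ` {..<CARD('r)} \<union> (\<lambda>i. quadratic_form V \<tau> (B (hr i))) ` {..<CARD('r)})"
      using pfaffian_ideal_eq_split_hull[OF V(1) cofV IV AB[OF V(1,3)] u] unfolding img .
    moreover have "coframe_on M V ({..<CARD('r)} <+> ({..<CARD('p)} <+> {..<CARD('q)}))
        (case_sum (\<lambda>i. \<theta> (hr i)) (case_sum (\<lambda>a. \<sigma> (hp a)) (\<lambda>a. \<tau> (hq a))))"
    proof (rule coframe_on_reindex[OF cofV])
      show "bij_betw (map_sum hr (map_sum hp hq)) ({..<CARD('r)} <+> ({..<CARD('p)} <+> {..<CARD('q)})) UNIV"
        using bij_betw_map_sum[OF h(1) bij_betw_map_sum[OF h(2,3)]] by simp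
    qed (auto split: sum.split)
    moreover have "two_form_comb M V CARD('p) (\<lambda>a. \<sigma> (hp a)) (quadratic_form V \<sigma> (A (hr i)))"
      "two_form_comb M V CARD('q) (\<lambda>a. \<tau> (hq a)) (quadratic_form V \<tau> (B (hr i)))" for i
      by (intro two_form_comb_quadratic_form h smooth_fun_subset[OF _ V(3)] smooth)+
    \<comment> \<open>Each \<theta> contributes one 2-form to either block, so s and t are both
      \<open>CARD('r)\<close>, which is positive because a type has an element.\<close>
    moreover have "CARD('r) \<ge> 1" by (simp add: Suc_le_eq)
    moreover have "CARD('p) \<ge> 2" "CARD('q) \<ge> 2"
      using card_ge_2_if_skew[OF skew(1) nz(1)] card_ge_2_if_skew[OF skew(2) nz(2)] .
    ultimately show ?thesis
      using V(1,2)
      by (intro conjI exI[of _ V] exI[of _ "CARD('r)"] exI[of _ "\<lambda>i. \<theta> (hr i)"] exI[of _ "\<lambda>a. \<sigma> (hp a)"]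
          exI[of _ "\<lambda>a. \<tau> (hq a)"] exI[of _ "\<lambda>i. quadratic_form V \<sigma> (A (hr i))"]
          exI[of _ "\<lambda>i. quadratic_form V \<tau> (B (hr i))"]) auto
  qed
  then have "decomposable_of_type M (pfaffian_ideal M I) CARD('p) CARD('q)"
    using False unfolding decomposable_of_type_def by blast
  then show ?thesis unfolding decomposable_def by blast
qed

end
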